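(* Let $d\ge 1$ and let $\mathcal H$ be a translation and modulation invariant Hilbert space on $\mathbf R^d$ which contains at least one element of $M^{1,1}(\mathbf R^d)\setminus\{0\}$ and is continuously embedded in $\mathscr D'(\mathbf R^d)$. Then $\mathcal H = L^2(\mathbf R^d)$ (equality as vector spaces of distributions), and there is a constant $c>0$ such that $$ \Vert f\Vert_{\mathcal H} = c\cdot \Vert f\Vert_{L^2(\mathbf R^d)} \qquad\text{for every } f\in \mathcal H = L^2(\mathbf R^d), $$ with $c$ independent of $f$.
   Context: All spaces are complex. $\mathscr D'(\mathbf R^d)$ is the space of distributions on $\mathbf R^d$, $\mathscr S(\mathbf R^d)$ the Schwartz space and $\mathscr S'(\mathbf R^d)$ the space of tempered distributions; functions in $L^2(\mathbf R^d)$ are identified with distributions in the usual way. A Hilbert space $\mathcal H$ of distributions on $\mathbf R^d$ is a linear subspace of the distributions equipped with an inner product $(\,\cdot\,,\,\cdot\,)_{\mathcal H}$ making it a Hilbert space with norm $\Vert\cdot\Vert_{\mathcal H}$. It is called translation and modulation invariant if for every $f\in\mathcal H$ and all $x_0,\xi_0\in\mathbf R^d$, the distribution $x\mapsto f(x-x_0)e^{i\langle x,\xi_0\rangle}$ (translation by $x_0$ followed by multiplication by the character $e^{i\langle\cdot,\xi_0\rangle}$, in the sense of distributions) belongs to $\mathcal H$ and $$\Vert f(\cdot-x_0)e^{i\langle\cdot,\xi_0\rangle}\Vert_{\mathcal H}=\Vert f\Vert_{\mathcal H}.$$ It is continuously embedded in $\mathscr D'(\mathbf R^d)$ if $\mathcal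 H\subseteq\mathscr D'(\mathbf R^d)$ and the inclusion map is continuous. $M^{1,1}(\mathbf R^d)$ is the (unweighted) modulation space, also called the Feichtinger algebra: the set of all $f\in\mathscr S'(\mathbf R^d)$ whose short-time Fourier transform $V_\phi f(x,\xi)=(2\pi)^{-d/2}\,(f,\phi(\cdot-x)e^{i\langle\cdot,\xi\rangle})$ belongs to $L^1(\mathbf R^{2d})$, where $\phi\in\mathscr S(\mathbf R^d)\setminus\{0\}$ is a fixed window (e.g. a Gaussian; the space does not depend on the choice) and $(\,\cdot\,,\,\cdot\,)$ is the extension of the $L^2$ inner product to $\mathscr S'\times\mathscr S$. *)

theory Defs
  imports "HOL-Analysis.Analysis"
begin

section \<open>Test functions, Schwartz functions and their dual spaces\<close>

text \<open>
  \<open>iter_deriv [v\<^sub>1, \<dots>, v\<^sub>k] f\<close> is \<open>\<partial>\<^bsub>v\<^sub>1\<^esub> \<cdots> \<partial>\<^bsub>v\<^sub>k\<^esub> f\<close>.  Lists over \<open>Basis\<close> play the role of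
  multi-indices (a multi-index corresponds to several lists, which for smooth functions all
  give the same derivative).
\<close>

primrec iter_deriv :: "'a::euclidean_space list \<Rightarrow> ('a \<Rightarrow> complex) \<Rightarrow> 'a \<Rightarrow> complex" where
  "iter_deriv [] f = f"
| "iter_deriv (v # vs) f = (\<lambda>x. frechet_derivative (iter_deriv vs f) (at x) v)"

definition smooth :: "('a::euclidean_space \<Rightarrow> complex) \<Rightarrow> bool" where
  "smooth f \<longleftrightarrow> (\<forall>vs\<in>lists Basis. iter_deriv vs f differentiable_on UNIV)"

definition supp :: "('a::euclidean_space \<Rightarrow> complex) \<Rightarrow> 'a set" where
  "supp f = closure {x. f x \<noteq> 0}"

definition test_functions :: "('a::euclidean_space \<Rightarrow> complex) set" where
  "test_functions = {f. smooth f \<and> compact (supp f)}"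

definition schwartz_functions :: "('a::euclidean_space \<Rightarrow> complex) set" where
  "schwartz_functions = {f. smooth f \<and>
     (\<forall>N::nat. \<forall>vs\<in>lists Basis. bounded (range (\<lambda>x. (1 + norm x) ^ N *\<^sub>R iter_deriv vs f x)))}"

type_synonym 'a functional = "('a \<Rightarrow> complex) \<Rightarrow> complex"

text \<open>
  Linear functionals on a space of functions \<open>S\<close> are represented by total functions vanishing
  outside \<open>S\<close>, so that equality of functionals on \<open>S\<close> is equality in HOL.
\<close>

definition linear_functional_on :: "('a \<Rightarrow> complex) set \<Rightarrow> 'a functional \<Rightarrow> bool" where
  "linear_functional_on S u \<longleftrightarrow>
     (\<forall>\<phi>. \<phi> \<notin> S \<longrightarrow> u \<phi> = 0) \<and>
     (\<forall>\<phi>\<in>S. \<forall>\<psi>\<in>S. u (\<lambda>x. \<phi> x + \<psi> x) = u \<phi> + u \<psi>) \<and>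
     (\<forall>c. \<forall>\<phi>\<in>S. u (\<lambda>x. c * \<phi> x) = c * u \<phi>)"

text \<open>
  Continuity on the space of test functions is expressed by the usual seminorm estimate on
  every compact set, and on the Schwartz space by one global seminorm estimate.
\<close>

definition distributions :: "'a::euclidean_space functional set" where
  "distributions = {u. linear_functional_on test_functions u \<and>
     (\<forall>K. compact K \<longrightarrow> (\<exists>C. \<exists>N::nat. \<forall>\<phi>\<in>test_functions. supp \<phi> \<subseteq> K \<longrightarrow>
        cmod (u \<phi>) \<le> C * (\<Sum>vs | set vs \<subseteq> Basis \<and> length vs \<le> N.
                              SUP x. cmod (iter_deriv vs \<phi> x))))}"

definition tempered_distributions :: "'a::euclidean_space functional set" where
  "tempered_distributions = {u. linear_functional_on schwartz_functions u \<and>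
     (\<exists>C. \<exists>N::nat. \<forall>\<phi>\<in>schwartz_functions.
        cmod (u \<phi>) \<le> C * (\<Sum>vs | set vs \<subseteq> Basis \<and> length vs \<le> N.
                              SUP x. (1 + norm x) ^ N * cmod (iter_deriv vs \<phi> x)))}"

section \<open>Square integrable functions as distributions\<close>

definition square_integrable :: "('a::euclidean_space \<Rightarrow> complex) set" where
  "square_integrable = {f. f \<in> borel_measurable lborel \<and> integrable lborel (\<lambda>x. (cmod (f x))\<^sup>2)}"

definition L2_norm :: "('a::euclidean_space \<Rightarrow> complex) \<Rightarrow> real" where
  "L2_norm f = sqrt (LINT x|lborel. (cmod (f x))\<^sup>2)"

definition distribution_of :: "('a::euclidean_space \<Rightarrow> complex) \<Rightarrow> 'a functional" where
  "distribution_of f = (\<lambda>\<phi>. if \<phi> \<in> test_functions then LINT x|lborel. f x * \<phi> x else 0)"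

section \<open>Hilbert spaces of distributions\<close>

text \<open>Inner products are linear in the first and conjugate linear in the second argument.\<close>

locale inner_product_distribution_space =
  fixes H :: "'a::euclidean_space functional set"
    and ip :: "'a functional \<Rightarrow> 'a functional \<Rightarrow> complex"
  assumes subset_distributions: "H \<subseteq> distributions"
    and zero_mem: "(\<lambda>_. 0) \<in> H"
    and add_mem: "\<lbrakk>f \<in> H; g \<in> H\<rbrakk> \<Longrightarrow> (\<lambda>\<phi>. f \<phi> + g \<phi>) \<in> H"
    and scale_mem: "f \<in> H \<Longrightarrow> (\<lambda>\<phi>. c * f \<phi>) \<in> H"
    and ip_add_left: "\<lbrakk>f \<in> H; g \<in> H; h \<in> H\<rbrakk> \<Longrightarrow> ip (\<lambda>\<phi>. f \<phi> + g \<phi>) h = ip f h + ip g h"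
    and ip_scale_left: "\<lbrakk>f \<in> H; g \<in> H\<rbrakk> \<Longrightarrow> ip (\<lambda>\<phi>. c * f \<phi>) g = c * ip f g"
    and ip_commute: "\<lbrakk>f \<in> H; g \<in> H\<rbrakk> \<Longrightarrow> ip g f = cnj (ip f g)"
    and ip_nonneg: "f \<in> H \<Longrightarrow> 0 \<le> Re (ip f f)"
    and ip_definite: "\<lbrakk>f \<in> H; ip f f = 0\<rbrakk> \<Longrightarrow> f = (\<lambda>_. 0)"

definition ip_norm :: "('a functional \<Rightarrow> 'a functional \<Rightarrow> complex) \<Rightarrow> 'a functional \<Rightarrow> real" where
  "ip_norm ip f = sqrt (Re (ip f f))"

text \<open>
  The value outside \<open>H\<close> is fixed to \<open>0\<close> because \<^locale>\<open>Metric_space\<close> demands symmetry and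
  nonnegativity of the distance also off the carrier.
\<close>

definition ip_dist ::
    "'a functional set \<Rightarrow> ('a functional \<Rightarrow> 'a functional \<Rightarrow> complex)
       \<Rightarrow> 'a functional \<Rightarrow> 'a functional \<Rightarrow> real" where
  "ip_dist H ip f g = (if f \<in> H \<and> g \<in> H then ip_norm ip (\<lambda>\<phi>. f \<phi> - g \<phi>) else 0)"

context inner_product_distribution_space
begin

lemma diff_mem: "f \<in> H \<Longrightarrow> g \<in> H \<Longrightarrow> (\<lambda>\<phi>. f \<phi> - g \<phi>) \<in> H"
  using add_mem[OF _ scale_mem[of g "-1"], of f] by simp

lemma ip_add_right:
  "\<lbrakk>f \<in> H; g \<in> H; h \<in> H\<rbrakk> \<Longrightarrow> ip h (\<lambda>\<phi>. f \<phi> + g \<phi>) = ip h f + ip h g"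
  by (simp add: ip_commute[of _ h] ip_add_left add_mem)

lemma ip_scale_right: "\<lbrakk>f \<in> H; g \<in> H\<rbrakk> \<Longrightarrow> ip g (\<lambda>\<phi>. c * f \<phi>) = cnj c * ip g f"
  by (simp add: ip_commute[of _ g] ip_scale_left scale_mem)

lemma ip_self: "f \<in> H \<Longrightarrow> ip f f = of_real ((ip_norm ip f)\<^sup>2)"
  using ip_commute[of f f] ip_nonneg[of f] by (simp add: ip_norm_def complex_eq_iff)

lemma ip_norm_eq_0: "f \<in> H \<Longrightarrow> ip_norm ip f = 0 \<Longrightarrow> f = (\<lambda>_. 0)"
  using ip_self[of f] ip_definite[of f] by simp

lemma ip_norm_nonneg: "f \<in> H \<Longrightarrow> 0 \<le> ip_norm ip f"
  using ip_nonneg by (simp add: ip_norm_def)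

lemma cauchy_schwarz:
  assumes f: "f \<in> H" and g: "g \<in> H"
  shows "cmod (ip f g) \<le> ip_norm ip f * ip_norm ip g"
proof (cases "ip_norm ip g = 0")
  case True
  then have "g = (\<lambda>\<phi>. 0 * g \<phi>)" using ip_norm_eq_0[OF g] by simp
  then have "ip f g = 0" using ip_scale_right[OF g f, of 0] by simp
  then show ?thesis using True by simp
next
  case False
  define a where "a = (ip_norm ip g)\<^sup>2"
  define c where "c = - ip f g / of_real a"
  define h where "h = (\<lambda>\<phi>. f \<phi> + c * g \<phi>)"
  have a: "a > 0" using False by (simp add: a_def)
  have cg: "(\<lambda>\<phi>. c * g \<phi>) \<in> H" using g by (rule scale_mem)
  have "ip h h = ip f f + cnj c * ip f g + c * (ip g f + cnj c * ip g g)"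
    unfolding h_def using f g cg
    by (simp add: ip_add_left ip_add_right ip_scale_left ip_scale_right add_mem algebra_simps)
  also have "ip g f + cnj c * ip g g = 0"
    using a ip_commute[OF f g] ip_self[OF g] by (simp add: c_def flip: a_def)
  also have "ip f f + cnj c * ip f g + c * 0 = of_real ((ip_norm ip f)\<^sup>2 - (cmod (ip f g))\<^sup>2 / a)"
    using ip_self[OF f] complex_norm_square[of "ip f g"] by (simp add: c_def mult.commute)
  finally have "Re (ip h h) = (ip_norm ip f)\<^sup>2 - (cmod (ip f g))\<^sup>2 / a" by simp
  moreover have "0 \<le> Re (ip h h)" using ip_nonneg add_mem[OF f cg] by (simp add: h_def)
  ultimately have "(cmod (ip f g))\<^sup>2 / a \<le> (ip_norm ip f)\<^sup>2" by simp
  then have "(cmod (ip f g))\<^sup>2 \<le> (ip_norm ip f * ip_norm ip g)\<^sup>2"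
    using a by (simp add: pos_divide_le_eq power_mult_distrib flip: a_def)
  then show ?thesis
    by (rule power2_le_imp_le) (simp add: ip_norm_nonneg f g)
qed

lemma ip_norm_triangle:
  assumes f: "f \<in> H" and g: "g \<in> H"
  shows "ip_norm ip (\<lambda>\<phi>. f \<phi> + g \<phi>) \<le> ip_norm ip f + ip_norm ip g"
proof (rule power2_le_imp_le)
  have "(ip_norm ip (\<lambda>\<phi>. f \<phi> + g \<phi>))\<^sup>2 = Re (ip (\<lambda>\<phi>. f \<phi> + g \<phi>) (\<lambda>\<phi>. f \<phi> + g \<phi>))"
    using ip_nonneg[OF add_mem[OF f g]] by (simp add: ip_norm_def)
  also have "\<dots> = (ip_norm ip f)\<^sup>2 + (ip_norm ip g)\<^sup>2 + 2 * Re (ip f g)"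
    using f g ip_commute[OF f g] ip_self[OF f] ip_self[OF g]
    by (simp add: ip_add_left ip_add_right add_mem)
  also have "\<dots> \<le> (ip_norm ip f + ip_norm ip g)\<^sup>2"
    using cauchy_schwarz[OF f g] complex_Re_le_cmod[of "ip f g"]
    by (simp add: power2_sum)
  finally show "(ip_norm ip (\<lambda>\<phi>. f \<phi> + g \<phi>))\<^sup>2 \<le> (ip_norm ip f + ip_norm ip g)\<^sup>2" .
qed (simp add: ip_norm_nonneg f g)

end

sublocale inner_product_distribution_space \<subseteq> Metric_space H "ip_dist H ip"
proof
  fix f g h :: "'a functional"
  show "0 \<le> ip_dist H ip f g"
    by (simp add: ip_dist_def ip_norm_nonneg diff_mem)
  show "ip_dist H ip f g = ip_dist H ip g f"
  proof (cases "f \<in> H \<and> g \<in> H")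
    case True
    define u where "u = (\<lambda>\<phi>. f \<phi> - g \<phi>)"
    have u: "u \<in> H" using True by (simp add: u_def diff_mem)
    have "(\<lambda>\<phi>. g \<phi> - f \<phi>) = (\<lambda>\<phi>. -1 * u \<phi>)" by (simp add: u_def)
    moreover have "ip (\<lambda>\<phi>. -1 * u \<phi>) (\<lambda>\<phi>. -1 * u \<phi>) = ip u u"
      using ip_scale_left[OF u scale_mem[OF u], of "-1" "-1"] ip_scale_right[OF u u, of "-1"]
      by simp
    ultimately show ?thesis using True by (simp add: ip_dist_def ip_norm_def u_def)
  qed (auto simp: ip_dist_def)
  show "ip_dist H ip f g = 0 \<longleftrightarrow> f = g" if "f \<in> H" "g \<in> H"
  proof
    assume "ip_dist H ip f g = 0"
    then have "(\<lambda>\<phi>. f \<phi> - g \<phi>) = (\<lambda>_. 0)"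
      using ip_norm_eq_0[OF diff_mem[OF that]] that by (simp add: ip_dist_def)
    then show "f = g" by (simp add: fun_eq_iff)
  next
    assume "f = g"
    then show "ip_dist H ip f g = 0"
      using ip_scale_left[OF zero_mem zero_mem, of 0] by (simp add: ip_dist_def ip_norm_def)
  qed
  show "ip_dist H ip f h \<le> ip_dist H ip f g + ip_dist H ip g h"
    if "f \<in> H" "g \<in> H" "h \<in> H"
    using ip_norm_triangle[OF diff_mem[OF that(1,2)] diff_mem[OF that(2,3)]] that
    by (simp add: ip_dist_def)
qed

locale hilbert_distribution_space = inner_product_distribution_space +
  assumes complete: "mcomplete"

text \<open>
  Continuity refers to the weak topology of the space of distributions, i.e. pointwise
  convergence on test functions.  This is the subspace topology inherited from the product
  topology on functionals (the library's topology on a function type), as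
  all distributions vanish outside the test functions.
\<close>

definition continuously_embedded ::
    "'a::euclidean_space functional set \<Rightarrow> ('a functional \<Rightarrow> 'a functional \<Rightarrow> complex) \<Rightarrow> bool" where
  "continuously_embedded H ip \<longleftrightarrow> H \<subseteq> distributions \<and>
     continuous_map (Metric_space.mtopology H (ip_dist H ip)) (top_of_set distributions) (\<lambda>f. f)"

text \<open>
  \<open>tm_shift x\<^sub>0 \<xi>\<^sub>0 f\<close> is \<open>x \<mapsto> f (x - x\<^sub>0) e\<^bsup>i\<langle>x, \<xi>\<^sub>0\<rangle>\<^esup>\<close>: both operations are transposed to the
  test function, by the substitution \<open>x \<mapsto> x + x\<^sub>0\<close> in \<open>\<integral> f (x - x\<^sub>0) e\<^bsup>i\<langle>x, \<xi>\<^sub>0\<rangle>\<^esup> \<phi> x dx\<close>.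
  The transposed argument is a test function iff \<open>\<phi>\<close> is.
\<close>

definition tm_shift :: "'a::euclidean_space \<Rightarrow> 'a \<Rightarrow> 'a functional \<Rightarrow> 'a functional" where
  "tm_shift x0 \<xi>0 f = (\<lambda>\<phi>. f (\<lambda>x. cis ((x + x0) \<bullet> \<xi>0) * \<phi> (x + x0)))"

definition tm_invariant ::
    "'a::euclidean_space functional set \<Rightarrow> ('a functional \<Rightarrow> 'a functional \<Rightarrow> complex) \<Rightarrow> bool" where
  "tm_invariant H ip \<longleftrightarrow>
     (\<forall>f\<in>H. \<forall>x0 \<xi>0. tm_shift x0 \<xi>0 f \<in> H \<and> ip_norm ip (tm_shift x0 \<xi>0 f) = ip_norm ip f)"

section \<open>The Feichtinger algebra\<close>

text \<open>
  The pairing \<open>(f, \<psi>)\<close> extending the \<open>L\<^sup>2\<close> inner product is \<open>f\<close> applied to the conjugate of \<open>\<psi>\<close>.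
\<close>

definition stft :: "('a::euclidean_space \<Rightarrow> complex) \<Rightarrow> 'a functional \<Rightarrow> 'a \<Rightarrow> 'a \<Rightarrow> complex" where
  "stft \<phi> f x \<xi> = of_real ((2 * pi) powr (- real DIM('a) / 2)) *
                   f (\<lambda>y. cnj (\<phi> (y - x) * cis (y \<bullet> \<xi>)))"

text \<open>
  \<open>M\<^sup>1\<^sup>,\<^sup>1\<close> with window \<open>\<phi>\<close>, as a set of distributions: a distribution is tempered if it
  extends to a tempered distribution \<open>F\<close> (uniquely, by density of the test functions in the
  Schwartz space), and the short-time Fourier transform is formed with \<open>F\<close>.
\<close>

definition feichtinger_algebra ::
    "('a::euclidean_space \<Rightarrow> complex) \<Rightarrow> 'a functional set" where
  "feichtinger_algebra \<phi> = {f \<in> distributions. \<exists>F\<in>tempered_distributions.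
     (\<forall>\<psi>\<in>test_functions. F \<psi> = f \<psi>) \<and>
     integrable (lborel :: ('a \<times> 'a) measure) (\<lambda>(x, \<xi>). stft \<phi> F x \<xi>)}"

end

theory Submission
  imports Defs
begin

text \<open>
  Evaluation at a test function \<open>\<phi>\<close> is a bounded functional on \<open>H\<close>, so it is represented by some
  \<open>k\<^sub>\<phi> \<in> H\<close>, and \<open>Q \<psi> \<eta> = (k\<^sub>\<eta>, k\<^sub>\<psi>) = k\<^sub>\<eta> \<psi>\<close> is a hermitian form on test functions that is
  separately continuous and inherits the invariance of \<open>H\<close>.  Modulation invariance says that
  multiplication by a character can be moved from one argument of \<open>Q\<close> to the other; by trigonometric
  approximation the same holds for multiplication by any test function, so that \<open>Q \<psi> \<eta>\<close> only depends
  on \<open>\<psi> \<eta>\<^sup>*\<close>.  Averaging over translations (with Riemann sums, to which distributions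
  can be applied term by term) then gives \<open>Q \<psi> \<eta> = c \<integral> \<psi> \<eta>\<^sup>*\<close>.  As \<open>H \<noteq> 0\<close>, \<open>c > 0\<close>.  Thus
  \<open>k\<^sub>\<eta> = c \<eta>\<^sup>*\<close> as a distribution, with norm \<open>\<surd>c \<parallel>\<eta>\<parallel>\<close> in \<open>H\<close>, and these elements are dense
  in \<open>H\<close>; completeness of \<open>L\<^sup>2\<close> and of \<open>H\<close> identifies the two spaces.
\<close>

section \<open>Smooth functions\<close>

text \<open>The obstacle is continuity. A distribution is controlled only by derivatives of unknown
  finite order on a compact set, and \<open>Q\<close> is only known to be continuous in each
  argument separately. Uniform approximation by trigonometric polynomials is therefore too weak: the
  approximants must converge on a compact set together with all derivatives. Convolving the test
  function with a kernel that peaks at the origin achieves this, because every derivative falls on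
  the test function. Formally \<open>Q \<psi> \<eta>\<close> is a translation invariant distribution
  evaluated at the product of \<psi> and the conjugate of \<eta>, but that distribution is never
  formed. The factor between the norms is 1 / sqrt c, since an element c times a test function has
  norm sqrt c times the L2 norm of that test function.\<close>

lemma iter_deriv_append: "iter_deriv (vs @ ws) f = iter_deriv vs (iter_deriv ws f)"
  by (induction vs) simp_all

text \<open>\<open>smooth\<close> is the largest class of differentiable functions that is closed
  under partial derivatives. Exhibiting such a class replaces explicit formulas for higher
  derivatives.\<close>

lemma smooth_coinduct:
  assumes "f \<in> C"
    and "\<And>g. g \<in> C \<Longrightarrow> g differentiable_on UNIV"
    and "\<And>g v. g \<in> C \<Longrightarrow> v \<in> Basis \<Longrightarrow> iter_deriv [v] g \<in> C"
  shows "smooth f"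
proof -
  have "iter_deriv vs f \<in> C" if "vs \<in> lists Basis" for vs
    using that by induction (use assms in auto)
  then show ?thesis using assms(2) by (auto simp: smooth_def)
qed

text \<open>Product and chain rule turn a single term into a sum of terms of the same shape, so the
  natural classes are closed under derivatives only up to finite sums.\<close>

inductive_set add_closure :: "('a \<Rightarrow> complex) set \<Rightarrow> ('a \<Rightarrow> complex) set" for C where
  base: "f \<in> C \<Longrightarrow> f \<in> add_closure C"
| add: "f \<in> add_closure C \<Longrightarrow> g \<in> add_closure C \<Longrightarrow> (\<lambda>x. f x + g x) \<in> add_closure C"

lemma iter_deriv1_eqI:
  assumes "\<And>x. (f has_derivative f' x) (at x)"
  shows "iter_deriv [v] f = (\<lambda>x. f' x v)"
  using frechet_derivative_at[OF assms] by (simp add: fun_eq_iff)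

lemma smooth_coinduct_add:
  assumes f: "f \<in> C"
    and diff: "\<And>g. g \<in> C \<Longrightarrow> g differentiable_on UNIV"
    and deriv: "\<And>g v. g \<in> C \<Longrightarrow> v \<in> Basis \<Longrightarrow> iter_deriv [v] g \<in> add_closure C"
  shows "smooth f"
proof (rule smooth_coinduct[of f "add_closure C"])
  show "f \<in> add_closure C" using f by (rule add_closure.base)
  show d: "g differentiable_on UNIV" if "g \<in> add_closure C" for g
    using that by induction (auto simp: diff intro: differentiable_on_add)
  show "iter_deriv [v] g \<in> add_closure C" if "g \<in> add_closure C" and v: "v \<in> Basis" for g v
    using that(1)
  proof induction
    case (base g)
    then show ?case using deriv v by blast
  next
    case (add f g)
    have "((\<lambda>x. f x + g x) has_derivative
        (\<lambda>v. frechet_derivative f (at x) v + frechet_derivative g (at x) v)) (at x)" for x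
      using d[OF add(1)] d[OF add(2)]
      by (intro has_derivative_add) (simp_all add: differentiable_on_def frechet_derivative_works[symmetric])
    from iter_deriv1_eqI[OF this, of v]
    show ?case using add_closure.add[OF add(3,4)] by simp
  qed
qed

lemma smooth_has_derivative:
  assumes "smooth f"
  shows "(f has_derivative frechet_derivative f (at x)) (at x)"
proof -
  have "iter_deriv [] f differentiable_on UNIV" using assms unfolding smooth_def by blast
  then show ?thesis by (simp add: differentiable_on_def frechet_derivative_works[THEN iffD1])
qed

lemma smooth_differentiable_on: "smooth f \<Longrightarrow> f differentiable_on UNIV"
  by (meson differentiableI differentiable_on_def smooth_has_derivative has_derivative_at_withinI)

lemma smooth_continuous_on: "smooth f \<Longrightarrow> continuous_on S f"
  by (meson smooth_differentiable_on differentiable_imp_continuous_on continuous_on_subset subset_UNIV)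

lemma smooth_iter_deriv: "smooth f \<Longrightarrow> vs \<in> lists Basis \<Longrightarrow> smooth (iter_deriv vs f)"
  by (simp add: smooth_def append_in_lists_conv flip: iter_deriv_append)

lemma smooth_pderiv: "smooth f \<Longrightarrow> v \<in> Basis \<Longrightarrow> smooth (\<lambda>x. frechet_derivative f (at x) v)"
  using smooth_iter_deriv[of f "[v]"] by simp

lemma iter_deriv_add:
  assumes "smooth f" "smooth g" "vs \<in> lists Basis"
  shows "iter_deriv vs (\<lambda>x. f x + g x) = (\<lambda>x. iter_deriv vs f x + iter_deriv vs g x)"
  using assms(3)
proof induction
  case (Cons v vs)
  have "smooth (iter_deriv vs f)" "smooth (iter_deriv vs g)" using assms Cons by (simp_all add: smooth_iter_deriv)
  then have "((\<lambda>x. iter_deriv vs f x + iter_deriv vs g x) has_derivative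
      (\<lambda>v. frechet_derivative (iter_deriv vs f) (at x) v + frechet_derivative (iter_deriv vs g) (at x) v)) (at x)" for x
    by (intro has_derivative_add smooth_has_derivative)
  from iter_deriv1_eqI[OF this, of v] show ?case using Cons by simp
qed simp

lemma smooth_add:
  assumes "smooth f" "smooth g"
  shows "smooth (\<lambda>x. f x + g x)"
  unfolding smooth_def
proof
  fix vs :: "'a list"
  assume vs: "vs \<in> lists Basis"
  show "iter_deriv vs (\<lambda>x. f x + g x) differentiable_on UNIV"
    unfolding iter_deriv_add[OF assms vs]
    by (rule differentiable_on_add) (simp_all add: smooth_differentiable_on smooth_iter_deriv assms vs)
qed

lemma iter_deriv_bounded_linear:
  assumes "bounded_linear L" "smooth f" "vs \<in> lists Basis"
  shows "iter_deriv vs (\<lambda>x. L (f x)) = (\<lambda>x. L (iter_deriv vs f x))"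
  using assms(3)
proof induction
  case (Cons v vs)
  have "smooth (iter_deriv vs f)" using assms(2) Cons(2) by (rule smooth_iter_deriv)
  then have "((\<lambda>x. L (iter_deriv vs f x)) has_derivative
      (\<lambda>v. L (frechet_derivative (iter_deriv vs f) (at x) v))) (at x)" for x
    by (rule bounded_linear.has_derivative[OF assms(1) smooth_has_derivative])
  from iter_deriv1_eqI[OF this, of v] show ?case using Cons by simp
qed simp

lemma smooth_bounded_linear:
  assumes "bounded_linear L" "smooth f"
  shows "smooth (\<lambda>x. L (f x))"
  unfolding smooth_def
proof
  fix vs :: "'a list"
  assume vs: "vs \<in> lists Basis"
  have "((\<lambda>x. L (iter_deriv vs f x)) has_derivative
      (\<lambda>v. L (frechet_derivative (iter_deriv vs f) (at x) v))) (at x)" for x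
    by (rule bounded_linear.has_derivative[OF assms(1) smooth_has_derivative[OF smooth_iter_deriv[OF assms(2) vs]]])
  then show "iter_deriv vs (\<lambda>x. L (f x)) differentiable_on UNIV"
    unfolding iter_deriv_bounded_linear[OF assms vs]
    by (meson differentiableI differentiable_on_def has_derivative_at_withinI)
qed

lemma smooth_cmult: "smooth f \<Longrightarrow> smooth (\<lambda>x. c * f x)"
  by (rule smooth_bounded_linear[OF bounded_linear_mult_right])

lemma iter_deriv_cmult:
  "smooth f \<Longrightarrow> vs \<in> lists Basis \<Longrightarrow> iter_deriv vs (\<lambda>x. c * f x) = (\<lambda>x. c * iter_deriv vs f x)"
  by (rule iter_deriv_bounded_linear[OF bounded_linear_mult_right])

lemma smooth_cnj: "smooth f \<Longrightarrow> smooth (\<lambda>x. cnj (f x))"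
  by (rule smooth_bounded_linear[OF bounded_linear_cnj])

lemma smooth_diff: "smooth f \<Longrightarrow> smooth g \<Longrightarrow> smooth (\<lambda>x. f x - g x)"
  using smooth_add[of f "\<lambda>x. -1 * g x"] smooth_cmult[of g "-1"] by simp

lemma iter_deriv_diff:
  assumes "smooth f" "smooth g" "vs \<in> lists Basis"
  shows "iter_deriv vs (\<lambda>x. f x - g x) = (\<lambda>x. iter_deriv vs f x - iter_deriv vs g x)"
  using iter_deriv_add[OF assms(1) smooth_cmult[OF assms(2), of "-1"] assms(3)]
    iter_deriv_cmult[OF assms(2,3), of "-1"] by simp

lemma smooth_const: "smooth (\<lambda>_. c)"
  by (rule smooth_coinduct[of _ "range (\<lambda>c _. c)"]) auto

lemma smooth_sum: "(\<And>i. i \<in> I \<Longrightarrow> smooth (f i)) \<Longrightarrow> smooth (\<lambda>x. \<Sum>i\<in>I. f i x)"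
  by (induction I rule: infinite_finite_induct) (simp_all add: smooth_const smooth_add)

lemma iter_deriv_sum:
  assumes "\<And>i. i \<in> I \<Longrightarrow> smooth (f i)" "vs \<in> lists Basis" "finite I"
  shows "iter_deriv vs (\<lambda>x. \<Sum>i\<in>I. f i x) = (\<lambda>x. \<Sum>i\<in>I. iter_deriv vs (f i) x)"
  using assms(3,1)
proof (induction I)
  case empty
  have "iter_deriv vs (\<lambda>x. 0 * (0::complex)) = (\<lambda>x. 0 * iter_deriv vs (\<lambda>x. 0) x)"
    by (rule iter_deriv_cmult[OF smooth_const assms(2)])
  then show ?case by simp
next
  case (insert i I)
  have "iter_deriv vs (\<lambda>x. f i x + (\<Sum>i\<in>I. f i x)) = (\<lambda>x. iter_deriv vs (f i) x + iter_deriv vs (\<lambda>x. \<Sum>i\<in>I. f i x) x)"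
    by (rule iter_deriv_add[OF insert(4) smooth_sum assms(2)]) (use insert in auto)
  then show ?case using insert by simp
qed

lemma smooth_mult:
  assumes "smooth f" "smooth g"
  shows "smooth (\<lambda>x. f x * g x)"
proof (rule smooth_coinduct_add[of _ "{\<lambda>x. f x * g x |f g. smooth f \<and> smooth g}"])
  have mem: "(\<lambda>x. f x * g x) \<in> add_closure {\<lambda>x. f x * g x |f g. smooth f \<and> smooth g}"
    if "smooth f" "smooth g" for f g :: "'a \<Rightarrow> complex"
    by (rule add_closure.base, rule CollectI, rule exI[of _ f], rule exI[of _ g]) (use that in simp)
  fix h :: "'a \<Rightarrow> complex" and v :: 'a
  assume "h \<in> {\<lambda>x. f x * g x |f g. smooth f \<and> smooth g}"
  then obtain f g where h: "h = (\<lambda>x. f x * g x)" and s: "smooth f" "smooth g" by blast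
  have hd: "(h has_derivative (\<lambda>v. f x * frechet_derivative g (at x) v + frechet_derivative f (at x) v * g x)) (at x)" for x
    unfolding h by (intro has_derivative_mult smooth_has_derivative s)
  then show "h differentiable_on UNIV"
    by (meson differentiableI differentiable_on_def has_derivative_at_withinI)
  assume v: "v \<in> Basis"
  have "iter_deriv [v] h = (\<lambda>x. f x * frechet_derivative g (at x) v + frechet_derivative f (at x) v * g x)"
    using hd by (rule iter_deriv1_eqI)
  also have "\<dots> \<in> add_closure {\<lambda>x. f x * g x |f g. smooth f \<and> smooth g}"
    by (rule add_closure.add[OF mem[OF s(1) smooth_pderiv[OF s(2) v]] mem[OF smooth_pderiv[OF s(1) v] s(2)]])
  finally show "iter_deriv [v] h \<in> add_closure {\<lambda>x. f x * g x |f g. smooth f \<and> smooth g}" .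
qed (use assms in blast)

lemma pderiv_mult:
  assumes "smooth f" "smooth g"
  shows "iter_deriv [v] (\<lambda>x. f x * g x) = (\<lambda>x. iter_deriv [v] f x * g x + f x * iter_deriv [v] g x)"
  by (subst iter_deriv1_eqI[OF has_derivative_mult[OF smooth_has_derivative[OF assms(1)]
        smooth_has_derivative[OF assms(2)]]]) (simp add: add.commute)

lemma has_derivative_affine: "((\<lambda>x::'a::real_normed_vector. x + t) has_derivative (\<lambda>x. x)) (at x)"
  by (auto intro!: derivative_eq_intros)

lemma iter_deriv_translate:
  assumes "smooth f" "vs \<in> lists Basis"
  shows "iter_deriv vs (\<lambda>x. f (x + t)) = (\<lambda>x. iter_deriv vs f (x + t))"
  using assms(2)
proof induction
  case (Cons v vs)
  have "smooth (iter_deriv vs f)" using assms(1) Cons(2) by (rule smooth_iter_deriv)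
  then have "((\<lambda>x. iter_deriv vs f (x + t)) has_derivative
      (\<lambda>v. frechet_derivative (iter_deriv vs f) (at (x + t)) v)) (at x)" for x
    by (rule has_derivative_compose[OF has_derivative_affine smooth_has_derivative])
  from iter_deriv1_eqI[OF this, of v] show ?case using Cons by simp
qed simp

lemma smooth_translate: "smooth f \<Longrightarrow> smooth (\<lambda>x. f (x + t))"
proof (rule smooth_coinduct[of _ "{\<lambda>x. f (x + t) |f. smooth f}"])
  fix h :: "'a \<Rightarrow> complex" and v :: 'a
  assume "h \<in> {\<lambda>x. f (x + t) |f. smooth f}"
  then obtain f where h: "h = (\<lambda>x. f (x + t))" and s: "smooth f" by blast
  have hd: "(h has_derivative frechet_derivative f (at (x + t))) (at x)" for x
    unfolding h by (rule has_derivative_compose[OF has_derivative_affine smooth_has_derivative[OF s]])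
  then show "h differentiable_on UNIV"
    by (meson differentiableI differentiable_on_def has_derivative_at_withinI)
  assume v: "v \<in> Basis"
  show "iter_deriv [v] h \<in> {\<lambda>x. f (x + t) |f. smooth f}"
    unfolding iter_deriv1_eqI[OF hd]
    by (rule CollectI, rule exI[of _ "\<lambda>x. frechet_derivative f (at x) v"]) (simp add: smooth_pderiv[OF s v])
qed blast

lemma has_derivative_cis_inner:
  "((\<lambda>x. cis (x \<bullet> \<xi>)) has_derivative (\<lambda>v. (\<i> * of_real (v \<bullet> \<xi>)) * cis (x \<bullet> \<xi>))) (at x)"
proof -
  have "((\<lambda>x. \<i> * complex_of_real (x \<bullet> \<xi>)) has_derivative (\<lambda>v. \<i> * of_real (v \<bullet> \<xi>))) (at x)"
    by (intro has_derivative_mult_right has_derivative_of_real has_derivative_inner_left has_derivative_ident)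
  then have "((\<lambda>x. exp (\<i> * complex_of_real (x \<bullet> \<xi>))) has_derivative
      (\<lambda>v. exp (\<i> * of_real (x \<bullet> \<xi>)) * (\<i> * of_real (v \<bullet> \<xi>)))) (at x)"
    by (rule has_derivative_compose) (rule DERIV_exp[unfolded has_field_derivative_def])
  then show ?thesis by (simp add: cis_conv_exp mult.commute)
qed

lemma smooth_cis_inner: "smooth (\<lambda>x. cis (x \<bullet> \<xi>))"
proof (rule smooth_coinduct[of _ "range (\<lambda>c x. c * cis (x \<bullet> \<xi>))"])
  fix h :: "'a \<Rightarrow> complex" and v :: 'a
  assume "h \<in> range (\<lambda>c x. c * cis (x \<bullet> \<xi>))"
  then obtain c where h: "h = (\<lambda>x. c * cis (x \<bullet> \<xi>))" by blast
  have hd: "(h has_derivative (\<lambda>v. c * ((\<i> * of_real (v \<bullet> \<xi>)) * cis (x \<bullet> \<xi>)))) (at x)" for x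
    unfolding h by (intro has_derivative_mult_right has_derivative_cis_inner)
  then show "h differentiable_on UNIV"
    by (meson differentiableI differentiable_on_def has_derivative_at_withinI)
  show "iter_deriv [v] h \<in> range (\<lambda>c x. c * cis (x \<bullet> \<xi>))"
    by (rule range_eqI[of _ _ "c * (\<i> * of_real (v \<bullet> \<xi>))"])
       (simp add: iter_deriv1_eqI[OF hd] mult.assoc del: iter_deriv.simps)
qed (auto intro!: range_eqI[of _ _ 1])

text \<open>The class consists of the products \<open>F (q x) * g x\<close>: the chain rule replaces
  \<open>F\<close> by another member of \<open>D\<close>, and the derivative of \<open>q\<close> is
  absorbed into the smooth factor \<open>g\<close>. Allowing a set \<open>D\<close> treats a whole
  family such as p(1/t) exp(-1/t) at once.\<close>

lemma smooth_compose_real: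
  assumes F: "F \<in> D" and D: "\<And>F. F \<in> D \<Longrightarrow> \<exists>F'\<in>D. \<forall>t::real. (F has_real_derivative F' t) (at t)"
    and q: "smooth (\<lambda>x. complex_of_real (q x))"
  shows "smooth (\<lambda>x. complex_of_real (F (q x)))"
proof (rule smooth_coinduct_add[of _ "{\<lambda>x. of_real (F (q x)) * g x |F g. F \<in> D \<and> smooth g}"])
  show "(\<lambda>x. complex_of_real (F (q x))) \<in> {\<lambda>x. of_real (F (q x)) * g x |F g. F \<in> D \<and> smooth g}"
    by (intro CollectI exI[of _ F] exI[of _ "\<lambda>_. 1"]) (simp add: F smooth_const)
  have mem: "(\<lambda>x. of_real (F (q x)) * g x) \<in> add_closure {\<lambda>x. of_real (F (q x)) * g x |F g. F \<in> D \<and> smooth g}"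
    if "F \<in> D" "smooth g" for F g
    by (rule add_closure.base, rule CollectI, rule exI[of _ F], rule exI[of _ g]) (use that in simp)
  fix h :: "'a \<Rightarrow> complex" and v :: 'a
  assume "h \<in> {\<lambda>x. of_real (F (q x)) * g x |F g. F \<in> D \<and> smooth g}"
  then obtain F g where h: "h = (\<lambda>x. of_real (F (q x)) * g x)" and FD: "F \<in> D" and s: "smooth g" by blast
  obtain F' where F': "F' \<in> D" "\<And>t. (F has_real_derivative F' t) (at t)" using D[OF FD] by blast
  define q' where "q' x v = frechet_derivative (\<lambda>x. complex_of_real (q x)) (at x) v" for x v
  have dq: "((\<lambda>x. complex_of_real (q x)) has_derivative q' x) (at x)" for x
    unfolding q'_def using smooth_has_derivative[OF q] .
  have "((\<lambda>x. Re (complex_of_real (q x))) has_derivative (\<lambda>v. Re (q' x v))) (at x)" for x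
    by (rule bounded_linear.has_derivative[OF bounded_linear_Re dq])
  then have dq1: "(q has_derivative (\<lambda>v. Re (q' x v))) (at x)" for x by simp
  have "((\<lambda>x. complex_of_real (q x)) has_derivative (\<lambda>v. of_real (Re (q' x v)))) (at x)" for x
    using dq1 by (rule bounded_linear.has_derivative[OF bounded_linear_of_real])
  then have rq: "of_real (Re (q' x v)) = q' x v" for x v
    using dq has_derivative_unique by metis
  have "((\<lambda>x. F (q x)) has_derivative (\<lambda>v. F' (q x) * Re (q' x v))) (at x)" for x
    by (rule has_derivative_compose[OF dq1 F'(2)[unfolded has_field_derivative_def]])
  then have "((\<lambda>x. complex_of_real (F (q x))) has_derivative (\<lambda>v. complex_of_real (F' (q x) * Re (q' x v)))) (at x)" for x
    by (rule bounded_linear.has_derivative[OF bounded_linear_of_real])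
  then have "(h has_derivative (\<lambda>v. of_real (F (q x)) * frechet_derivative g (at x) v +
      complex_of_real (F' (q x) * Re (q' x v)) * g x)) (at x)" for x
    unfolding h by (intro has_derivative_mult smooth_has_derivative s)
  then have hd: "(h has_derivative (\<lambda>v. of_real (F (q x)) * frechet_derivative g (at x) v +
      of_real (F' (q x)) * (q' x v * g x))) (at x)" for x
    by (simp add: rq mult.assoc)
  then show "h differentiable_on UNIV"
    by (meson differentiableI differentiable_on_def has_derivative_at_withinI)
  assume v: "v \<in> Basis"
  have sm: "smooth (\<lambda>x. q' x v * g x)"
    unfolding q'_def by (rule smooth_mult[OF smooth_pderiv[OF q v] s])
  show "iter_deriv [v] h \<in> add_closure {\<lambda>x. of_real (F (q x)) * g x |F g. F \<in> D \<and> smooth g}"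
    unfolding iter_deriv1_eqI[OF hd]
    by (rule add_closure.add[OF mem[OF FD smooth_pderiv[OF s v]] mem[OF F'(1) sm]])
qed

lemma smooth_quadratic: "smooth (\<lambda>x. complex_of_real (\<alpha> + x \<bullet> w + \<beta> * (x \<bullet> x)))"
proof (rule smooth_coinduct[of _ "{\<lambda>x. complex_of_real (\<alpha> + x \<bullet> w + \<beta> * (x \<bullet> x)) |\<alpha> w \<beta>. True}"])
  fix h :: "'a \<Rightarrow> complex" and v :: 'a
  assume "h \<in> {\<lambda>x. complex_of_real (\<alpha> + x \<bullet> w + \<beta> * (x \<bullet> x)) |\<alpha> w \<beta>. True}"
  then obtain \<alpha> w \<beta> where h: "h = (\<lambda>x. complex_of_real (\<alpha> + x \<bullet> w + \<beta> * (x \<bullet> x)))" by blast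
  have hd: "(h has_derivative (\<lambda>v. complex_of_real (v \<bullet> w + x \<bullet> ((2 * \<beta>) *\<^sub>R v) + 0 * (x \<bullet> x)))) (at x)" for x
    unfolding h by (rule bounded_linear.has_derivative[OF bounded_linear_of_real])
       (auto intro!: derivative_eq_intros simp: algebra_simps inner_commute)
  then show "h differentiable_on UNIV"
    by (meson differentiableI differentiable_on_def has_derivative_at_withinI)
  show "iter_deriv [v] h \<in> {\<lambda>x. complex_of_real (\<alpha> + x \<bullet> w + \<beta> * (x \<bullet> x)) |\<alpha> w \<beta>. True}"
    unfolding iter_deriv1_eqI[OF hd] by blast
qed blast

section \<open>Test functions and continuity of distributions\<close>

lemma test_functionsI:
  assumes "smooth f" "compact K" "\<And>x. x \<notin> K \<Longrightarrow> f x = 0"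
  shows "f \<in> test_functions" "supp f \<subseteq> K"
proof -
  show *: "supp f \<subseteq> K"
    unfolding supp_def using assms(2,3) by (intro closure_minimal) (auto simp: compact_imp_closed)
  have "compact (K \<inter> supp f)"
    using assms(2) by (intro compact_Int_closed) (simp_all add: supp_def)
  then show "f \<in> test_functions"
    using assms(1) * by (simp add: test_functions_def Int_absorb1)
qed

lemma test_smooth: "\<psi> \<in> test_functions \<Longrightarrow> smooth \<psi>"
  by (simp add: test_functions_def)

lemma test_compact: "\<psi> \<in> test_functions \<Longrightarrow> compact (supp \<psi>)"
  by (simp add: test_functions_def)

lemma not_in_supp: "x \<notin> supp \<psi> \<Longrightarrow> \<psi> x = 0"
  using closure_subset[of "{x. \<psi> x \<noteq> 0}"] by (auto simp: supp_def)

lemma test_mult: "smooth g \<Longrightarrow> \<psi> \<in> test_functions \<Longrightarrow> (\<lambda>x. g x * \<psi> x) \<in> test_functions"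
  by (rule test_functionsI(1)[of _ "supp \<psi>"]) (simp_all add: smooth_mult test_smooth test_compact not_in_supp[of _ \<psi>])

lemma test_mult2: "\<phi> \<in> test_functions \<Longrightarrow> \<psi> \<in> test_functions \<Longrightarrow> (\<lambda>x. \<phi> x * \<psi> x) \<in> test_functions"
  by (rule test_mult[OF test_smooth])

lemma test_cmult: "\<psi> \<in> test_functions \<Longrightarrow> (\<lambda>x. c * \<psi> x) \<in> test_functions"
  by (rule test_mult[OF smooth_const])

lemma test_add: "\<phi> \<in> test_functions \<Longrightarrow> \<psi> \<in> test_functions \<Longrightarrow> (\<lambda>x. \<phi> x + \<psi> x) \<in> test_functions"
  by (rule test_functionsI(1)[of _ "supp \<phi> \<union> supp \<psi>"])
     (simp_all add: smooth_add test_smooth test_compact not_in_supp[of _ \<phi>] not_in_supp[of _ \<psi>] compact_Un)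

lemma test_diff: "\<phi> \<in> test_functions \<Longrightarrow> \<psi> \<in> test_functions \<Longrightarrow> (\<lambda>x. \<phi> x - \<psi> x) \<in> test_functions"
  by (rule test_functionsI(1)[of _ "supp \<phi> \<union> supp \<psi>"])
     (simp_all add: smooth_diff test_smooth test_compact not_in_supp[of _ \<phi>] not_in_supp[of _ \<psi>] compact_Un)

lemma test_zero: "(\<lambda>_. 0) \<in> test_functions"
  by (rule test_functionsI(1)[of _ "{}"]) (simp_all add: smooth_const)

lemma test_sum: "(\<And>i. i \<in> I \<Longrightarrow> f i \<in> test_functions) \<Longrightarrow> (\<lambda>x. \<Sum>i\<in>I. f i x) \<in> test_functions"
  by (induction I rule: infinite_finite_induct) (simp_all add: test_zero test_add)

lemma test_cnj: "\<psi> \<in> test_functions \<Longrightarrow> (\<lambda>x. cnj (\<psi> x)) \<in> test_functions"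
  by (rule test_functionsI(1)[of _ "supp \<psi>"]) (simp_all add: smooth_cnj test_smooth test_compact not_in_supp[of _ \<psi>])

lemma test_translate:
  assumes p: "\<psi> \<in> test_functions"
  shows "(\<lambda>x. \<psi> (x + t)) \<in> test_functions"
proof (rule test_functionsI(1))
  show "smooth (\<lambda>x. \<psi> (x + t))" by (rule smooth_translate[OF test_smooth[OF p]])
  show "compact ((\<lambda>x. x - t) ` supp \<psi>)"
    by (intro compact_continuous_image continuous_intros test_compact p)
  show "\<psi> (x + t) = 0" if "x \<notin> (\<lambda>x. x - t) ` supp \<psi>" for x
  proof (rule not_in_supp[of "x + t" \<psi>])
    show "x + t \<notin> supp \<psi>" using that by (metis add_diff_cancel image_eqI)
  qed
qed

section \<open>Locality of derivatives and continuity of distributions on products\<close>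

lemma iter_deriv_cong_open:
  assumes "open S" "\<And>x. x \<in> S \<Longrightarrow> f x = g x" "x \<in> S"
  shows "iter_deriv vs f x = iter_deriv vs g x"
  using assms(3)
proof (induction vs arbitrary: x)
  case (Cons v vs)
  have "(iter_deriv vs f has_derivative D) (at x) \<longleftrightarrow> (iter_deriv vs g has_derivative D) (at x)" for D
    using has_derivative_transform_within_open[of "iter_deriv vs f" D x UNIV S "iter_deriv vs g"]
      has_derivative_transform_within_open[of "iter_deriv vs g" D x UNIV S "iter_deriv vs f"]
      assms(1) Cons by auto
  then show ?case by (simp add: frechet_derivative_def)
qed (use assms in simp)

lemma iter_deriv_not_in_supp:
  assumes "x \<notin> supp \<psi>"
  shows "iter_deriv vs \<psi> x = 0"
proof -
  have z: "iter_deriv vs (\<lambda>_. 0) = (\<lambda>_. 0)" by (induction vs) simp_all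
  have "open (- supp \<psi>)" by (simp add: supp_def open_Compl)
  then have "iter_deriv vs \<psi> x = iter_deriv vs (\<lambda>_. 0) x"
  proof (rule iter_deriv_cong_open)
    show "\<psi> x = 0" if "x \<in> - supp \<psi>" for x using that not_in_supp[of x \<psi>] by blast
  qed (use assms in blast)
  then show ?thesis by (simp add: z)
qed

lemma test_iter_deriv: "\<psi> \<in> test_functions \<Longrightarrow> vs \<in> lists Basis \<Longrightarrow> iter_deriv vs \<psi> \<in> test_functions"
  by (rule test_functionsI(1)[of _ "supp \<psi>"])
     (simp_all add: smooth_iter_deriv test_smooth test_compact iter_deriv_not_in_supp)

lemma test_bounded:
  assumes "\<psi> \<in> test_functions"
  obtains C where "C > 0" "\<And>x. cmod (\<psi> x) \<le> C"
proof -
  have "bounded (\<psi> ` supp \<psi>)"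
    by (intro compact_imp_bounded compact_continuous_image smooth_continuous_on test_smooth test_compact assms)
  then obtain C where "C > 0" "\<And>x. x \<in> supp \<psi> \<Longrightarrow> cmod (\<psi> x) \<le> C"
    unfolding bounded_pos by auto
  then have "cmod (\<psi> x) \<le> C" for x by (cases "x \<in> supp \<psi>") (auto simp: not_in_supp[of _ \<psi>])
  then show ?thesis using \<open>C > 0\<close> that by blast
qed

text \<open>This avoids the Leibniz formula: peeling off the innermost derivative, the product rule
  leaves two products of the same kind, one with a derivative of \<open>h n\<close> and one with a
  derivative of \<psi>. Hence the induction generalises over both factors and runs from the end of
  the list.\<close>

lemma uniform_limit_iter_deriv_mult:
  fixes h :: "nat \<Rightarrow> 'a::euclidean_space \<Rightarrow> complex"
  assumes "vs \<in> lists Basis" "\<psi> \<in> test_functions" "supp \<psi> \<subseteq> K" "\<And>n. smooth (h n)"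
    and "\<And>ws. ws \<in> lists Basis \<Longrightarrow> uniform_limit K (\<lambda>n. iter_deriv ws (h n)) (\<lambda>_. 0) sequentially"
  shows "uniform_limit UNIV (\<lambda>n. iter_deriv vs (\<lambda>x. h n x * \<psi> x)) (\<lambda>_. 0) sequentially"
  using assms
proof (induction vs arbitrary: h \<psi> rule: rev_induct)
  case Nil
  obtain C where C: "C > 0" "\<And>x. cmod (\<psi> x) \<le> C" using test_bounded[OF Nil(2)] by blast
  have lim: "uniform_limit K h (\<lambda>_. 0) sequentially" using Nil(5)[of "[]"] by simp
  show ?case unfolding uniform_limit_iff
  proof (intro allI impI)
    fix e :: real assume "e > 0"
    then have "\<forall>\<^sub>F n in sequentially. \<forall>x\<in>K. dist (h n x) 0 < e / C"
      using lim C unfolding uniform_limit_iff by auto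
    then show "\<forall>\<^sub>F n in sequentially. \<forall>x\<in>UNIV. dist (iter_deriv [] (\<lambda>x. h n x * \<psi> x) x) 0 < e"
    proof eventually_elim
      case (elim n)
      have "cmod (h n x * \<psi> x) < e" for x
      proof (cases "x \<in> K")
        case True
        then have "cmod (h n x) * C < e" using elim C by (auto simp: field_simps)
        moreover have "cmod (h n x) * cmod (\<psi> x) \<le> cmod (h n x) * C"
          by (rule mult_left_mono) (use C in auto)
        ultimately show ?thesis by (simp add: norm_mult)
      next
        case False
        then have "\<psi> x = 0" using Nil(3) not_in_supp[of x \<psi>] by blast
        then show ?thesis using \<open>e > 0\<close> by simp
      qed
      then show ?case by simp
    qed
  qed
next
  case (snoc v vs)
  have v: "[v] \<in> lists Basis" "v \<in> Basis" and vs: "vs \<in> lists Basis" using snoc(2) by auto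
  have sm: "smooth (iter_deriv [v] (h n))" "smooth (iter_deriv [v] \<psi>)" for n
    using snoc(3,5) v by (auto intro: smooth_iter_deriv test_smooth simp del: iter_deriv.simps)
  have A: "uniform_limit UNIV (\<lambda>n. iter_deriv vs (\<lambda>x. iter_deriv [v] (h n) x * \<psi> x)) (\<lambda>_. 0) sequentially"
  proof (rule snoc.IH[OF vs snoc(3,4) sm(1)])
    show "uniform_limit K (\<lambda>n. iter_deriv ws (iter_deriv [v] (h n))) (\<lambda>_. 0) sequentially"
      if "ws \<in> lists Basis" for ws
      using snoc(6)[of "ws @ [v]"] that v unfolding iter_deriv_append by simp
  qed
  have B: "uniform_limit UNIV (\<lambda>n. iter_deriv vs (\<lambda>x. h n x * iter_deriv [v] \<psi> x)) (\<lambda>_. 0) sequentially"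
  proof (rule snoc.IH[OF vs test_iter_deriv[OF snoc(3) v(1)] _ snoc(5,6)])
    show "supp (iter_deriv [v] \<psi>) \<subseteq> K"
      using test_functionsI(2)[OF sm(2) test_compact[OF snoc(3)]] iter_deriv_not_in_supp snoc(4) by blast
  qed
  have "iter_deriv (vs @ [v]) (\<lambda>x. h n x * \<psi> x) = (\<lambda>x. iter_deriv vs (\<lambda>x. iter_deriv [v] (h n) x * \<psi> x) x
      + iter_deriv vs (\<lambda>x. h n x * iter_deriv [v] \<psi> x) x)" for n
    unfolding iter_deriv_append pderiv_mult[OF snoc(5) test_smooth[OF snoc(3)]]
    by (intro iter_deriv_add smooth_mult sm snoc(5) test_smooth snoc(3) vs)
  then show ?case using uniform_limit_add[OF A B] by simp
qed

lemma distribution_linear: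
  assumes "u \<in> distributions"
  shows distribution_add: "\<phi> \<in> test_functions \<Longrightarrow> \<psi> \<in> test_functions \<Longrightarrow> u (\<lambda>x. \<phi> x + \<psi> x) = u \<phi> + u \<psi>"
    and distribution_cmult: "\<phi> \<in> test_functions \<Longrightarrow> u (\<lambda>x. c * \<phi> x) = c * u \<phi>"
    and distribution_not_test: "\<phi> \<notin> test_functions \<Longrightarrow> u \<phi> = 0"
  using assms by (auto simp: distributions_def linear_functional_on_def)

lemma distribution_diff:
  assumes "u \<in> distributions" "\<phi> \<in> test_functions" "\<psi> \<in> test_functions"
  shows "u (\<lambda>x. \<phi> x - \<psi> x) = u \<phi> - u \<psi>"
  using distribution_add[OF assms(1,2) test_cmult[OF assms(3), of "-1"]]
    distribution_cmult[OF assms(1,3), of "-1"] by simp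

lemma distribution_zero: "u \<in> distributions \<Longrightarrow> u (\<lambda>_. 0) = 0"
  using distribution_cmult[of u "\<lambda>_. 0" 0] test_zero by simp

lemma distribution_sum:
  assumes "u \<in> distributions" "\<And>i. i \<in> I \<Longrightarrow> f i \<in> test_functions"
  shows "u (\<lambda>x. \<Sum>i\<in>I. f i x) = (\<Sum>i\<in>I. u (f i))"
  using assms(2)
  by (induction I rule: infinite_finite_induct)
     (simp_all add: distribution_zero[OF assms(1)] distribution_add[OF assms(1)] test_sum)

text \<open>All products are supported in \<open>supp \<psi>\<close>, so one seminorm estimate with
  fixed C and N serves for every n. All later passages to the limit inside a distribution rest on
  this.\<close>

lemma distribution_mult_tendsto_0:
  fixes h :: "nat \<Rightarrow> 'a::euclidean_space \<Rightarrow> complex"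
  assumes u: "u \<in> distributions" and psi: "\<psi> \<in> test_functions" and h: "\<And>n. smooth (h n)"
    and lim: "\<And>ws. ws \<in> lists Basis \<Longrightarrow> uniform_limit (supp \<psi>) (\<lambda>n. iter_deriv ws (h n)) (\<lambda>_. 0) sequentially"
  shows "(\<lambda>n. u (\<lambda>x. h n x * \<psi> x)) \<longlonglongrightarrow> 0"
proof -
  define s where "s n vs = (SUP x. cmod (iter_deriv vs (\<lambda>x. h n x * \<psi> x) x))" for n vs
  have T: "(\<lambda>x. h n x * \<psi> x) \<in> test_functions" for n by (intro test_mult h psi)
  have S: "supp (\<lambda>x. h n x * \<psi> x) \<subseteq> supp \<psi>" for n
    by (rule test_functionsI(2)) (simp_all add: smooth_mult h psi test_smooth test_compact not_in_supp[of _ \<psi>])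
  define q where "q \<phi> N = (\<Sum>vs | set vs \<subseteq> Basis \<and> length vs \<le> N. SUP x. cmod (iter_deriv vs \<phi> x))"
    for \<phi> :: "'a \<Rightarrow> complex" and N :: nat
  have "\<exists>C N. \<forall>\<phi>\<in>test_functions. supp \<phi> \<subseteq> supp \<psi> \<longrightarrow> cmod (u \<phi>) \<le> C * q \<phi> N"
    using u[unfolded distributions_def, THEN CollectD, THEN conjunct2, rule_format, OF test_compact[OF psi]]
    unfolding q_def .
  then obtain C N where CN: "\<And>\<phi>. \<phi> \<in> test_functions \<Longrightarrow> supp \<phi> \<subseteq> supp \<psi> \<Longrightarrow> cmod (u \<phi>) \<le> C * q \<phi> N"
    by blast
  have slim: "(\<lambda>n. s n vs) \<longlonglongrightarrow> 0" if vs: "vs \<in> lists Basis" for vs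
    unfolding tendsto_iff
  proof (intro allI impI)
    fix e :: real assume e: "e > 0"
    have "uniform_limit UNIV (\<lambda>n. iter_deriv vs (\<lambda>x. h n x * \<psi> x)) (\<lambda>_. 0) sequentially"
      by (rule uniform_limit_iter_deriv_mult[OF vs psi order_refl h lim])
    then have "\<forall>\<^sub>F n in sequentially. \<forall>x\<in>UNIV. dist (iter_deriv vs (\<lambda>x. h n x * \<psi> x) x) 0 < e / 2"
      using e unfolding uniform_limit_iff by (meson half_gt_zero)
    then show "\<forall>\<^sub>F n in sequentially. dist (s n vs) 0 < e"
    proof eventually_elim
      case (elim n)
      then have le: "cmod (iter_deriv vs (\<lambda>x. h n x * \<psi> x) x) \<le> e / 2" for x
        by (simp add: less_imp_le)
      have "s n vs \<le> e / 2" unfolding s_def by (rule cSUP_least) (use le in auto)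
      moreover have "0 \<le> s n vs" unfolding s_def
        by (rule cSUP_upper2[of _ _ 0]) (use bdd_aboveI2[of UNIV, OF le] in auto)
      ultimately show ?case using e by simp
    qed
  qed
  show ?thesis
  proof (rule Lim_null_comparison)
    show "\<forall>\<^sub>F n in sequentially. norm (u (\<lambda>x. h n x * \<psi> x)) \<le> C * (\<Sum>vs | set vs \<subseteq> Basis \<and> length vs \<le> N. s n vs)"
      unfolding s_def using CN[OF T S] by (simp add: q_def)
    have "(\<lambda>n. C * (\<Sum>vs | set vs \<subseteq> Basis \<and> length vs \<le> N. s n vs)) \<longlonglongrightarrow> C * (\<Sum>vs | set vs \<subseteq> (Basis::'a set) \<and> length vs \<le> N. 0)"
      by (intro tendsto_mult tendsto_const tendsto_sum slim) auto
    then show "(\<lambda>n. C * (\<Sum>vs | set vs \<subseteq> Basis \<and> length vs \<le> N. s n vs)) \<longlonglongrightarrow> 0" by simp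
  qed
qed

section \<open>Integrals over boxes and Riemann sums\<close>

text \<open>One operator for two purposes: with s = -1 it is the convolution of f with the kernel k
  cut off to a box, and with k = 1 it integrates the translates of f over the box. The compact
  domain allows differentiation under the integral.\<close>

definition box_conv :: "('a::euclidean_space \<Rightarrow> complex) \<Rightarrow> real \<Rightarrow> 'a \<Rightarrow> 'a \<Rightarrow> ('a \<Rightarrow> complex) \<Rightarrow> 'a \<Rightarrow> complex" where
  "box_conv k s a b f x = integral (cbox a b) (\<lambda>y. k y * f (x + s *\<^sub>R y))"

lemma has_derivative_box_conv:
  assumes f: "smooth f" and k: "continuous_on UNIV k"
  shows "(box_conv k s a b f has_derivative (\<lambda>v. box_conv k s a b (\<lambda>x. frechet_derivative f (at x) v) x)) (at x)"
proof -
  define D where "D x = frechet_derivative f (at x)" for x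
  have D: "(f has_derivative D x) (at x)" for x
    unfolding D_def by (rule smooth_has_derivative[OF f])
  have bl: "bounded_linear (\<lambda>v. k t * D (x + s *\<^sub>R t) v)" for x t
    by (rule bounded_linear_compose[OF bounded_linear_mult_right has_derivative_bounded_linear[OF D]])
  \<comment> \<open>The Leibniz rule takes the derivative as a bounded linear operator depending
    continuously on both variables. In finite dimension its continuity may be tested on basis
    vectors, where it is that of a partial derivative.\<close>
  define B where "B x t = Blinfun (\<lambda>v. k t * D (x + s *\<^sub>R t) v)" for x t
  have B: "blinfun_apply (B x t) = (\<lambda>v. k t * D (x + s *\<^sub>R t) v)" for x t
    unfolding B_def by (rule bounded_linear_Blinfun_apply[OF bl])
  have Dc: "continuous_on UNIV (\<lambda>x. D x i)" if "i \<in> Basis" for i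
    unfolding D_def by (rule smooth_continuous_on[OF smooth_pderiv[OF f that]])
  have Bc: "continuous_on S (\<lambda>(x, t). B x t)" for S
    unfolding split_beta
  proof (rule continuous_on_blinfun_componentwise)
    show "continuous_on S (\<lambda>x. blinfun_apply (B (fst x) (snd x)) i)" if "i \<in> Basis" for i
      unfolding B
      by (intro continuous_on_mult continuous_on_compose2[OF k] continuous_on_compose2[OF Dc[OF that]]
          continuous_intros) auto
  qed
  have deriv: "((\<lambda>x. k t * f (x + s *\<^sub>R t)) has_derivative blinfun_apply (B x t)) (at x within UNIV)" for x t
    unfolding B using has_derivative_compose[OF has_derivative_affine D] by (intro has_derivative_mult_right)
  have int: "(\<lambda>t. k t * f (x + s *\<^sub>R t)) integrable_on cbox a b" for x
    by (intro integrable_continuous continuous_on_mult continuous_on_subset[OF k]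
        continuous_on_compose2[OF smooth_continuous_on[OF f, of UNIV]] continuous_intros) auto
  have "((\<lambda>x. integral (cbox a b) (\<lambda>t. k t * f (x + s *\<^sub>R t))) has_derivative
      blinfun_apply (integral (cbox a b) (B x))) (at x within UNIV)"
    by (rule leibniz_rule[OF deriv int Bc]) auto
  moreover have "blinfun_apply (integral (cbox a b) (B x)) v = integral (cbox a b) (\<lambda>t. k t * D (x + s *\<^sub>R t) v)" for v
  proof -
    have "continuous_on (cbox a b) (\<lambda>t. (\<lambda>(x, t). B x t) (x, t))"
      by (rule continuous_on_compose2[OF Bc[of UNIV]]) (auto intro!: continuous_intros)
    then have "B x integrable_on cbox a b" by (intro integrable_continuous) simp
    then show ?thesis by (subst blinfun_apply_integral) (simp_all add: B)
  qed
  then have "blinfun_apply (integral (cbox a b) (B x)) = (\<lambda>v. integral (cbox a b) (\<lambda>t. k t * D (x + s *\<^sub>R t) v))"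
    by (rule ext)
  ultimately show ?thesis
    unfolding box_conv_def[abs_def] D_def by (simp only:)
qed

lemma smooth_box_conv:
  assumes "smooth f" "continuous_on UNIV k"
  shows "smooth (box_conv k s a b f)"
proof (rule smooth_coinduct[of _ "box_conv k s a b ` Collect smooth"])
  fix g :: "'a \<Rightarrow> complex" and v :: 'a
  assume "g \<in> box_conv k s a b ` Collect smooth"
  then obtain h where g: "g = box_conv k s a b h" and h: "smooth h" by blast
  note d = has_derivative_box_conv[OF h assms(2), where s=s and a=a and b=b, folded g]
  show "g differentiable_on UNIV"
    using d by (meson differentiableI differentiable_on_def has_derivative_at_withinI)
  assume "v \<in> Basis"
  then show "iter_deriv [v] g \<in> box_conv k s a b ` Collect smooth"
    unfolding iter_deriv1_eqI[OF d] using smooth_pderiv[OF h] by auto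
qed (use assms in simp)

lemma iter_deriv_box_conv:
  assumes "smooth f" "continuous_on UNIV k" "vs \<in> lists Basis"
  shows "iter_deriv vs (box_conv k s a b f) = box_conv k s a b (iter_deriv vs f)"
  using assms(3)
proof induction
  case (Cons v vs)
  from iter_deriv1_eqI[OF has_derivative_box_conv[OF smooth_iter_deriv[OF assms(1) Cons(2)] assms(2), where s=s and a=a and b=b], of v]
  show ?case using Cons(3) by simp
qed simp

text \<open>Fineness places each cell within distance \<delta> of its tag, so replacing
  \<open>g\<close> by its value at the tag costs at most \<open>e\<close> times the volume of the
  cell; the volumes add up to that of the box.\<close>

lemma riemann_sum_bound:
  fixes g :: "'a::euclidean_space \<Rightarrow> complex"
  assumes g: "continuous_on (cbox a b) g" and p: "p tagged_division_of cbox a b" "(\<lambda>x. ball x \<delta>) fine p"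
    and osc: "\<And>x y. x \<in> cbox a b \<Longrightarrow> y \<in> cbox a b \<Longrightarrow> dist x y < \<delta> \<Longrightarrow> dist (g x) (g y) \<le> e"
  shows "cmod ((\<Sum>(y,K)\<in>p. measure lborel K *\<^sub>R g y) - integral (cbox a b) g) \<le> e * measure lborel (cbox a b)"
proof -
  have gi: "g integrable_on cbox a b" by (rule integrable_continuous[OF g])
  have "(\<Sum>(y,K)\<in>p. measure lborel K *\<^sub>R g y) - integral (cbox a b) g = (\<Sum>(y,K)\<in>p. measure lborel K *\<^sub>R g y - integral K g)"
    unfolding integral_combine_tagged_division_topdown[OF gi p(1)] by (simp add: split_beta sum_subtractf)
  also have "cmod \<dots> \<le> (\<Sum>(y,K)\<in>p. e * measure lborel K)"
  proof (rule sum_norm_le, clarify)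
    fix y K assume yK: "(y, K) \<in> p"
    then have K: "K \<subseteq> cbox a b" "y \<in> K" using p(1) by (auto simp: tagged_division_of_def tagged_partial_division_of_def)
    obtain c d where cd: "K = cbox c d" using tagged_division_ofD(4)[OF p(1) yK] by blast
    have gK: "g integrable_on K" unfolding cd by (rule integrable_continuous) (use K g cd in \<open>auto intro: continuous_on_subset\<close>)
    have KB: "K \<subseteq> ball y \<delta>" using p(2) yK by (auto simp: fine_def)
    have "y \<in> cbox a b" using K by auto
    have "measure lborel K *\<^sub>R g y - integral K g = integral K (\<lambda>x. g y - g x)"
      using gK unfolding cd by (subst integral_diff) auto
    also have "cmod \<dots> \<le> e * measure lborel K"
      unfolding cd
    proof (rule integrable_bound)
      show "0 \<le> e" using osc[of y y] \<open>y \<in> cbox a b\<close> KB K(2) by (auto simp: dist_self)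
      show "(\<lambda>x. g y - g x) integrable_on cbox c d" using gK unfolding cd by (intro integrable_diff) auto
      show "cmod (g y - g x) \<le> e" if "x \<in> cbox c d" for x
      proof -
        have "x \<in> ball y \<delta>" "x \<in> cbox a b" using that KB K(1) cd by blast+
        then show ?thesis using osc[of y x] \<open>y \<in> cbox a b\<close> by (simp add: dist_norm)
      qed
    qed
    finally show "cmod (measure lborel K *\<^sub>R g y - integral K g) \<le> e * measure lborel K" .
  qed
  also have "\<dots> = e * measure lborel (cbox a b)"
    using additive_content_tagged_division[OF p(1)] by (simp add: split_beta flip: sum_distrib_left)
  finally show ?thesis .
qed

text \<open>The divisions are chosen independently of the integrand, so the same sums approximate a
  function together with all its derivatives, and sums for different functions can be compared term
  by term.\<close>

definition riemann_seq :: "'a::euclidean_space \<Rightarrow> 'a \<Rightarrow> (nat \<Rightarrow> ('a \<times> 'a set) set) \<Rightarrow> bool" where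
  "riemann_seq a b p \<longleftrightarrow> (\<forall>m. p m tagged_division_of cbox a b \<and> (\<lambda>x. ball x (1 / Suc m)) fine p m)"

lemma ex_riemann_seq: "\<exists>p. riemann_seq a b p"
  unfolding riemann_seq_def
proof (rule choice, rule allI)
  fix m
  have "gauge (\<lambda>x. ball x (1 / real (Suc m)))" by (intro gauge_ball) simp
  then obtain p where "p tagged_division_of cbox a b" "(\<lambda>x. ball x (1 / real (Suc m))) fine p"
    by (rule fine_division_exists)
  then show "\<exists>p. p tagged_division_of cbox a b \<and> (\<lambda>x. ball x (1 / real (Suc m))) fine p"
    by blast
qed

lemma uniform_limit_riemann:
  fixes f :: "'a::euclidean_space \<Rightarrow> complex"
  assumes f: "continuous_on UNIV f" and S: "compact S" and p: "riemann_seq a b p"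
  shows "uniform_limit S (\<lambda>m x. \<Sum>(y,K)\<in>p m. measure lborel K *\<^sub>R f (x + s *\<^sub>R y)) (box_conv (\<lambda>_. 1) s a b f) sequentially"
  unfolding uniform_limit_iff
proof (intro allI impI)
  fix e :: real assume e: "e > 0"
  \<comment> \<open>Adding 1 to the volume keeps the denominator positive for a degenerate box and
    makes the final estimate strict.\<close>
  define e' where "e' = e / (measure lborel (cbox a b) + 1)"
  have c: "measure lborel (cbox a b) \<ge> 0" by simp
  have e': "e' > 0" "e' * measure lborel (cbox a b) < e"
    using e c by (auto simp: e'_def field_simps add_pos_nonneg)
  define L where "L = (\<lambda>(x,y). x + s *\<^sub>R y) ` (S \<times> cbox a b)"
  have "compact L" unfolding L_def split_beta
    by (intro compact_continuous_image compact_Times S compact_cbox continuous_intros)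
  then have "uniformly_continuous_on L f"
    by (intro compact_uniformly_continuous continuous_on_subset[OF f]) auto
  then obtain d where d: "d > 0" "\<And>x y. x \<in> L \<Longrightarrow> y \<in> L \<Longrightarrow> dist x y < d \<Longrightarrow> dist (f x) (f y) < e'"
    using e' unfolding uniformly_continuous_on_def by (metis dist_commute)
  have "\<forall>\<^sub>F m in sequentially. \<bar>s\<bar> * (1 / Suc m) < d"
  proof -
    have "(\<lambda>m. \<bar>s\<bar> * (1 / Suc m)) \<longlonglongrightarrow> \<bar>s\<bar> * 0"
      by (intro tendsto_mult tendsto_const) (use LIMSEQ_inverse_real_of_nat in \<open>simp add: inverse_eq_divide\<close>)
    then show ?thesis using d(1) by (intro order_tendstoD) auto
  qed
  then show "\<forall>\<^sub>F m in sequentially. \<forall>x\<in>S. dist (\<Sum>(y,K)\<in>p m. measure lborel K *\<^sub>R f (x + s *\<^sub>R y)) (box_conv (\<lambda>_. 1) s a b f x) < e"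
  proof eventually_elim
    case (elim m)
    show ?case
    proof
      fix x assume x: "x \<in> S"
      have "cmod ((\<Sum>(y,K)\<in>p m. measure lborel K *\<^sub>R f (x + s *\<^sub>R y)) - integral (cbox a b) (\<lambda>y. f (x + s *\<^sub>R y))) \<le> e' * measure lborel (cbox a b)"
      proof (rule riemann_sum_bound)
        show "continuous_on (cbox a b) (\<lambda>y. f (x + s *\<^sub>R y))"
          by (rule continuous_on_compose2[OF f]) (auto intro!: continuous_intros)
        show "p m tagged_division_of cbox a b" "(\<lambda>x. ball x (1 / Suc m)) fine p m"
          using p by (auto simp: riemann_seq_def)
        fix y z assume yz: "y \<in> cbox a b" "z \<in> cbox a b" "dist y z < 1 / Suc m"
        have "dist (x + s *\<^sub>R y) (x + s *\<^sub>R z) = \<bar>s\<bar> * dist y z"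
          by (simp add: dist_norm flip: scaleR_diff_right)
        also have "\<dots> \<le> \<bar>s\<bar> * (1 / Suc m)" using yz by (intro mult_left_mono) auto
        also have "\<dots> < d" by (rule elim)
        finally have "dist (f (x + s *\<^sub>R y)) (f (x + s *\<^sub>R z)) < e'"
          by (intro d(2)) (use x yz in \<open>auto simp: L_def\<close>)
        then show "dist (f (x + s *\<^sub>R y)) (f (x + s *\<^sub>R z)) \<le> e'" by simp
      qed
      then show "dist (\<Sum>(y,K)\<in>p m. measure lborel K *\<^sub>R f (x + s *\<^sub>R y)) (box_conv (\<lambda>_. 1) s a b f x) < e"
        using e' by (simp add: box_conv_def dist_norm)
    qed
  qed
qed

lemma finite_tagged_division: "riemann_seq a b p \<Longrightarrow> finite (p m)"
  unfolding riemann_seq_def by (meson tagged_division_of_finite)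

text \<open>The Riemann sums of the translates of f converge to \<open>box_conv\<close> with all
  derivatives on \<open>supp \<eta>\<close>, so u may be applied term by term. After multiplication
  by \<eta> only the values on \<open>supp \<eta>\<close> matter, where the limit is the constant
  I.\<close>

lemma distribution_riemann_sum:
  assumes u: "u \<in> distributions" and eta: "\<eta> \<in> test_functions" and f: "smooth f"
    and p: "riemann_seq a b p" and I: "\<And>x. x \<in> supp \<eta> \<Longrightarrow> box_conv (\<lambda>_. 1) s a b f x = I"
  shows "(\<lambda>m. \<Sum>(y,K)\<in>p m. measure lborel K *\<^sub>R u (\<lambda>x. f (x + s *\<^sub>R y) * \<eta> x)) \<longlonglongrightarrow> I * u \<eta>"
proof -
  define F where "F = box_conv (\<lambda>_. 1) s a b f"
  define r where "r g m x = (\<Sum>q\<in>p m. of_real (measure lborel (snd q)) * g (x + s *\<^sub>R fst q))" for g :: "'a \<Rightarrow> complex" and m x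
  have F: "smooth F" unfolding F_def by (rule smooth_box_conv[OF f continuous_on_const])
  have sm: "smooth (\<lambda>x. of_real (measure lborel (snd q)) * f (x + s *\<^sub>R fst q))" for q :: "'a \<times> 'a set"
    by (rule smooth_cmult[OF smooth_translate[OF f]])
  have r: "smooth (r f m)" for m
    unfolding r_def[abs_def] by (rule smooth_sum[OF sm])
  have dr: "iter_deriv vs (r f m) = r (iter_deriv vs f) m" if "vs \<in> lists Basis" for m vs
    unfolding r_def[abs_def] iter_deriv_sum[OF sm that finite_tagged_division[OF p]]
      iter_deriv_cmult[OF smooth_translate[OF f] that] iter_deriv_translate[OF f that] ..
  have "(\<lambda>m. u (\<lambda>x. (r f m x - F x) * \<eta> x)) \<longlonglongrightarrow> 0"
  proof (rule distribution_mult_tendsto_0[OF u eta smooth_diff[OF r F]])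
    fix vs :: "'a list" assume vs: "vs \<in> lists Basis"
    have "uniform_limit (supp \<eta>) (\<lambda>m. r (iter_deriv vs f) m) (box_conv (\<lambda>_. 1) s a b (iter_deriv vs f)) sequentially"
      using uniform_limit_riemann[OF smooth_continuous_on[OF smooth_iter_deriv[OF f vs]] test_compact[OF eta] p, of s]
      by (simp add: r_def[abs_def] split_beta scaleR_conv_of_real)
    then show "uniform_limit (supp \<eta>) (\<lambda>m. iter_deriv vs (\<lambda>x. r f m x - F x)) (\<lambda>_. 0) sequentially"
      unfolding iter_deriv_diff[OF r F vs] dr[OF vs]
      unfolding F_def iter_deriv_box_conv[OF f continuous_on_const vs]
      by (simp add: uniform_limit_iff dist_norm)
  qed
  moreover have "u (\<lambda>x. (r f m x - F x) * \<eta> x) = (\<Sum>(y,K)\<in>p m. measure lborel K *\<^sub>R u (\<lambda>x. f (x + s *\<^sub>R y) * \<eta> x)) - I * u \<eta>" for m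
  proof -
    have FI: "(\<lambda>x. F x * \<eta> x) = (\<lambda>x. I * \<eta> x)"
      using I not_in_supp[of _ \<eta>] unfolding F_def by (metis mult_zero_right)
    have t: "(\<lambda>x. f (x + s *\<^sub>R y) * \<eta> x) \<in> test_functions" for y
      by (rule test_mult[OF smooth_translate[OF f] eta])
    have "u (\<lambda>x. (r f m x - F x) * \<eta> x) = u (\<lambda>x. r f m x * \<eta> x - F x * \<eta> x)"
      by (simp add: left_diff_distrib)
    also have "\<dots> = u (\<lambda>x. r f m x * \<eta> x) - u (\<lambda>x. F x * \<eta> x)"
      by (rule distribution_diff[OF u test_mult[OF r eta] test_mult[OF F eta]])
    also have "u (\<lambda>x. F x * \<eta> x) = I * u \<eta>"
      unfolding FI by (rule distribution_cmult[OF u eta])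
    also have "(\<lambda>x. r f m x * \<eta> x) = (\<lambda>x. \<Sum>q\<in>p m. of_real (measure lborel (snd q)) * (f (x + s *\<^sub>R fst q) * \<eta> x))"
      by (simp add: r_def sum_distrib_right mult.assoc)
    also have "u \<dots> = (\<Sum>q\<in>p m. of_real (measure lborel (snd q)) * u (\<lambda>x. f (x + s *\<^sub>R fst q) * \<eta> x))"
      by (simp add: distribution_sum[OF u test_cmult[OF t]] distribution_cmult[OF u t])
    finally show ?thesis by (simp add: split_beta scaleR_conv_of_real)
  qed
  ultimately show ?thesis by (simp add: LIM_zero_iff)
qed

section \<open>Trigonometric approximation of test functions\<close>

lemma integrable_compact_support:
  fixes f :: "'a::euclidean_space \<Rightarrow> complex"
  assumes "continuous_on UNIV f" "compact K" "\<And>x. x \<notin> K \<Longrightarrow> f x = 0"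
  shows "integrable lborel f"
proof -
  have "integrable lborel (\<lambda>x. indicator K x *\<^sub>R f x)"
    using assms by (intro borel_integrable_compact continuous_on_subset[OF assms(1)]) auto
  also have "(\<lambda>x. indicator K x *\<^sub>R f x) = f"
    using assms(3) by (auto simp: indicator_def)
  finally show ?thesis .
qed

lemma test_integrable: "\<psi> \<in> test_functions \<Longrightarrow> integrable lborel \<psi>"
  by (rule integrable_compact_support[of _ "supp \<psi>"])
     (simp_all add: smooth_continuous_on test_smooth test_compact not_in_supp[of _ \<psi>])

lemma lborel_integral_reflect_translate:
  fixes f :: "'a::euclidean_space \<Rightarrow> complex"
  assumes "s = 1 \<or> s = -1" "continuous_on UNIV f"
  shows "(LINT y|lborel. f (x + s *\<^sub>R y)) = (LINT y|lborel. f y)"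
proof -
  have "\<bar>s\<bar> = 1" using assms(1) by auto
  then have "lborel = distr lborel borel (\<lambda>y. x + s *\<^sub>R y)"
    using lborel_affine[of s x] by (auto simp: density_1)
  then have "(LINT y|lborel. f y) = (LINT y|distr lborel borel (\<lambda>y. x + s *\<^sub>R y). f y)" by simp
  also have "\<dots> = (LINT y|lborel. f (x + s *\<^sub>R y))"
    using assms(2) by (intro integral_distr borel_measurable_continuous_onI) auto
  finally show ?thesis by simp
qed

lemma box_conv_eq_lborel_integral:
  assumes k: "continuous_on UNIV k" and f: "continuous_on UNIV f"
    and z: "\<And>y. y \<notin> cbox a b \<Longrightarrow> f (x + s *\<^sub>R y) = 0"
  shows "box_conv k s a b f x = (LINT y|lborel. k y * f (x + s *\<^sub>R y))"
proof -
  have c: "continuous_on UNIV (\<lambda>y. k y * f (x + s *\<^sub>R y))"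
    by (intro continuous_on_mult k continuous_on_compose2[OF f] continuous_intros) auto
  have "integrable lborel (\<lambda>y. k y * f (x + s *\<^sub>R y))"
    by (rule integrable_compact_support[OF c compact_cbox[of a b]]) (simp add: z)
  then have UNIV: "((\<lambda>y. k y * f (x + s *\<^sub>R y)) has_integral (LINT y|lborel. k y * f (x + s *\<^sub>R y))) UNIV"
    by (rule has_integral_integral_lborel)
  have "((\<lambda>y. k y * f (x + s *\<^sub>R y)) has_integral box_conv k s a b f x) (cbox a b)"
    unfolding box_conv_def
    by (intro integrable_integral integrable_continuous continuous_on_subset[OF c]) simp
  then have "((\<lambda>y. k y * f (x + s *\<^sub>R y)) has_integral box_conv k s a b f x) UNIV"
    by (rule has_integral_on_superset) (simp_all add: z)
  then show ?thesis using UNIV by (rule has_integral_unique)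
qed

text \<open>Supplies a cube centred at the origin that contains all shifts which bring one support
  into contact with the other; integrals over translates can then be restricted to it.\<close>

lemma ex_cbox_differences:
  fixes A B :: "'a::euclidean_space set"
  assumes "compact A" "compact B"
  obtains M where "M > 0" "\<And>x y. x \<in> A \<Longrightarrow> y \<in> B \<Longrightarrow> x - y \<in> cbox (- M *\<^sub>R One) (M *\<^sub>R One)"
    "\<And>x y. x \<in> A \<Longrightarrow> y \<in> B \<Longrightarrow> y - x \<in> cbox (- M *\<^sub>R One) (M *\<^sub>R One)"
proof -
  obtain M1 M2 where M: "\<And>x. x \<in> A \<Longrightarrow> norm x \<le> M1" "\<And>x. x \<in> B \<Longrightarrow> norm x \<le> M2" 
    using assms[THEN compact_imp_bounded] unfolding bounded_iff by auto
  define M where "M = \<bar>M1\<bar> + \<bar>M2\<bar> + 1"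
  have *: "z \<in> cbox (- M *\<^sub>R One) (M *\<^sub>R One)" if "norm z \<le> M" for z :: 'a
    unfolding mem_box using Basis_le_norm[of _ z] that by (auto simp: abs_le_iff) (smt (verit, best))+
  have "norm (x - y) \<le> M" "norm (y - x) \<le> M" if "x \<in> A" "y \<in> B" for x y
    using M(1)[OF that(1)] M(2)[OF that(2)] norm_triangle_ineq4[of x y] norm_triangle_ineq4[of y x]
    unfolding M_def by auto
  moreover have "M > 0" by (simp add: M_def)
  ultimately show ?thesis using * that by blast
qed

text \<open>Trigonometric polynomials with arbitrary real frequencies, so that their periods can be
  adapted to any given box.\<close>

inductive_set trig :: "('a::euclidean_space \<Rightarrow> complex) set" where
  character: "(\<lambda>x. c * cis (x \<bullet> \<xi>)) \<in> trig"
| add: "f \<in> trig \<Longrightarrow> g \<in> trig \<Longrightarrow> (\<lambda>x. f x + g x) \<in> trig"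

lemma trig_cmult: "f \<in> trig \<Longrightarrow> (\<lambda>x. c * f x) \<in> trig"
proof (induction rule: trig.induct)
  case (character d \<xi>)
  then show ?case using trig.character[of "c * d" \<xi>] by (simp add: mult.assoc)
next
  case (add f g)
  then show ?case using trig.add[of "\<lambda>x. c * f x" "\<lambda>x. c * g x"] by (simp add: distrib_left)
qed

lemma trig_const: "(\<lambda>_. c) \<in> trig"
  using trig.character[of c 0] by simp

lemma trig_sum: "(\<And>i. i \<in> I \<Longrightarrow> f i \<in> trig) \<Longrightarrow> (\<lambda>x. \<Sum>i\<in>I. f i x) \<in> trig"
  by (induction I rule: infinite_finite_induct) (simp_all add: trig_const trig.add)

lemma trig_mult: "f \<in> trig \<Longrightarrow> g \<in> trig \<Longrightarrow> (\<lambda>x. f x * g x) \<in> trig"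
proof (induction f rule: trig.induct)
  case (character c \<xi>)
  from this show ?case
  proof (induction g rule: trig.induct)
    case (character d \<zeta>)
    then show ?case using trig.character[of "c * d" "\<xi> + \<zeta>"] by (simp add: inner_add_right cis_mult[symmetric] mult_ac)
  next
    case (add f g)
    then show ?case using trig.add[OF add(3,4)] by (simp add: distrib_left)
  qed
next
  case (add f1 f2)
  then show ?case using trig.add[OF add(3,4)] by (simp add: distrib_right)
qed

lemma trig_power: "f \<in> trig \<Longrightarrow> (\<lambda>x. f x ^ k) \<in> trig"
  by (induction k) (simp_all add: trig_const trig_mult)

lemma trig_cos: "(\<lambda>x. complex_of_real (cos (x \<bullet> \<xi>))) \<in> trig"
proof -
  have "(\<lambda>x. 1 / 2 * cis (x \<bullet> \<xi>) + 1 / 2 * cis (x \<bullet> (- \<xi>))) \<in> trig"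
    by (intro trig.add trig.character)
  moreover have "1 / 2 * cis t + 1 / 2 * cis (- t) = complex_of_real (cos t)" for t
    by (simp add: complex_eq_iff)
  ultimately show ?thesis by (simp add: inner_minus_right)
qed

lemma trig_continuous: "f \<in> trig \<Longrightarrow> continuous_on UNIV f"
  by (induction rule: trig.induct) (intro continuous_intros; simp)+

lemma trig_smooth: "f \<in> trig \<Longrightarrow> smooth f"
  by (induction rule: trig.induct) (simp_all add: smooth_cmult[OF smooth_cis_inner] smooth_add)

text \<open>Characters are eigenfunctions of convolution: convolving one with \<psi> multiplies it
  by a Fourier integral of \<psi>.\<close>

lemma trig_convolution:
  assumes psi: "\<psi> \<in> test_functions" and P: "P \<in> trig"
  shows "(\<lambda>x. LINT y|lborel. P (x - y) * \<psi> y) \<in> trig"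
  using P
proof induction
  case (character c \<xi>)
  have "(LINT y|lborel. c * cis ((x - y) \<bullet> \<xi>) * \<psi> y) = (c * (LINT y|lborel. cis (- (y \<bullet> \<xi>)) * \<psi> y)) * cis (x \<bullet> \<xi>)" for x
  proof -
    have "cis ((x - y) \<bullet> \<xi>) = cis (x \<bullet> \<xi>) * cis (- (y \<bullet> \<xi>))" for y
      by (simp add: inner_diff_left cis_mult)
    then have "c * cis ((x - y) \<bullet> \<xi>) * \<psi> y = (c * cis (x \<bullet> \<xi>)) * (cis (- (y \<bullet> \<xi>)) * \<psi> y)" for y
      by (simp only: mult.assoc)
    then have "(LINT y|lborel. c * cis ((x - y) \<bullet> \<xi>) * \<psi> y)
        = (LINT y|lborel. (c * cis (x \<bullet> \<xi>)) * (cis (- (y \<bullet> \<xi>)) * \<psi> y))" by presburger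
    then show ?thesis by simp
  qed
  then show ?case by (simp add: trig.character)
next
  case (add f g)
  have i: "integrable lborel (\<lambda>y. h (x - y) * \<psi> y)" if "h \<in> trig" for h x
  proof (rule integrable_compact_support[OF _ test_compact[OF psi]])
    show "continuous_on UNIV (\<lambda>y. h (x - y) * \<psi> y)"
      by (intro continuous_on_mult continuous_on_compose2[OF trig_continuous[OF that]]
          continuous_on_diff continuous_on_const continuous_on_id smooth_continuous_on[OF test_smooth[OF psi]]) auto
  qed (simp add: not_in_supp[of _ \<psi>])
  have "(LINT y|lborel. (f (x - y) + g (x - y)) * \<psi> y) = (LINT y|lborel. f (x - y) * \<psi> y) + (LINT y|lborel. g (x - y) * \<psi> y)" for x
    using i[OF add(1)] i[OF add(2)] by (simp add: distrib_right)
  then show ?case using trig.add[OF add(3,4)] by simp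
qed

text \<open>The normalised powers of \<open>W\<close> concentrate at its unique maximum 0, as for
  the Landau kernel. Near 0 uniform continuity of f is used; away from 0 the powers decay faster
  than their total mass.\<close>

lemma uniform_limit_approximate_identity:
  fixes W :: "'a::euclidean_space \<Rightarrow> real" and f :: "'a \<Rightarrow> complex"
  assumes W: "continuous_on UNIV W" "W 0 = 1" "\<And>z. 0 \<le> W z" "\<And>z. z \<in> cbox a b \<Longrightarrow> z \<noteq> 0 \<Longrightarrow> W z < 1"
    and ab: "0 \<in> box a b" and f: "continuous_on UNIV f" and S: "compact S"
  shows "uniform_limit S (\<lambda>k. box_conv (\<lambda>z. of_real (W z ^ k / integral (cbox a b) (\<lambda>z. W z ^ k))) (-1) a b f) f sequentially"
  unfolding uniform_limit_iff
proof (intro allI impI)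
  fix e :: real assume e: "e > 0"
  define I where "I k = integral (cbox a b) (\<lambda>z. W z ^ k)" for k
  define L where "L = (\<lambda>(x,z). x + -1 *\<^sub>R z) ` (S \<times> cbox a b)"
  have L: "compact L" unfolding L_def split_beta
    by (intro compact_continuous_image compact_Times S compact_cbox continuous_intros)
  have "0 \<in> cbox a b" using ab box_subset_cbox by blast
  then have SL: "x \<in> L" if "x \<in> S" for x unfolding L_def using that by (force intro!: image_eqI[of _ _ "(x, 0)"])
  have xzL: "x + -1 *\<^sub>R z \<in> L" if "x \<in> S" "z \<in> cbox a b" for x z using that unfolding L_def by force
  have "bounded (f ` L)" by (intro compact_imp_bounded compact_continuous_image continuous_on_subset[OF f] L) auto
  then obtain C where C: "C > 0" "\<And>x. x \<in> L \<Longrightarrow> cmod (f x) \<le> C" unfolding bounded_pos by auto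
  have "uniformly_continuous_on L f"
    by (intro compact_uniformly_continuous continuous_on_subset[OF f] L) auto
  then obtain d where d: "d > 0" "\<And>x y. x \<in> L \<Longrightarrow> y \<in> L \<Longrightarrow> dist x y < d \<Longrightarrow> dist (f x) (f y) < e / 2"
    using e unfolding uniformly_continuous_on_def by (metis dist_commute half_gt_zero)
  \<comment> \<open>q is the maximum of \<open>W\<close> on the part of the box outside the ball of
    radius d. It is below 1 since that compact set omits 0; if the set is empty, any value will
    do.\<close>
  obtain q where q: "0 \<le> q" "q < 1" "\<And>z. z \<in> cbox a b \<Longrightarrow> norm z \<ge> d \<Longrightarrow> W z \<le> q"
  proof (cases "cbox a b - ball 0 d = {}")
    case True
    then show ?thesis by (intro that[of 0]) (auto simp: subset_iff)
  next
    case False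
    have "compact (cbox a b - ball 0 d)" by (intro compact_diff compact_cbox open_ball)
    from continuous_attains_sup[OF this False continuous_on_subset[OF W(1)]]
    obtain z where z: "z \<in> cbox a b - ball 0 d" "\<And>y. y \<in> cbox a b - ball 0 d \<Longrightarrow> W y \<le> W z" by auto
    show ?thesis
    proof (rule that[of "W z"])
      show "W z < 1" using z d by (intro W(4)) auto
      show "W y \<le> W z" if "y \<in> cbox a b" "norm y \<ge> d" for y using that by (intro z(2)) auto
    qed (rule W(3))
  qed
  \<comment> \<open>By continuity \<open>W\<close> exceeds q' on a small box of volume v around 0,
    so the mass \<open>I k\<close> is at least \<open>q' ^ k * v\<close>. As q < q', the far part is
    bounded by a multiple of \<open>(q / q') ^ k\<close>.\<close>
  define q' where "q' = (1 + q) / 2"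
  have q': "q < q'" "q' < 1" "0 < q'" using q by (auto simp: q'_def)
  have "open (box a b \<inter> {z. q' < W z})"
    by (intro open_Int open_box open_Collect_less continuous_intros W(1))
  moreover have "0 \<in> box a b \<inter> {z. q' < W z}" using ab W(2) q' by auto
  ultimately obtain c c' where cc: "0 \<in> box c c'" "cbox c c' \<subseteq> box a b \<inter> {z. q' < W z}"
    by (rule open_contains_cbox)
  define v where "v = measure lborel (cbox c c')"
  have v: "v > 0" using cc(1) unfolding v_def by (metis content_pos_lt_eq box_ne_empty(2) empty_iff)
  have int: "(\<lambda>z. W z ^ k) integrable_on cbox s t" for k s t
    by (intro integrable_continuous continuous_on_power continuous_on_subset[OF W(1)]) auto
  have I: "I k \<ge> q' ^ k * v" for k
  proof -
    have "q' ^ k * v = integral (cbox c c') (\<lambda>_. q' ^ k)" by (simp add: v_def)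
    also have "\<dots> \<le> integral (cbox c c') (\<lambda>z. W z ^ k)"
    proof (rule integral_le[OF integrable_const int])
      fix z assume "z \<in> cbox c c'"
      then have "q' < W z" using cc(2) by blast
      then show "q' ^ k \<le> W z ^ k" using q'(3) by (intro power_mono) auto
    qed
    also have "\<dots> \<le> I k" unfolding I_def
      by (rule integral_subset_le) (use cc box_subset_cbox[of a b] int W(3) in auto)
    finally show ?thesis .
  qed
  have Ipos: "I k > 0" for k using I[of k] v q'(3) by (smt (verit) mult_pos_pos zero_less_power)
  define B where "B = measure lborel (cbox a b)"
  have "(\<lambda>k. 2 * C * B / v * (q / q') ^ k) \<longlonglongrightarrow> 2 * C * B / v * 0"
    using q q' by (intro tendsto_mult tendsto_const LIMSEQ_power_zero) auto
  then have "\<forall>\<^sub>F k in sequentially. 2 * C * B / v * (q / q') ^ k < e / 2"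
    using e by (intro order_tendstoD) auto
  then show "\<forall>\<^sub>F k in sequentially. \<forall>x\<in>S. dist (box_conv (\<lambda>z. of_real (W z ^ k / integral (cbox a b) (\<lambda>z. W z ^ k))) (-1) a b f x) (f x) < e"
  proof eventually_elim
    case (elim k)
    show ?case
    proof
      fix x assume x: "x \<in> S"
      have c1: "continuous_on (cbox a b) (\<lambda>z. complex_of_real (W z ^ k / I k) * f (x + -1 *\<^sub>R z))"
        by (intro continuous_intros continuous_on_subset[OF W(1)] continuous_on_compose2[OF f]) (use Ipos[of k] in auto)
      have c2: "continuous_on (cbox a b) (\<lambda>z. complex_of_real (W z ^ k / I k) * f x)"
        by (intro continuous_intros continuous_on_subset[OF W(1)]) (use Ipos[of k] in auto)
      have "((\<lambda>z. complex_of_real (W z ^ k / I k) * f x) has_integral complex_of_real (I k / I k) * f x) (cbox a b)"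
        by (intro has_integral_mult_left has_integral_of_real has_integral_divide)
           (simp add: I_def integrable_integral int)
      then have fx: "integral (cbox a b) (\<lambda>z. complex_of_real (W z ^ k / I k) * f x) = f x"
        by (rule integral_unique[THEN trans]) (use Ipos[of k] in simp)
      have "box_conv (\<lambda>z. of_real (W z ^ k / I k)) (-1) a b f x - f x
        = integral (cbox a b) (\<lambda>z. complex_of_real (W z ^ k / I k) * f (x + -1 *\<^sub>R z) - complex_of_real (W z ^ k / I k) * f x)"
        unfolding box_conv_def by (subst integral_diff) (use c1 c2 fx in \<open>auto intro: integrable_continuous\<close>)
      \<comment> \<open>The bound for the near part and the bound for the far part are added, so the
        domain of integration need not be split. The first term integrates to e / 2, the second
        becomes small with k.\<close>
      also have "cmod \<dots> \<le> integral (cbox a b) (\<lambda>z. e / 2 / I k * W z ^ k + 2 * C * q ^ k / I k)"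
      proof (rule integral_norm_bound_integral)
        show "(\<lambda>z. complex_of_real (W z ^ k / I k) * f (x + -1 *\<^sub>R z) - complex_of_real (W z ^ k / I k) * f x) integrable_on cbox a b"
          by (intro integrable_continuous continuous_on_diff c1 c2)
        show "(\<lambda>z. e / 2 / I k * W z ^ k + 2 * C * q ^ k / I k) integrable_on cbox a b"
          by (intro integrable_continuous continuous_intros continuous_on_subset[OF W(1)]) auto
        fix z assume z: "z \<in> cbox a b"
        have "cmod (complex_of_real (W z ^ k / I k) * f (x + -1 *\<^sub>R z) - complex_of_real (W z ^ k / I k) * f x)
            = W z ^ k / I k * dist (f (x + -1 *\<^sub>R z)) (f x)"
          using W(3)[of z] Ipos[of k] unfolding right_diff_distrib[symmetric] norm_mult dist_norm
          by (simp add: norm_power norm_divide)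
        also have "\<dots> \<le> W z ^ k / I k * (e / 2) + q ^ k / I k * (2 * C)"
        proof (cases "norm z < d")
          case True
          then have "dist (f (x + -1 *\<^sub>R z)) (f x) \<le> e / 2"
            by (intro less_imp_le d(2) xzL SL x z) (simp add: dist_norm)
          then have "W z ^ k / I k * dist (f (x + -1 *\<^sub>R z)) (f x) \<le> W z ^ k / I k * (e / 2)"
            using W(3)[of z] Ipos[of k] by (intro mult_left_mono) auto
          then show ?thesis using q C Ipos[of k] by (smt (verit) divide_nonneg_pos mult_nonneg_nonneg zero_le_power)
        next
          case False
          have "dist (f (x + -1 *\<^sub>R z)) (f x) \<le> 2 * C"
            using C(2)[OF xzL[OF x z]] C(2)[OF SL[OF x]] by (smt (verit) dist_norm norm_triangle_ineq4)
          moreover have "W z ^ k / I k \<le> q ^ k / I k"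
            using False q(3)[OF z] W(3)[of z] Ipos[of k] by (intro divide_right_mono power_mono) auto
          ultimately have "W z ^ k / I k * dist (f (x + -1 *\<^sub>R z)) (f x) \<le> q ^ k / I k * (2 * C)"
            using q Ipos[of k] by (intro mult_mono) (auto simp: less_imp_le)
          moreover have "0 \<le> W z ^ k / I k * (e / 2)" using W(3)[of z] Ipos[of k] e by (auto simp: less_imp_le)
          ultimately show ?thesis by linarith
        qed
        finally show "cmod (complex_of_real (W z ^ k / I k) * f (x + -1 *\<^sub>R z) - complex_of_real (W z ^ k / I k) * f x)
           \<le> e / 2 / I k * W z ^ k + 2 * C * q ^ k / I k" by (simp add: mult_ac)
      qed
      also have "\<dots> = e / 2 / I k * I k + 2 * C * q ^ k / I k * B"
      proof -
        have "((\<lambda>z. e / 2 / I k * W z ^ k + 2 * C * q ^ k / I k) has_integral (e / 2 / I k * I k + B *\<^sub>R (2 * C * q ^ k / I k))) (cbox a b)"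
          unfolding B_def by (intro has_integral_add has_integral_mult_right has_integral_const)
            (simp add: I_def integrable_integral int)
        from integral_unique[OF this] show ?thesis by (simp add: mult.commute)
      qed
      also have "\<dots> = e / 2 + 2 * C * B * (q ^ k / I k)" using Ipos[of k] by simp
      also have "\<dots> \<le> e / 2 + 2 * C * B * (q ^ k / (q' ^ k * v))"
        using I[of k] q q' v C Ipos[of k] by (intro add_left_mono mult_left_mono divide_left_mono) (auto simp: B_def)
      also have "\<dots> = e / 2 + 2 * C * B / v * (q / q') ^ k" by (simp add: power_divide)
      also have "\<dots> < e" using elim by simp
      finally show "dist (box_conv (\<lambda>z. of_real (W z ^ k / integral (cbox a b) (\<lambda>z. W z ^ k))) (-1) a b f x) (f x) < e"
        unfolding I_def dist_norm .
    qed
  qed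
qed

text \<open>
  Both \<open>g\<close> and \<open>P\<close> are convolutions of \<open>\<psi>\<close> with the powers of a trigonometric polynomial that peaks
  at the origin of a large box.  They agree on \<open>S\<close>: the derivatives of \<open>g\<close> fall on \<open>\<psi>\<close>, which gives
  convergence, while \<open>P\<close> is trigonometric.
\<close>

lemma test_function_trig_approximation:
  fixes \<psi> :: "'a::euclidean_space \<Rightarrow> complex"
  assumes psi: "\<psi> \<in> test_functions" and S: "compact S"
  obtains g P where "\<And>k. smooth (g k)" "\<And>k::nat. P k \<in> trig" "\<And>k x. x \<in> S \<Longrightarrow> g k x = P k x"
    "\<And>vs. vs \<in> lists Basis \<Longrightarrow> uniform_limit S (\<lambda>k. iter_deriv vs (g k)) (iter_deriv vs \<psi>) sequentially"
proof -
  obtain M where M: "M > 0" "\<And>x y. x \<in> S \<Longrightarrow> y \<in> supp \<psi> \<Longrightarrow> x - y \<in> cbox (- M *\<^sub>R One) (M *\<^sub>R One)"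
    using ex_cbox_differences[OF S test_compact[OF psi]] by metis
  define a :: 'a where "a = - M *\<^sub>R One"
  define b :: 'a where "b = M *\<^sub>R One"
  \<comment> \<open>The mean over the coordinates of (1 + cos(z_j / M)) / 2. On the cube |z_j / M|
    is at most 1, hence below pi, so each cosine equals 1 only at z_j = 0, and \<open>W\<close>
    reaches 1 only at the origin.\<close>
  define W where "W z = (\<Sum>j\<in>Basis. (1 + cos (z \<bullet> (j /\<^sub>R M))) / (2 * DIM('a)))" for z :: 'a
  have Wc: "continuous_on UNIV W" unfolding W_def by (intro continuous_intros) auto
  have W0: "W 0 = 1" by (simp add: W_def)
  have Wpos: "0 \<le> W z" for z unfolding W_def by (intro sum_nonneg divide_nonneg_nonneg) (auto simp: add_nonneg_nonneg; smt (verit) cos_ge_minus_one)+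
  have Wlt: "W z < 1" if z: "z \<in> cbox a b" "z \<noteq> 0" for z
  proof -
    obtain j where j: "j \<in> Basis" "z \<bullet> j \<noteq> 0" using z(2) by (metis euclidean_all_zero_iff)
    have zj: "\<bar>z \<bullet> j\<bar> \<le> M" using z(1) j(1) by (auto simp: mem_box a_def b_def abs_le_iff dest: bspec[OF _ j(1)])
    have "cos \<bar>z \<bullet> (j /\<^sub>R M)\<bar> < cos 0"
    proof (rule cos_monotone_0_pi)
      show "0 < \<bar>z \<bullet> (j /\<^sub>R M)\<bar>" using j M(1) by simp
      have "\<bar>z \<bullet> (j /\<^sub>R M)\<bar> \<le> 1" using zj M(1) by (simp add: abs_mult field_simps)
      then show "\<bar>z \<bullet> (j /\<^sub>R M)\<bar> \<le> pi" using pi_gt3 by linarith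
    qed simp
    then have lt: "cos (z \<bullet> (j /\<^sub>R M)) < 1" by simp
    have "W z < (\<Sum>j\<in>(Basis::'a set). 2 / (2 * DIM('a)))"
      unfolding W_def
    proof (rule sum_strict_mono_ex1)
      show "\<exists>j\<in>Basis. (1 + cos (z \<bullet> (j /\<^sub>R M))) / (2 * DIM('a)) < 2 / (2 * DIM('a))"
        using j(1) lt by (intro bexI[of _ j] divide_strict_right_mono) auto
      show "\<forall>j\<in>Basis. (1 + cos (z \<bullet> (j /\<^sub>R M))) / (2 * DIM('a)) \<le> 2 / (2 * DIM('a))"
        by (intro ballI divide_right_mono) auto
    qed simp
    then show ?thesis by simp
  qed
  define I where "I k = integral (cbox a b) (\<lambda>z. W z ^ k)" for k
  define w where "w k z = complex_of_real (W z ^ k / integral (cbox a b) (\<lambda>z. W z ^ k))" for k z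
  have wc: "continuous_on UNIV (w k)" for k
    unfolding w_def divide_inverse by (intro continuous_intros continuous_on_subset[OF Wc]) auto
  define g where "g k = box_conv (w k) (-1) a b \<psi>" for k
  define P where "P k x = (LINT y|lborel. w k (x - y) * \<psi> y)" for k x
  have "(\<lambda>z. complex_of_real (W z)) \<in> trig"
  proof -
    have "(\<lambda>z. (\<Sum>j\<in>Basis. 1 / (2 * DIM('a)) * (1 + complex_of_real (cos (z \<bullet> (j /\<^sub>R M)))))) \<in> (trig :: ('a \<Rightarrow> complex) set)"
      by (intro trig_sum trig_cmult trig.add trig_const trig_cos)
    then show ?thesis by (simp add: W_def)
  qed
  from trig_cmult[OF trig_power[OF this], where c="complex_of_real (inverse c)" for c]
  have "(\<lambda>z. complex_of_real (inverse c) * complex_of_real (W z) ^ k) \<in> trig" for k c .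
  then have "(\<lambda>z. complex_of_real (inverse (I k)) * complex_of_real (W z) ^ k) \<in> trig" for k .
  moreover have "w k = (\<lambda>z. complex_of_real (inverse (I k)) * complex_of_real (W z) ^ k)" for k
    by (rule ext) (simp add: w_def I_def divide_inverse)
  ultimately have wt: "w k \<in> trig" for k by simp
  have ab: "0 \<in> box a b" using M(1) by (auto simp: mem_box a_def b_def)
  show ?thesis
  proof (rule that[of g P])
    show "smooth (g k)" for k unfolding g_def by (rule smooth_box_conv[OF test_smooth[OF psi] wc])
    show "P k \<in> trig" for k unfolding P_def[abs_def] by (rule trig_convolution[OF psi wt])
    show "g k x = P k x" if x: "x \<in> S" for k x
    proof -
      have pc: "continuous_on UNIV \<psi>" by (rule smooth_continuous_on[OF test_smooth[OF psi]])
      have "g k x = (LINT y|lborel. w k y * \<psi> (x + -1 *\<^sub>R y))"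
        unfolding g_def
      \<comment> \<open>For x in S the box contains every y for which x - y lies in
        \<open>supp \<psi>\<close>, so the truncation to the box loses nothing.\<close>
      proof (rule box_conv_eq_lborel_integral[OF wc pc])
        fix y assume y: "y \<notin> cbox a b"
        show "\<psi> (x + -1 *\<^sub>R y) = 0"
        proof (rule not_in_supp[of "x + -1 *\<^sub>R y" \<psi>], rule notI)
          assume "x + -1 *\<^sub>R y \<in> supp \<psi>"
          from M(2)[OF x this] y show False by (simp add: a_def b_def)
        qed
      qed
      also have "\<dots> = (LINT y|lborel. (\<lambda>y. w k (x - y) * \<psi> y) (x + -1 *\<^sub>R y))" by simp
      also have "\<dots> = P k x" unfolding P_def
        by (rule lborel_integral_reflect_translate)
           (auto intro!: continuous_on_mult continuous_on_compose2[OF wc] pc continuous_intros)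
      finally show ?thesis .
    qed
    show "uniform_limit S (\<lambda>k. iter_deriv vs (g k)) (iter_deriv vs \<psi>) sequentially" if vs: "vs \<in> lists Basis" for vs
      unfolding g_def iter_deriv_box_conv[OF test_smooth[OF psi] wc vs]
      unfolding w_def[abs_def]
      by (rule uniform_limit_approximate_identity[OF Wc W0 Wpos Wlt ab
            smooth_continuous_on[OF smooth_iter_deriv[OF test_smooth[OF psi] vs]] S])
  qed
qed

section \<open>Sesquilinear forms invariant under translations and modulations\<close>

text \<open>Linear in the first and conjugate linear in the second argument. Continuity is required
  in the first argument only; \<open>hermitian\<close> carries it over to the second.\<close>

locale invariant_form =
  fixes Q :: "('a::euclidean_space \<Rightarrow> complex) \<Rightarrow> ('a \<Rightarrow> complex) \<Rightarrow> complex"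
  assumes distribution_left: "\<eta> \<in> test_functions \<Longrightarrow> (\<lambda>\<psi>. Q \<psi> \<eta>) \<in> distributions"
    and hermitian: "\<psi> \<in> test_functions \<Longrightarrow> \<eta> \<in> test_functions \<Longrightarrow> Q \<eta> \<psi> = cnj (Q \<psi> \<eta>)"
    and modulation: "\<psi> \<in> test_functions \<Longrightarrow> \<eta> \<in> test_functions \<Longrightarrow>
      Q (\<lambda>x. cis (x \<bullet> \<xi>) * \<psi> x) (\<lambda>x. cis (x \<bullet> \<xi>) * \<eta> x) = Q \<psi> \<eta>"
    and translation: "\<psi> \<in> test_functions \<Longrightarrow> \<eta> \<in> test_functions \<Longrightarrow>
      Q (\<lambda>x. \<psi> (x + t)) (\<lambda>x. \<eta> (x + t)) = Q \<psi> \<eta>"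
begin

definition adjointable :: "('a \<Rightarrow> complex) \<Rightarrow> bool" where
  "adjointable g \<longleftrightarrow> (\<forall>\<psi>\<in>test_functions. \<forall>\<eta>\<in>test_functions.
     Q (\<lambda>x. g x * \<psi> x) \<eta> = Q \<psi> (\<lambda>x. cnj (g x) * \<eta> x))"

lemma add_left: "\<phi> \<in> test_functions \<Longrightarrow> \<psi> \<in> test_functions \<Longrightarrow> \<eta> \<in> test_functions \<Longrightarrow>
    Q (\<lambda>x. \<phi> x + \<psi> x) \<eta> = Q \<phi> \<eta> + Q \<psi> \<eta>"
  using distribution_add[OF distribution_left] by simp

lemma cmult_left: "\<psi> \<in> test_functions \<Longrightarrow> \<eta> \<in> test_functions \<Longrightarrow> Q (\<lambda>x. c * \<psi> x) \<eta> = c * Q \<psi> \<eta>"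
  using distribution_cmult[OF distribution_left] by simp

lemma add_right: "\<phi> \<in> test_functions \<Longrightarrow> \<psi> \<in> test_functions \<Longrightarrow> \<eta> \<in> test_functions \<Longrightarrow>
    Q \<eta> (\<lambda>x. \<phi> x + \<psi> x) = Q \<eta> \<phi> + Q \<eta> \<psi>"
  by (simp add: hermitian[of _ \<eta>] test_add add_left)

lemma cmult_right: "\<psi> \<in> test_functions \<Longrightarrow> \<eta> \<in> test_functions \<Longrightarrow> Q \<eta> (\<lambda>x. c * \<psi> x) = cnj c * Q \<eta> \<psi>"
  by (simp add: hermitian[of _ \<eta>] test_cmult cmult_left)

text \<open>A modulation preserves \<open>Q\<close>, so its adjoint is its inverse, which is
  multiplication by the conjugate character. The scalar c is handled by sesquilinearity.\<close>

lemma adjointable_character: "adjointable (\<lambda>x. c * cis (x \<bullet> \<xi>))"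
  unfolding adjointable_def
proof (intro ballI)
  fix \<psi> \<eta> :: "'a \<Rightarrow> complex" assume T: "\<psi> \<in> test_functions" "\<eta> \<in> test_functions"
  have Tc: "(\<lambda>x. cis (x \<bullet> \<zeta>) * \<phi> x) \<in> test_functions" if "\<phi> \<in> test_functions" for \<zeta> and \<phi> :: "'a \<Rightarrow> complex"
    using that by (rule test_mult[OF smooth_cis_inner])
  have "Q (\<lambda>x. cis (x \<bullet> \<xi>) * \<psi> x) \<eta>
     = Q (\<lambda>x. cis (x \<bullet> \<xi>) * \<psi> x) (\<lambda>x. cis (x \<bullet> \<xi>) * (cis (x \<bullet> (- \<xi>)) * \<eta> x))"
    by (simp add: mult.assoc[symmetric] cis_mult inner_minus_right)
  also have "\<dots> = Q \<psi> (\<lambda>x. cis (x \<bullet> (- \<xi>)) * \<eta> x)" by (rule modulation[OF T(1) Tc[OF T(2)]])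
  finally have "c * Q (\<lambda>x. cis (x \<bullet> \<xi>) * \<psi> x) \<eta> = cnj (cnj c) * Q \<psi> (\<lambda>x. cis (x \<bullet> (- \<xi>)) * \<eta> x)" by simp
  then have "Q (\<lambda>x. c * (cis (x \<bullet> \<xi>) * \<psi> x)) \<eta> = Q \<psi> (\<lambda>x. cnj c * (cis (x \<bullet> (- \<xi>)) * \<eta> x))"
    by (simp only: cmult_left[OF Tc T(2)] cmult_right[OF Tc T(1)] T)
  then show "Q (\<lambda>x. c * cis (x \<bullet> \<xi>) * \<psi> x) \<eta> = Q \<psi> (\<lambda>x. cnj (c * cis (x \<bullet> \<xi>)) * \<eta> x)"
    by (simp add: mult.assoc cis_cnj inner_minus_right)
qed

lemma adjointable_trig: "g \<in> trig \<Longrightarrow> adjointable g"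
proof (induction rule: trig.induct)
  case (character c \<xi>)
  show ?case by (rule adjointable_character)
next
  case (add f g)
  show ?case unfolding adjointable_def
  proof (intro ballI)
    fix \<psi> \<eta> :: "'a \<Rightarrow> complex" assume T: "\<psi> \<in> test_functions" "\<eta> \<in> test_functions"
    note sm = trig_smooth[OF add(1)] trig_smooth[OF add(2)]
    have "Q (\<lambda>x. (f x + g x) * \<psi> x) \<eta> = Q (\<lambda>x. f x * \<psi> x) \<eta> + Q (\<lambda>x. g x * \<psi> x) \<eta>"
      using add_left[OF test_mult[OF sm(1) T(1)] test_mult[OF sm(2) T(1)] T(2)] by (simp add: distrib_right)
    also have "\<dots> = Q \<psi> (\<lambda>x. cnj (f x) * \<eta> x) + Q \<psi> (\<lambda>x. cnj (g x) * \<eta> x)"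
      using add(3,4) T by (simp add: adjointable_def)
    also have "\<dots> = Q \<psi> (\<lambda>x. cnj (f x + g x) * \<eta> x)"
      using add_right[OF test_mult[OF smooth_cnj[OF sm(1)] T(2)] test_mult[OF smooth_cnj[OF sm(2)] T(2)] T(1)]
      by (simp add: distrib_right)
    finally show "Q (\<lambda>x. (f x + g x) * \<psi> x) \<eta> = Q \<psi> (\<lambda>x. cnj (f x + g x) * \<eta> x)" .
  qed
qed

lemma tendsto_mult_left:
  assumes T: "\<psi> \<in> test_functions" "\<eta> \<in> test_functions" and g: "\<And>k. smooth (g k)" "smooth h"
    and lim: "\<And>vs. vs \<in> lists Basis \<Longrightarrow> uniform_limit (supp \<psi>) (\<lambda>k. iter_deriv vs (g k)) (iter_deriv vs h) sequentially"
  shows "(\<lambda>k. Q (\<lambda>x. g k x * \<psi> x) \<eta>) \<longlonglongrightarrow> Q (\<lambda>x. h x * \<psi> x) \<eta>"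
proof -
  have "(\<lambda>k. Q (\<lambda>x. (g k x - h x) * \<psi> x) \<eta>) \<longlonglongrightarrow> 0"
  proof (rule distribution_mult_tendsto_0[OF distribution_left[OF T(2)] T(1) smooth_diff[OF g]])
    fix vs :: "'a list" assume vs: "vs \<in> lists Basis"
    show "uniform_limit (supp \<psi>) (\<lambda>k. iter_deriv vs (\<lambda>x. g k x - h x)) (\<lambda>_. 0) sequentially"
      unfolding iter_deriv_diff[OF g vs] using lim[OF vs] by (simp add: uniform_limit_iff dist_norm)
  qed
  moreover have "Q (\<lambda>x. (g k x - h x) * \<psi> x) \<eta> = Q (\<lambda>x. g k x * \<psi> x) \<eta> - Q (\<lambda>x. h x * \<psi> x) \<eta>" for k
    using distribution_diff[OF distribution_left[OF T(2)] test_mult[OF g(1) T(1)] test_mult[OF g(2) T(1)]]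
    by (simp add: left_diff_distrib)
  ultimately show ?thesis by (simp add: LIM_zero_iff)
qed

text \<open>The polynomials \<open>P k\<close> can be moved across \<open>Q\<close>, while the
  functions \<open>g k\<close> are the ones that converge with all derivatives. The two may be
  exchanged because S contains the supports of both arguments. The limit in the second argument is
  taken in the first one, after conjugation.\<close>

lemma adjointable_test:
  assumes phi: "\<phi> \<in> test_functions"
  shows "adjointable \<phi>"
  unfolding adjointable_def
proof (intro ballI)
  fix \<psi> \<eta> :: "'a \<Rightarrow> complex" assume T: "\<psi> \<in> test_functions" "\<eta> \<in> test_functions"
  define S where "S = supp \<psi> \<union> supp \<eta>"
  have "compact S" unfolding S_def by (intro compact_Un test_compact T)
  then obtain g P where g: "\<And>k. smooth (g k)" and P: "\<And>k::nat. P k \<in> trig"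
    and gP: "\<And>k x. x \<in> S \<Longrightarrow> g k x = P k x"
    and lim: "\<And>vs. vs \<in> lists Basis \<Longrightarrow> uniform_limit S (\<lambda>k. iter_deriv vs (g k)) (iter_deriv vs \<phi>) sequentially"
    using test_function_trig_approximation[OF phi] by metis
  note sphi = test_smooth[OF phi]
  have gP1: "(\<lambda>x. g k x * \<psi> x) = (\<lambda>x. P k x * \<psi> x)" for k
    using gP not_in_supp[of _ \<psi>] unfolding S_def by fastforce
  have gP2: "(\<lambda>x. cnj (g k x) * \<eta> x) = (\<lambda>x. cnj (P k x) * \<eta> x)" for k
    using gP not_in_supp[of _ \<eta>] unfolding S_def by fastforce
  have "(\<lambda>k. Q (\<lambda>x. g k x * \<psi> x) \<eta>) \<longlonglongrightarrow> Q (\<lambda>x. \<phi> x * \<psi> x) \<eta>"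
    by (rule tendsto_mult_left[OF T g sphi uniform_limit_on_subset[OF lim]]) (auto simp: S_def)
  moreover have "(\<lambda>k. Q (\<lambda>x. cnj (g k x) * \<eta> x) \<psi>) \<longlonglongrightarrow> Q (\<lambda>x. cnj (\<phi> x) * \<eta> x) \<psi>"
  proof (rule tendsto_mult_left[OF T(2,1) smooth_cnj[OF g] smooth_cnj[OF sphi]])
    fix vs :: "'a list" assume vs: "vs \<in> lists Basis"
    have "uniform_limit (supp \<eta>) (\<lambda>k. iter_deriv vs (g k)) (iter_deriv vs \<phi>) sequentially"
      by (rule uniform_limit_on_subset[OF lim[OF vs]]) (simp add: S_def)
    then show "uniform_limit (supp \<eta>) (\<lambda>k. iter_deriv vs (\<lambda>x. cnj (g k x))) (iter_deriv vs (\<lambda>x. cnj (\<phi> x))) sequentially"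
      unfolding iter_deriv_bounded_linear[OF bounded_linear_cnj g vs] iter_deriv_bounded_linear[OF bounded_linear_cnj sphi vs]
      by (simp add: uniform_limit_iff dist_norm flip: complex_cnj_diff)
  qed
  then have "(\<lambda>k. cnj (Q (\<lambda>x. cnj (g k x) * \<eta> x) \<psi>)) \<longlonglongrightarrow> cnj (Q (\<lambda>x. cnj (\<phi> x) * \<eta> x) \<psi>)"
    by (rule tendsto_cnj)
  moreover have "Q (\<lambda>x. g k x * \<psi> x) \<eta> = cnj (Q (\<lambda>x. cnj (g k x) * \<eta> x) \<psi>)" for k
  proof -
    have "Q (\<lambda>x. g k x * \<psi> x) \<eta> = Q \<psi> (\<lambda>x. cnj (P k x) * \<eta> x)"
      unfolding gP1 using adjointable_trig[OF P] T by (simp add: adjointable_def)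
    also have "\<dots> = cnj (Q (\<lambda>x. cnj (P k x) * \<eta> x) \<psi>)"
      by (rule hermitian[OF test_mult[OF smooth_cnj[OF trig_smooth[OF P]] T(2)] T(1)])
    finally show ?thesis unfolding gP2 .
  qed
  ultimately have "Q (\<lambda>x. \<phi> x * \<psi> x) \<eta> = cnj (Q (\<lambda>x. cnj (\<phi> x) * \<eta> x) \<psi>)"
    using LIMSEQ_unique by simp
  also have "\<dots> = Q \<psi> (\<lambda>x. cnj (\<phi> x) * \<eta> x)"
    by (rule hermitian[OF test_mult[OF smooth_cnj[OF sphi] T(2)] T(1), symmetric])
  finally show "Q (\<lambda>x. \<phi> x * \<psi> x) \<eta> = Q \<psi> (\<lambda>x. cnj (\<phi> x) * \<eta> x)" .
qed

text \<open>By invariance of Lebesgue measure the translates of f integrate to the same constant at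
  every point of \<open>supp \<psi>\<close>, as long as the box contains all relevant shifts. The
  sign s covers translation in either direction.\<close>

lemma riemann_sum_tendsto:
  assumes T: "\<psi> \<in> test_functions" "\<eta> \<in> test_functions" "f \<in> test_functions" and s: "s = 1 \<or> s = -1"
    and p: "riemann_seq a b p"
    and box: "\<And>x y. x \<in> supp \<psi> \<Longrightarrow> x + s *\<^sub>R y \<in> supp f \<Longrightarrow> y \<in> cbox a b"
  shows "(\<lambda>m. \<Sum>(y,K)\<in>p m. measure lborel K *\<^sub>R Q (\<lambda>x. f (x + s *\<^sub>R y) * \<psi> x) \<eta>) \<longlonglongrightarrow> (LINT x|lborel. f x) * Q \<psi> \<eta>"
proof (rule distribution_riemann_sum[OF distribution_left[OF T(2)] T(1) test_smooth[OF T(3)] p])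
  fix x assume x: "x \<in> supp \<psi>"
  note c = smooth_continuous_on[OF test_smooth[OF T(3)], of UNIV]
  have "box_conv (\<lambda>_. 1) s a b f x = (LINT y|lborel. 1 * f (x + s *\<^sub>R y))"
    by (rule box_conv_eq_lborel_integral[OF continuous_on_const c])
       (use box[OF x] not_in_supp[of _ f] in blast)
  then show "box_conv (\<lambda>_. 1) s a b f x = (LINT x|lborel. f x)"
    using lborel_integral_reflect_translate[OF s c] by simp
qed

text \<open>
  Move all factors but \<open>\<rho>\<close> into the second argument of \<open>Q (\<psi> \<rho>\<^sub>y \<sigma>\<^sub>y\<^sup>*) \<eta>\<close>, where the index \<open>y\<close> denotes
  translation, translate back by \<open>y\<close>, and integrate over \<open>y\<close>.
\<close>

lemma form_exchange:
  assumes T: "\<psi> \<in> test_functions" "\<eta> \<in> test_functions" "\<rho> \<in> test_functions" "\<sigma> \<in> test_functions"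
  shows "(LINT x|lborel. \<rho> x * cnj (\<sigma> x)) * Q \<psi> \<eta> = (LINT x|lborel. \<psi> x * cnj (\<eta> x)) * Q \<rho> \<sigma>"
proof -
  define f where "f = (\<lambda>x. \<rho> x * cnj (\<sigma> x))"
  define h where "h = (\<lambda>x. cnj (\<psi> x) * \<eta> x)"
  have f: "f \<in> test_functions" unfolding f_def by (intro test_mult2 test_cnj T)
  have h: "h \<in> test_functions" unfolding h_def by (intro test_mult2 test_cnj T)
  obtain M1 where M1: "\<And>x y. x \<in> supp \<psi> \<Longrightarrow> y \<in> supp f \<Longrightarrow> y - x \<in> cbox (- M1 *\<^sub>R One) (M1 *\<^sub>R One)"
    using ex_cbox_differences[OF test_compact[OF T(1)] test_compact[OF f]] by metis
  obtain M2 where M2: "\<And>x y. x \<in> supp \<sigma> \<Longrightarrow> y \<in> supp h \<Longrightarrow> x - y \<in> cbox (- M2 *\<^sub>R One) (M2 *\<^sub>R One)"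
    using ex_cbox_differences[OF test_compact[OF T(4)] test_compact[OF h]] by metis
  \<comment> \<open>One cube for both sums, so that they run over the same tagged divisions and
    agree term by term.\<close>
  define a :: 'a where "a = - max M1 M2 *\<^sub>R One"
  define b :: 'a where "b = max M1 M2 *\<^sub>R One"
  have sub: "cbox (- M1 *\<^sub>R One) (M1 *\<^sub>R One) \<subseteq> cbox a b" "cbox (- M2 *\<^sub>R One) (M2 *\<^sub>R One) \<subseteq> cbox a b"
    by (auto simp: a_def b_def subset_box)
  obtain p where p: "riemann_seq a b p" using ex_riemann_seq by blast
  have L1: "(\<lambda>m. \<Sum>(y,K)\<in>p m. measure lborel K *\<^sub>R Q (\<lambda>x. f (x + 1 *\<^sub>R y) * \<psi> x) \<eta>) \<longlonglongrightarrow> (LINT x|lborel. f x) * Q \<psi> \<eta>"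
  proof (rule riemann_sum_tendsto[OF T(1,2) f _ p])
    show "y \<in> cbox a b" if "x \<in> supp \<psi>" "x + 1 *\<^sub>R y \<in> supp f" for x y
      using M1[OF that] sub by auto
  qed simp
  have "(\<lambda>m. \<Sum>(y,K)\<in>p m. measure lborel K *\<^sub>R Q (\<lambda>x. h (x + -1 *\<^sub>R y) * \<sigma> x) \<rho>) \<longlonglongrightarrow> (LINT x|lborel. h x) * Q \<sigma> \<rho>"
  proof (rule riemann_sum_tendsto[OF T(4,3) h _ p])
    show "y \<in> cbox a b" if "x \<in> supp \<sigma>" "x + -1 *\<^sub>R y \<in> supp h" for x y
      using M2[OF that] sub by auto
  qed simp
  then have L2: "(\<lambda>m. cnj (\<Sum>(y,K)\<in>p m. measure lborel K *\<^sub>R Q (\<lambda>x. h (x + -1 *\<^sub>R y) * \<sigma> x) \<rho>)) \<longlonglongrightarrow> cnj ((LINT x|lborel. h x) * Q \<sigma> \<rho>)"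
    by (rule tendsto_cnj)
  \<comment> \<open>An exact identity for each shift, before any limit. The conjugate of the shifted
    \<sigma>, times \<psi>, moves across as a single test function; translating back frees \<rho>
    and \<sigma> of the shift and leaves it on \<open>h\<close> with the opposite sign.\<close>
  have eq: "Q (\<lambda>x. f (x + 1 *\<^sub>R y) * \<psi> x) \<eta> = cnj (Q (\<lambda>x. h (x + -1 *\<^sub>R y) * \<sigma> x) \<rho>)" for y
  proof -
    have \<rho>y: "(\<lambda>x. \<rho> (x + y)) \<in> test_functions" and \<sigma>y: "(\<lambda>x. \<sigma> (x + y)) \<in> test_functions"
      by (intro test_translate T)+
    have m: "(\<lambda>x. cnj (\<sigma> (x + y)) * \<psi> x) \<in> test_functions" by (intro test_mult2 test_cnj \<sigma>y T)
    have hy: "(\<lambda>x. h (x + - y)) \<in> test_functions" by (rule test_translate[OF h])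
    have "Q (\<lambda>x. f (x + 1 *\<^sub>R y) * \<psi> x) \<eta> = Q (\<lambda>x. (cnj (\<sigma> (x + y)) * \<psi> x) * \<rho> (x + y)) \<eta>"
      by (simp add: f_def mult_ac)
    also have "\<dots> = Q (\<lambda>x. \<rho> (x + y)) (\<lambda>x. cnj (cnj (\<sigma> (x + y)) * \<psi> x) * \<eta> x)"
      using adjointable_test[OF m] \<rho>y T(2) by (simp add: adjointable_def)
    also have "(\<lambda>x. cnj (cnj (\<sigma> (x + y)) * \<psi> x) * \<eta> x) = (\<lambda>x. \<sigma> (x + y) * h ((x + y) + - y))"
      by (simp add: h_def mult.assoc)
    also have "Q (\<lambda>x. \<rho> (x + y)) (\<lambda>x. \<sigma> (x + y) * h ((x + y) + - y)) = Q \<rho> (\<lambda>x. \<sigma> x * h (x + - y))"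
      by (rule translation[OF T(3) test_mult2[OF T(4) hy]])
    also have "\<dots> = cnj (Q (\<lambda>x. \<sigma> x * h (x + - y)) \<rho>)"
      by (rule hermitian[OF test_mult2[OF T(4) hy] T(3)])
    finally show ?thesis by (simp add: mult.commute)
  qed
  have "(LINT x|lborel. f x) * Q \<psi> \<eta> = cnj ((LINT x|lborel. h x) * Q \<sigma> \<rho>)"
    using L1 L2 by (simp only: eq) (simp add: split_beta scaleR_conv_of_real LIMSEQ_unique)
  also have "\<dots> = (LINT x|lborel. cnj (h x)) * Q \<rho> \<sigma>"
    using hermitian[OF T(4,3)] by simp
  finally show ?thesis by (simp add: f_def h_def)
qed

end

section \<open>Smooth cutoffs and the lemma of du Bois-Reymond\<close>

text \<open>The functions p(1/t) exp(-1/t), extended by 0. The polynomial factor makes the family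
  closed under differentiation, also at t = 0.\<close>

definition flat_exp :: "real poly \<Rightarrow> real \<Rightarrow> real" where
  "flat_exp p t = (if t \<le> 0 then 0 else poly p (inverse t) / exp (inverse t))"

lemma tendsto_poly_div_exp_0: "((\<lambda>x. poly p x / exp x) \<longlongrightarrow> (0::real)) at_top"
proof -
  have "((\<lambda>x. \<Sum>i\<le>degree p. coeff p i * (x ^ i / exp x)) \<longlongrightarrow> (\<Sum>i\<le>degree p. coeff p i * 0)) at_top"
    by (intro tendsto_sum tendsto_mult tendsto_const tendsto_power_div_exp_0)
  then show ?thesis by (simp add: poly_altdef sum_divide_distrib)
qed

text \<open>With u = 1/t one has du/dt = -u^2, so p(u) exp(-u) has the derivative u^2 (p(u) - p'(u))
  exp(-u); the factor \<open>[:0, 0, 1:]\<close> is u^2.\<close>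

lemma flat_exp_has_derivative:
  "(flat_exp p has_real_derivative flat_exp ([:0, 0, 1:] * (p - pderiv p)) t) (at t)"
proof -
  consider "t < 0" | "t = 0" | "t > 0" by linarith
  then show ?thesis
  proof cases
    case 1
    have "((\<lambda>_. 0) has_real_derivative 0) (at t)" by simp
    then show ?thesis
      using 1 by (subst has_field_derivative_transform_within_open[of "\<lambda>_. 0" _ _ "{..<0}"])
        (auto simp: flat_exp_def)
  next
    case 2
    have "((\<lambda>h. flat_exp p h / h) \<longlongrightarrow> 0) (at_left 0)"
      by (rule tendsto_eventually) (auto simp: flat_exp_def eventually_at_filter)
    moreover have "((\<lambda>h. flat_exp p h / h) \<longlongrightarrow> 0) (at_right 0)"
    proof (rule Lim_transform_eventually)
      \<comment> \<open>Dividing by h multiplies the polynomial by the variable u = 1/h, which is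
        \<open>pCons 0 p\<close>; as h decreases to 0, u tends to infinity and the exponential
        dominates.\<close>
      show "((\<lambda>h. poly (pCons 0 p) (inverse h) / exp (inverse h)) \<longlongrightarrow> 0) (at_right (0::real))"
        by (rule filterlim_compose[OF tendsto_poly_div_exp_0 filterlim_inverse_at_top_right])
      show "\<forall>\<^sub>F h in at_right 0. poly (pCons 0 p) (inverse h) / exp (inverse h) = flat_exp p h / h"
        by (auto simp: flat_exp_def eventually_at_filter field_simps)
    qed
    ultimately have "((\<lambda>h. flat_exp p h / h) \<longlongrightarrow> 0) (at 0)" by (rule filterlim_split_at)
    then show ?thesis using 2 by (simp add: has_field_derivative_iff flat_exp_def)
  next
    case 3
    have "((\<lambda>t. poly p (inverse t) / exp (inverse t)) has_real_derivative
        flat_exp ([:0, 0, 1:] * (p - pderiv p)) t) (at t)"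
      using 3 by (auto intro!: derivative_eq_intros DERIV_chain2[OF poly_DERIV]
          simp: flat_exp_def field_simps power2_eq_square)
    then show ?thesis
      by (rule has_field_derivative_transform_within_open[of _ _ _ "{0<..}"]) (use 3 in \<open>auto simp: flat_exp_def\<close>)
  qed
qed

text \<open>exp(-1/t) for t > 0. It serves twice: as the building block of a bump and, rescaled, to
  approximate the indicator of the positive half line.\<close>

definition step :: "real \<Rightarrow> real" where "step = flat_exp 1"

lemma step_nonpos: "t \<le> 0 \<Longrightarrow> step t = 0" and step_pos: "t > 0 \<Longrightarrow> 0 < step t"
  and step_nonneg: "0 \<le> step t" and step_le_1: "step t \<le> 1"
  by (simp_all add: step_def flat_exp_def)

lemma smooth_step: "smooth (\<lambda>x. complex_of_real (q x)) \<Longrightarrow> smooth (\<lambda>x. complex_of_real (step (q x)))"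
  unfolding step_def
proof (rule smooth_compose_real[of "flat_exp 1" "range flat_exp"])
  fix F :: "real \<Rightarrow> real" assume "F \<in> range flat_exp"
  then obtain p where "F = flat_exp p" by auto
  then show "\<exists>F'\<in>range flat_exp. \<forall>t. (F has_real_derivative F' t) (at t)"
    using flat_exp_has_derivative[of p] by (intro bexI[of _ "flat_exp ([:0, 0, 1:] * (p - pderiv p))"]) simp_all
qed auto

lemma step_scaled_tendsto: "(\<lambda>k. step (real k * t)) \<longlonglongrightarrow> (if t > 0 then 1 else 0)"
proof (cases "t > 0")
  case True
  have "(\<lambda>k. 1 / exp (inverse (real k) * inverse t)) \<longlonglongrightarrow> 1 / exp (0 * inverse t)"
    by (intro tendsto_intros lim_inverse_n) simp
  then have "(\<lambda>k. 1 / exp (inverse (real k) * inverse t)) \<longlonglongrightarrow> 1" by simp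
  moreover have "\<forall>\<^sub>F k in sequentially. 1 / exp (inverse (real k) * inverse t) = step (real k * t)"
    using eventually_gt_at_top[of 0]
    by eventually_elim (use True in \<open>auto simp: step_def flat_exp_def mult_le_0_iff\<close>)
  ultimately have "(\<lambda>k. step (real k * t)) \<longlonglongrightarrow> 1" by (rule Lim_transform_eventually)
  then show ?thesis using True by simp
next
  case False
  then show ?thesis by (simp add: step_nonpos mult_nonneg_nonpos)
qed

lemma smooth_prod: "(\<And>i. i \<in> I \<Longrightarrow> smooth (f i)) \<Longrightarrow> smooth (\<lambda>x. \<Prod>i\<in>I. f i x)"
  by (induction I rule: infinite_finite_induct) (simp_all add: smooth_const smooth_mult)

definition box_bump :: "'a::euclidean_space \<Rightarrow> 'a \<Rightarrow> 'a \<Rightarrow> real" where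
  "box_bump a b x = (\<Prod>j\<in>Basis. step (x \<bullet> j - a \<bullet> j) * step (b \<bullet> j - x \<bullet> j))"

lemma box_bump_nonneg: "0 \<le> box_bump a b x"
  unfolding box_bump_def by (intro prod_nonneg mult_nonneg_nonneg step_nonneg)

lemma box_bump_pos: "0 < box_bump a b x \<longleftrightarrow> x \<in> box a b"
proof
  assume "x \<in> box a b"
  then show "0 < box_bump a b x" unfolding box_bump_def
    by (intro prod_pos ballI mult_pos_pos step_pos) (auto simp: mem_box)
next
  assume pos: "0 < box_bump a b x"
  have "step (x \<bullet> j - a \<bullet> j) * step (b \<bullet> j - x \<bullet> j) \<noteq> 0" if "j \<in> Basis" for j
  proof
    assume "step (x \<bullet> j - a \<bullet> j) * step (b \<bullet> j - x \<bullet> j) = 0"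
    then have "box_bump a b x = 0" unfolding box_bump_def using that by (intro prod_zero) auto
    then show False using pos by simp
  qed
  then have "step (x \<bullet> j - a \<bullet> j) \<noteq> 0" "step (b \<bullet> j - x \<bullet> j) \<noteq> 0" if "j \<in> Basis" for j
    using that by auto
  then have "\<not> x \<bullet> j - a \<bullet> j \<le> 0" "\<not> b \<bullet> j - x \<bullet> j \<le> 0" if "j \<in> Basis" for j
    using that step_nonpos by blast+
  then show "x \<in> box a b" unfolding mem_box by (simp add: not_le)
qed

lemma smooth_box_bump: "smooth (\<lambda>x. complex_of_real (box_bump a b x))"
proof -
  have "smooth (\<lambda>x. complex_of_real (x \<bullet> j - a \<bullet> j))" for j
    using smooth_quadratic[of "- (a \<bullet> j)" j 0] by (simp add: algebra_simps)
  moreover have "smooth (\<lambda>x. complex_of_real (b \<bullet> j - x \<bullet> j))" for j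
    using smooth_quadratic[of "b \<bullet> j" "- j" 0] by (simp add: inner_minus_right)
  ultimately have "smooth (\<lambda>x. \<Prod>j\<in>Basis. complex_of_real (step (x \<bullet> j - a \<bullet> j)) * complex_of_real (step (b \<bullet> j - x \<bullet> j)))"
    by (intro smooth_prod smooth_mult smooth_step)
  then show ?thesis by (simp add: box_bump_def)
qed

text \<open>Since the bump is positive exactly on the open box, rescaled steps of it converge
  pointwise to the indicator of the box from within. Dominated convergence needs no more, in
  particular no plateau where the cutoff equals 1.\<close>

definition box_cutoff :: "'a::euclidean_space \<Rightarrow> 'a \<Rightarrow> nat \<Rightarrow> 'a \<Rightarrow> complex" where
  "box_cutoff a b k x = complex_of_real (step (real k * box_bump a b x))"

lemma box_cutoff_outside: "x \<notin> box a b \<Longrightarrow> box_cutoff a b k x = 0"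
  using box_bump_pos[of a b x] box_bump_nonneg[of a b x] by (simp add: box_cutoff_def step_nonpos)

lemma box_cutoff_test: "box_cutoff a b k \<in> test_functions"
proof (rule test_functionsI(1)[of _ "cbox a b"])
  have "smooth (\<lambda>x. complex_of_real (real k) * complex_of_real (box_bump a b x))"
    by (rule smooth_cmult[OF smooth_box_bump])
  then have "smooth (\<lambda>x. complex_of_real (real k * box_bump a b x))" by simp
  then show "smooth (box_cutoff a b k)" unfolding box_cutoff_def[abs_def] by (rule smooth_step)
  show "box_cutoff a b k x = 0" if "x \<notin> cbox a b" for x
    using that box_subset_cbox[of a b] by (intro box_cutoff_outside) auto
qed simp

lemma box_cutoff_bound: "cmod (box_cutoff a b k x) \<le> indicator (box a b) x"
proof (cases "x \<in> box a b")
  case True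
  then show ?thesis by (simp add: box_cutoff_def step_le_1 step_nonneg)
qed (simp add: box_cutoff_outside)

lemma box_cutoff_tendsto: "(\<lambda>k. box_cutoff a b k x) \<longlonglongrightarrow> indicator (box a b) x"
proof -
  have "(\<lambda>k. complex_of_real (step (real k * box_bump a b x))) \<longlonglongrightarrow> of_real (if box_bump a b x > 0 then 1 else 0)"
    by (intro tendsto_of_real step_scaled_tendsto)
  then show ?thesis by (cases "x \<in> box a b") (simp_all add: box_cutoff_def box_bump_pos)
qed

text \<open>\<open>ennreal\<close> truncates negative values, so M and N have the positive and the
  negative part of g as densities. They agree on boxes, a generator of the Borel sets stable under
  intersections, hence everywhere; so the two parts of g coincide almost everywhere.\<close>

lemma AE_zero_if_box_integrals_zero:
  fixes g :: "'a::euclidean_space \<Rightarrow> real"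
  assumes g[measurable]: "g \<in> borel_measurable borel"
    and i: "\<And>a b. integrable lborel (\<lambda>x. indicator (box a b) x * g x)"
    and z: "\<And>a b. (LINT x|lborel. indicator (box a b) x * g x) = 0"
  shows "AE x in lborel. g x = 0"
proof -
  define M where "M = density lborel (\<lambda>x. ennreal (g x))"
  define N where "N = density lborel (\<lambda>x. ennreal (- g x))"
  let ?E = "range (\<lambda>(a, b). box a b :: 'a set)"
  let ?A = "\<lambda>n::nat. box (- (real n *\<^sub>R One)) (real n *\<^sub>R One) :: 'a set"
  have M: "emeasure M (box a b) = (\<integral>\<^sup>+x. ennreal (indicator (box a b) x * g x) \<partial>lborel)"
    and N: "emeasure N (box a b) = (\<integral>\<^sup>+x. ennreal (- (indicator (box a b) x * g x)) \<partial>lborel)" for a b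
    unfolding M_def N_def
    by (subst emeasure_density; auto intro!: nn_integral_cong split: split_indicator)+
  have fin: "emeasure M (box a b) \<noteq> \<infinity>" "emeasure N (box a b) \<noteq> \<infinity>" for a b
    using i[of a b] unfolding real_integrable_def M N by auto
  have eq: "emeasure M (box a b) = emeasure N (box a b)" for a b
  proof -
    have "enn2real (emeasure M (box a b)) = enn2real (emeasure N (box a b))"
      using real_lebesgue_integral_def[OF i[of a b]] z[of a b] unfolding M N by simp
    then show ?thesis using fin by (metis ennreal_enn2real infinity_ennreal_def top.not_eq_extremum)
  qed
  have "M = N"
  proof (rule measure_eqI_generator_eq[of ?E UNIV M N ?A])
    show "Int_stable ?E" by (auto simp: Int_stable_def box_Int_box)
    show "sets M = sigma_sets UNIV ?E" "sets N = sigma_sets UNIV ?E"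
      by (simp_all add: M_def N_def borel_eq_box)
    show "(\<Union>i. ?A i) = UNIV" by (rule UN_box_eq_UNIV)
    show "emeasure M X = emeasure N X" if "X \<in> ?E" for X using that eq by auto
  qed (use fin in auto)
  then have "AE x in lborel. ennreal (g x) = ennreal (- g x)"
    unfolding M_def N_def by (intro sigma_finite_measure.density_unique[OF sigma_finite_lborel]) auto
  then show ?thesis
  proof eventually_elim
    case (elim x)
    then show ?case by (cases "g x \<ge> 0") (auto simp: ennreal_neg ennreal_eq_0_iff dest: sym)
  qed
qed

lemma square_integrable_mult:
  assumes "f \<in> square_integrable" "g \<in> square_integrable"
  shows "integrable lborel (\<lambda>x. f x * g x)"
proof -
  have [measurable]: "f \<in> borel_measurable borel" "g \<in> borel_measurable borel"
    using assms by (auto simp: square_integrable_def)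
  have "integrable lborel (\<lambda>x. (cmod (f x))\<^sup>2 + (cmod (g x))\<^sup>2)"
    using assms by (simp add: square_integrable_def)
  then show ?thesis
  proof (rule Bochner_Integration.integrable_bound)
    have "norm (f x * g x) \<le> norm ((cmod (f x))\<^sup>2 + (cmod (g x))\<^sup>2)" for x
    proof -
      have "2 * cmod (f x) * cmod (g x) \<le> (cmod (f x))\<^sup>2 + (cmod (g x))\<^sup>2" by (rule sum_squares_bound)
      moreover have "0 \<le> cmod (f x) * cmod (g x)" by simp
      ultimately have "cmod (f x) * cmod (g x) \<le> (cmod (f x))\<^sup>2 + (cmod (g x))\<^sup>2" by linarith
      then show ?thesis by (simp add: norm_mult)
    qed
    then show "AE x in lborel. norm (f x * g x) \<le> norm ((cmod (f x))\<^sup>2 + (cmod (g x))\<^sup>2)"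
      by (intro always_eventually allI)
  qed measurable
qed

lemma test_square_integrable: "\<psi> \<in> test_functions \<Longrightarrow> \<psi> \<in> square_integrable"
proof -
  assume T: "\<psi> \<in> test_functions"
  have "integrable lborel (\<lambda>x. cnj (\<psi> x) * \<psi> x)" by (intro test_integrable test_mult2 test_cnj T)
  then have "integrable lborel (\<lambda>x. Re (cnj (\<psi> x) * \<psi> x))" by (rule integrable_Re)
  moreover have "\<psi> \<in> borel_measurable borel"
    by (intro borel_measurable_continuous_onI smooth_continuous_on test_smooth T)
  moreover have "(cmod z)\<^sup>2 = Re (cnj z * z)" for z :: complex
    unfolding cmod_power2 by (simp add: power2_eq_square)
  ultimately show ?thesis by (simp add: square_integrable_def)
qed

lemma ex_nonzero_test:
  "\<exists>\<rho>\<in>test_functions. 0 < (LINT x|lborel. (cmod (\<rho> (x::'a::euclidean_space)))\<^sup>2)"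
proof -
  define \<rho> where "\<rho> = box_cutoff (0::'a) One 1"
  have T: "\<rho> \<in> test_functions" unfolding \<rho>_def by (rule box_cutoff_test)
  have i: "integrable lborel (\<lambda>x. (cmod (\<rho> x))\<^sup>2)"
    using test_square_integrable[OF T] by (simp add: square_integrable_def)
  have "(LINT x|lborel. (cmod (\<rho> x))\<^sup>2) \<noteq> 0"
  proof
    assume "(LINT x|lborel. (cmod (\<rho> x))\<^sup>2) = 0"
    then have "AE x in lborel. (cmod (\<rho> x))\<^sup>2 = 0"
      by (subst (asm) integral_nonneg_eq_0_iff_AE[OF i]) auto
    then have "AE x in lborel. x \<notin> box (0::'a) One"
    proof eventually_elim
      case (elim x)
      then have "box_bump 0 One x \<le> 0" using step_pos[of "box_bump 0 One x"]
        by (auto simp: \<rho>_def box_cutoff_def not_less[symmetric])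
      then show ?case using box_bump_pos[of 0 One x] by auto
    qed
    then have "emeasure lborel (box (0::'a) One) = 0"
      by (subst (asm) AE_iff_measurable[OF _ refl]) auto
    then show False by (simp add: emeasure_lborel_box_eq)
  qed
  then show ?thesis using T by (intro bexI[of _ \<rho>]) (auto simp: less_le)
qed

lemma indicator_box_square_integrable: "(\<lambda>x. indicator (box a b) x :: complex) \<in> square_integrable"
proof -
  have "integrable lborel (indicator (box a b) :: 'a \<Rightarrow> real)" by (rule integrable_real_indicator) (use emeasure_bounded_finite[OF bounded_box, of a b] in simp_all)
  moreover have "(\<lambda>x. (cmod (indicator (box a b) x))\<^sup>2) = (\<lambda>x. indicator (box a b) x)"
    by (auto simp: indicator_def)
  ultimately show ?thesis by (simp add: square_integrable_def)
qed

text \<open>Cutoffs of boxes are test functions dominated by the box indicators, so the integral of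
  f over every box vanishes. This identifies, up to null sets, different functions that represent
  the same distribution.\<close>

lemma du_Bois_Reymond:
  assumes f: "f \<in> square_integrable" and z: "\<And>\<phi>. \<phi> \<in> test_functions \<Longrightarrow> (LINT x|lborel. f x * \<phi> x) = 0"
  shows "AE x in lborel. f x = 0"
proof -
  have [measurable]: "f \<in> borel_measurable borel" using f by (simp add: square_integrable_def)
  have i: "integrable lborel (\<lambda>x. f x * indicator (box a b) x)" for a b
    by (rule square_integrable_mult[OF f indicator_box_square_integrable])
  have 0: "(LINT x|lborel. f x * indicator (box a b) x) = 0" for a b
  proof -
    have "(\<lambda>k. LINT x|lborel. f x * box_cutoff a b k x) \<longlonglongrightarrow> (LINT x|lborel. f x * indicator (box a b) x)"
    proof (rule integral_dominated_convergence)
      show "integrable lborel (\<lambda>x. cmod (f x * indicator (box a b) x))" using i by (rule integrable_norm)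
      show "(\<lambda>x. f x * box_cutoff a b k x) \<in> borel_measurable lborel" for k
        by (intro borel_measurable_integrable square_integrable_mult f test_square_integrable box_cutoff_test)
      show "AE x in lborel. (\<lambda>k. f x * box_cutoff a b k x) \<longlonglongrightarrow> f x * indicator (box a b) x"
        by (intro always_eventually allI tendsto_mult tendsto_const box_cutoff_tendsto)
      show "AE x in lborel. norm (f x * box_cutoff a b k x) \<le> cmod (f x * indicator (box a b) x)" for k
      proof (intro always_eventually allI)
        fix x
        have "cmod (f x) * cmod (box_cutoff a b k x) \<le> cmod (f x) * indicator (box a b) x"
          by (intro mult_left_mono box_cutoff_bound norm_ge_zero)
        also have "(indicator (box a b) x :: real) = cmod (indicator (box a b) x)" by (simp add: indicator_def)
        finally show "norm (f x * box_cutoff a b k x) \<le> cmod (f x * indicator (box a b) x)"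
          by (simp only: norm_mult)
      qed
    qed measurable
    then show ?thesis using z[OF box_cutoff_test] by (simp add: LIMSEQ_const_iff)
  qed
  have Re: "AE x in lborel. Re (f x) = 0"
  proof (rule AE_zero_if_box_integrals_zero)
    have *: "(\<lambda>x. indicator (box a b) x * Re (f x)) = (\<lambda>x. Re (f x * indicator (box a b) x))" for a b
      by (auto simp: indicator_def)
    show "integrable lborel (\<lambda>x. indicator (box a b) x * Re (f x))" for a b
      unfolding * using i by (rule integrable_Re)
    show "(LINT x|lborel. indicator (box a b) x * Re (f x)) = 0" for a b
      unfolding * using integral_Re[OF i[of a b]] 0 by simp
  qed measurable
  have Im: "AE x in lborel. Im (f x) = 0"
  proof (rule AE_zero_if_box_integrals_zero)
    have *: "(\<lambda>x. indicator (box a b) x * Im (f x)) = (\<lambda>x. Im (f x * indicator (box a b) x))" for a b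
      by (auto simp: indicator_def)
    show "integrable lborel (\<lambda>x. indicator (box a b) x * Im (f x))" for a b
      unfolding * using i by (rule integrable_Im)
    show "(LINT x|lborel. indicator (box a b) x * Im (f x)) = 0" for a b
      unfolding * using integral_Im[OF i[of a b]] 0 by simp
  qed measurable
  show ?thesis using Re Im by eventually_elim (simp add: complex_eq_iff)
qed

section \<open>Square integrable functions\<close>

lemma square_integrable_borel: "f \<in> square_integrable \<Longrightarrow> f \<in> borel_measurable borel"
  by (simp add: square_integrable_def)

lemma square_integrable_sq: "f \<in> square_integrable \<Longrightarrow> integrable lborel (\<lambda>x. (cmod (f x))\<^sup>2)"
  by (simp add: square_integrable_def)

lemma square_integrable_cmult:
  assumes f: "f \<in> square_integrable" shows "(\<lambda>x. c * f x) \<in> square_integrable"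
proof -
  note [measurable] = square_integrable_borel[OF f]
  show ?thesis using square_integrable_sq[OF f] by (simp add: square_integrable_def norm_mult power_mult_distrib)
qed

lemma square_integrable_cnj:
  assumes f: "f \<in> square_integrable" shows "(\<lambda>x. cnj (f x)) \<in> square_integrable"
proof -
  have "(\<lambda>x. cnj (f x)) \<in> borel_measurable borel"
    by (intro borel_measurable_continuous_on[OF _ square_integrable_borel[OF f]] continuous_intros)
  then show ?thesis using square_integrable_sq[OF f] by (simp add: square_integrable_def)
qed

lemma square_integrable_diff:
  assumes f: "f \<in> square_integrable" and g: "g \<in> square_integrable"
  shows "(\<lambda>x. f x - g x) \<in> square_integrable"
proof -
  note [measurable] = square_integrable_borel[OF f] square_integrable_borel[OF g]
  have "integrable lborel (\<lambda>x. 2 * (cmod (f x))\<^sup>2 + 2 * (cmod (g x))\<^sup>2)"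
    using square_integrable_sq[OF f] square_integrable_sq[OF g] by simp
  then have "integrable lborel (\<lambda>x. (cmod (f x - g x))\<^sup>2)"
  proof (rule Bochner_Integration.integrable_bound)
    have "(cmod (f x - g x))\<^sup>2 \<le> 2 * (cmod (f x))\<^sup>2 + 2 * (cmod (g x))\<^sup>2" for x
    proof -
      have "(cmod (f x - g x))\<^sup>2 \<le> (cmod (f x) + cmod (g x))\<^sup>2"
        by (intro power_mono norm_triangle_ineq4) simp
      also have "\<dots> \<le> 2 * (cmod (f x))\<^sup>2 + 2 * (cmod (g x))\<^sup>2"
        using sum_squares_bound[of "cmod (f x)" "cmod (g x)"] by (simp add: power2_sum)
      finally show ?thesis .
    qed
    then show "AE x in lborel. norm ((cmod (f x - g x))\<^sup>2) \<le> norm (2 * (cmod (f x))\<^sup>2 + 2 * (cmod (g x))\<^sup>2)"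
      by (intro always_eventually allI) simp
  qed measurable
  then show ?thesis by (simp add: square_integrable_def)
qed

text \<open>Stated for the bilinear pairing, without a conjugate, to match
  \<open>distribution_of\<close>.\<close>

lemma L2_Cauchy_Schwarz:
  assumes f: "f \<in> square_integrable" and g: "g \<in> square_integrable"
  shows "cmod (LINT x|lborel. f x * g x) \<le> L2_norm f * L2_norm g"
proof -
  note [measurable] = square_integrable_borel[OF f] square_integrable_borel[OF g]
  have sq: "(\<integral>\<^sup>+x. (ennreal (cmod (h x)))\<^sup>2 \<partial>lborel) = ennreal ((L2_norm h)\<^sup>2)"
    if h: "h \<in> square_integrable" for h :: "'a \<Rightarrow> complex"
  proof -
    have "(\<integral>\<^sup>+x. (ennreal (cmod (h x)))\<^sup>2 \<partial>lborel) = (\<integral>\<^sup>+x. ennreal ((cmod (h x))\<^sup>2) \<partial>lborel)"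
      by (simp add: ennreal_power)
    also have "\<dots> = ennreal (LINT x|lborel. (cmod (h x))\<^sup>2)"
      by (rule nn_integral_eq_integral[OF square_integrable_sq[OF h]]) simp
    finally show ?thesis by (simp add: L2_norm_def)
  qed
  have fg: "integrable lborel (\<lambda>x. f x * g x)" by (rule square_integrable_mult[OF f g])
  have "(\<integral>\<^sup>+x. ennreal (cmod (f x)) * ennreal (cmod (g x)) \<partial>lborel) = ennreal (LINT x|lborel. cmod (f x * g x))"
    using nn_integral_eq_integral[OF integrable_norm[OF fg]] by (simp add: norm_mult ennreal_mult)
  then have "(ennreal (LINT x|lborel. cmod (f x * g x)))\<^sup>2 \<le> ennreal ((L2_norm f)\<^sup>2) * ennreal ((L2_norm g)\<^sup>2)"
    using Cauchy_Schwarz_nn_integral[of "\<lambda>x. ennreal (cmod (f x))" lborel "\<lambda>x. ennreal (cmod (g x))"]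
    by (simp add: sq f g)
  then have "(LINT x|lborel. cmod (f x * g x))\<^sup>2 \<le> (L2_norm f * L2_norm g)\<^sup>2"
    by (simp add: ennreal_power power_mult_distrib ennreal_le_iff flip: ennreal_mult)
  then have "(LINT x|lborel. cmod (f x * g x)) \<le> L2_norm f * L2_norm g"
    by (rule power2_le_imp_le) (simp add: L2_norm_def)
  then show ?thesis using integral_norm_bound[of lborel "\<lambda>x. f x * g x"] by linarith
qed

lemma L2_limit_integral:
  assumes f: "\<And>n. f n \<in> square_integrable" and g: "g \<in> square_integrable" and q: "q \<in> square_integrable"
    and lim: "(\<lambda>n. LINT x|lborel. (cmod (f n x - g x))\<^sup>2) \<longlonglongrightarrow> 0"
  shows "(\<lambda>n. LINT x|lborel. f n x * q x) \<longlonglongrightarrow> (LINT x|lborel. g x * q x)"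
proof -
  have "(\<lambda>n. L2_norm (\<lambda>x. f n x - g x) * L2_norm q) \<longlonglongrightarrow> sqrt 0 * L2_norm q"
    unfolding L2_norm_def by (intro tendsto_mult tendsto_const tendsto_real_sqrt lim)
  then have z: "(\<lambda>n. L2_norm (\<lambda>x. f n x - g x) * L2_norm q) \<longlonglongrightarrow> 0" by simp
  have "(\<lambda>n. (LINT x|lborel. f n x * q x) - (LINT x|lborel. g x * q x)) \<longlonglongrightarrow> 0"
  proof (rule Lim_null_comparison[OF always_eventually z], rule allI)
    fix n
    have "(LINT x|lborel. f n x * q x) - (LINT x|lborel. g x * q x) = (LINT x|lborel. (f n x - g x) * q x)"
      using square_integrable_mult[OF f q] square_integrable_mult[OF g q] by (simp add: left_diff_distrib)
    then show "norm ((LINT x|lborel. f n x * q x) - (LINT x|lborel. g x * q x)) \<le> L2_norm (\<lambda>x. f n x - g x) * L2_norm q"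
      using L2_Cauchy_Schwarz[OF square_integrable_diff[OF f g] q] by simp
  qed
  then show ?thesis by (rule LIM_zero_cancel)
qed

text \<open>The Riesz-Fischer theorem for functions rather than classes: a rapidly Cauchy
  subsequence converges almost everywhere, and Fatou's lemma transfers the Cauchy estimate of the
  full sequence to this limit.\<close>

lemma L2_complete:
  fixes f :: "nat \<Rightarrow> 'a::euclidean_space \<Rightarrow> complex"
  assumes f: "\<And>n. f n \<in> square_integrable"
    and cauchy: "\<And>e. e > 0 \<Longrightarrow> \<exists>N. \<forall>m\<ge>N. \<forall>n\<ge>N. (LINT x|lborel. (cmod (f m x - f n x))\<^sup>2) < e"
  obtains g where "g \<in> square_integrable" "(\<lambda>n. LINT x|lborel. (cmod (f n x - g x))\<^sup>2) \<longlonglongrightarrow> 0"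
proof -
  note [measurable] = square_integrable_borel[OF f]
  define D where "D m n x = (cmod (f m x - f n x))\<^sup>2" for m n x
  have Dm[measurable]: "D m n \<in> borel_measurable borel" for m n unfolding D_def by measurable
  have Di: "integrable lborel (D m n)" for m n
    using square_integrable_sq[OF square_integrable_diff[OF f[of m] f[of n]]] by (simp add: D_def[abs_def])
  have DN: "(\<integral>\<^sup>+x. ennreal (D m n x) \<partial>lborel) = ennreal (LINT x|lborel. D m n x)" for m n
    by (rule nn_integral_eq_integral[OF Di]) (simp add: D_def)
  \<comment> \<open>The rate 1/8 leaves room for the weights 4^k: the weighted squares still have
    integrals at most 2^-k. So almost everywhere they are bounded in k, and the consecutive
    differences decay like 2^-k, which is summable.\<close>
  have "\<forall>k. \<exists>N. \<forall>m\<ge>N. \<forall>n\<ge>N. (LINT x|lborel. D m n x) < (1/8)^k"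
    using cauchy unfolding D_def by simp
  then obtain N where N: "\<And>k m n. m \<ge> N k \<Longrightarrow> n \<ge> N k \<Longrightarrow> (LINT x|lborel. D m n x) < (1/8)^k" by metis
  \<comment> \<open>Summing the thresholds up to k makes r increasing and at least
    \<open>N k\<close>; the extra summand k forces it to infinity.\<close>
  define r where "r k = (\<Sum>i\<le>k. N i) + k" for k
  have rN: "N k \<le> r k" for k unfolding r_def by (simp add: member_le_sum trans_le_add1)
  have rS: "r k \<le> r (Suc k)" for k unfolding r_def by simp
  have rk: "k \<le> r k" for k by (simp add: r_def)
  have Dr: "(LINT x|lborel. D (r (Suc k)) (r k) x) < (1/8)^k" for k
    using rN[of k] rS[of k] by (intro N) auto
  have fin: "(\<integral>\<^sup>+x. (\<Sum>k. ennreal (4^k * D (r (Suc k)) (r k) x)) \<partial>lborel) \<noteq> \<infinity>"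
  proof -
    have "(\<integral>\<^sup>+x. (\<Sum>k. ennreal (4^k * D (r (Suc k)) (r k) x)) \<partial>lborel)
       = (\<Sum>k. \<integral>\<^sup>+x. ennreal (4^k * D (r (Suc k)) (r k) x) \<partial>lborel)"
      by (rule nn_integral_suminf) measurable
    also have "\<dots> \<le> (\<Sum>k. ennreal ((1/2)^k))"
    proof (rule suminf_le)
      fix k
      have "(\<integral>\<^sup>+x. ennreal (4^k * D (r (Suc k)) (r k) x) \<partial>lborel) = ennreal (LINT x|lborel. 4^k * D (r (Suc k)) (r k) x)"
        by (rule nn_integral_eq_integral[OF integrable_mult_right[OF Di]]) (simp add: D_def)
      also have "(LINT x|lborel. 4^k * D (r (Suc k)) (r k) x) \<le> 4^k * (1/8)^k"
        using Dr[of k] by simp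
      also have "4^k * (1/8)^k = (1/2::real)^k" by (simp flip: power_mult_distrib)
      finally show "(\<integral>\<^sup>+x. ennreal (4^k * D (r (Suc k)) (r k) x) \<partial>lborel) \<le> ennreal ((1/2)^k)"
        by (simp add: ennreal_leI)
    qed auto
    also have "(\<Sum>k. ennreal ((1/2)^k)) = ennreal (\<Sum>k. (1/2)^k)"
      by (rule suminf_ennreal2) (auto intro: summable_geometric)
    finally show ?thesis using ennreal_less_top le_less_trans by (metis infinity_ennreal_def less_irrefl)
  qed
  have "AE x in lborel. (\<Sum>k. ennreal (4^k * D (r (Suc k)) (r k) x)) \<noteq> \<infinity>"
    by (rule nn_integral_PInf_AE[OF _ fin]) measurable
  then have conv: "AE x in lborel. convergent (\<lambda>k. f (r k) x)"
  proof eventually_elim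
    case (elim x)
    define s where "s = enn2real (\<Sum>k. ennreal (4^k * D (r (Suc k)) (r k) x))"
    have "ennreal (4^k * D (r (Suc k)) (r k) x) \<le> ennreal s" for k
    proof -
      have "ennreal (4^k * D (r (Suc k)) (r k) x) \<le> (\<Sum>k. ennreal (4^k * D (r (Suc k)) (r k) x))"
        using sum_le_suminf[of "\<lambda>k. ennreal (4^k * D (r (Suc k)) (r k) x)" "{k}"] by simp
      also have "\<dots> = ennreal s" unfolding s_def using elim by (simp add: ennreal_enn2real less_top)
      finally show ?thesis .
    qed
    moreover have "s \<ge> 0" by (simp add: s_def)
    ultimately have "4^k * D (r (Suc k)) (r k) x \<le> s" for k by (simp add: ennreal_le_iff)
    then have "sqrt (4^k * (cmod (f (r (Suc k)) x - f (r k) x))\<^sup>2) \<le> sqrt s" for k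
      by (simp add: D_def real_sqrt_le_mono)
    then have le: "2^k * cmod (f (r (Suc k)) x - f (r k) x) \<le> sqrt s" for k
      by (simp add: real_sqrt_mult real_sqrt_power)
    have "summable (\<lambda>k. f (r (Suc k)) x - f (r k) x)"
    proof (rule summable_comparison_test'[of "\<lambda>k. sqrt s * (1/2)^k"])
      show "summable (\<lambda>k. sqrt s * (1/2)^k)" by (intro summable_mult summable_geometric) simp
      show "norm (f (r (Suc k)) x - f (r k) x) \<le> sqrt s * (1/2)^k" for k
        using le[of k] by (simp add: power_one_over field_simps)
    qed
    then have "convergent (\<lambda>n. \<Sum>k<n. f (r (Suc k)) x - f (r k) x)"
      by (simp add: summable_iff_convergent)
    moreover have "(\<Sum>k<n. f (r (Suc k)) x - f (r k) x) = f (r n) x - f (r 0) x" for n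
      by (rule sum_lessThan_telescope)
    ultimately have "convergent (\<lambda>n. f (r n) x - f (r 0) x)" by simp
    from convergent_add[OF this convergent_const[of "f (r 0) x"]] show ?case by simp
  qed
  define g where "g x = lim (\<lambda>k. f (r k) x)" for x
  have [measurable]: "g \<in> borel_measurable borel" unfolding g_def by measurable
  have lim: "AE x in lborel. (\<lambda>k. f (r k) x) \<longlonglongrightarrow> g x"
    using conv by eventually_elim (simp add: g_def convergent_LIMSEQ_iff)
  \<comment> \<open>Fatou along the subsequence for fixed n. Its indices pass M from k = M on,
    because k is at most \<open>r k\<close>.\<close>
  have bound: "(\<integral>\<^sup>+x. ennreal ((cmod (f n x - g x))\<^sup>2) \<partial>lborel) \<le> ennreal e"
    if M: "\<And>m. m \<ge> M \<Longrightarrow> (LINT x|lborel. D n m x) < e" for n M e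
  proof -
    have "(\<integral>\<^sup>+x. ennreal ((cmod (f n x - g x))\<^sup>2) \<partial>lborel) = (\<integral>\<^sup>+x. liminf (\<lambda>k. ennreal (D n (r k) x)) \<partial>lborel)"
    proof (rule nn_integral_cong_AE)
      show "AE x in lborel. ennreal ((cmod (f n x - g x))\<^sup>2) = liminf (\<lambda>k. ennreal (D n (r k) x))"
        using lim
      proof eventually_elim
        case (elim x)
        have "(\<lambda>k. ennreal (D n (r k) x)) \<longlonglongrightarrow> ennreal ((cmod (f n x - g x))\<^sup>2)"
          unfolding D_def by (intro tendsto_ennrealI tendsto_power tendsto_norm tendsto_diff tendsto_const elim)
        from lim_imp_Liminf[OF _ this] show ?case by simp
      qed
    qed
    also have "\<dots> \<le> liminf (\<lambda>k. \<integral>\<^sup>+x. ennreal (D n (r k) x) \<partial>lborel)"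
      by (rule nn_integral_liminf) measurable
    also have "\<dots> \<le> limsup (\<lambda>k. \<integral>\<^sup>+x. ennreal (D n (r k) x) \<partial>lborel)"
      by (rule Liminf_le_Limsup) simp
    also have "\<dots> \<le> ennreal e"
    proof (rule Limsup_bounded)
      show "\<forall>\<^sub>F k in sequentially. (\<integral>\<^sup>+x. ennreal (D n (r k) x) \<partial>lborel) \<le> ennreal e"
        using eventually_ge_at_top[of M]
      proof eventually_elim
        case (elim k)
        then have "(LINT x|lborel. D n (r k) x) < e" using rk[of k] by (intro M) simp
        then show ?case unfolding DN by (intro ennreal_leI) simp
      qed
    qed
    finally show ?thesis .
  qed
  have sq: "integrable lborel (\<lambda>x. (cmod (f n x - g x))\<^sup>2) \<and> (LINT x|lborel. (cmod (f n x - g x))\<^sup>2) \<le> e"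
    if M: "\<And>m. m \<ge> M \<Longrightarrow> (LINT x|lborel. D n m x) < e" and e: "e > 0" for n M e
  proof -
    have b: "(\<integral>\<^sup>+x. ennreal ((cmod (f n x - g x))\<^sup>2) \<partial>lborel) \<le> ennreal e" by (rule bound[OF M])
    then have i: "integrable lborel (\<lambda>x. (cmod (f n x - g x))\<^sup>2)"
      by (intro integrableI_nonneg) (auto intro: le_less_trans)
    have "ennreal (LINT x|lborel. (cmod (f n x - g x))\<^sup>2) \<le> ennreal e"
      using b nn_integral_eq_integral[OF i] by simp
    then show ?thesis using i e by (simp add: ennreal_le_iff)
  qed
  show ?thesis
  proof (rule that[of g])
    obtain M where "\<And>m n. m \<ge> M \<Longrightarrow> n \<ge> M \<Longrightarrow> (LINT x|lborel. D m n x) < 1"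
      using cauchy[of 1] unfolding D_def by auto
    then have "integrable lborel (\<lambda>x. (cmod (f M x - g x))\<^sup>2)" using sq[of M M 1] by simp
    then have "(\<lambda>x. f M x - g x) \<in> square_integrable" by (simp add: square_integrable_def)
    from square_integrable_diff[OF f[of M] this] show "g \<in> square_integrable" by simp
    show "(\<lambda>n. LINT x|lborel. (cmod (f n x - g x))\<^sup>2) \<longlonglongrightarrow> 0"
      unfolding LIMSEQ_iff
    proof (intro allI impI)
      fix e :: real assume e: "e > 0"
      obtain M where M: "\<And>m n. m \<ge> M \<Longrightarrow> n \<ge> M \<Longrightarrow> (LINT x|lborel. D m n x) < e / 2"
        using cauchy[of "e / 2"] e unfolding D_def by auto
      have "norm ((LINT x|lborel. (cmod (f n x - g x))\<^sup>2) - 0) < e" if "n \<ge> M" for n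
        using sq[of M n "e / 2"] M that e by simp
      then show "\<exists>M. \<forall>n\<ge>M. norm ((LINT x|lborel. (cmod (f n x - g x))\<^sup>2) - 0) < e" by blast
    qed
  qed
qed

section \<open>Hilbert spaces of distributions\<close>

context inner_product_distribution_space
begin

lemma lin_mem: "f \<in> H \<Longrightarrow> g \<in> H \<Longrightarrow> (\<lambda>\<phi>. f \<phi> + c * g \<phi>) \<in> H"
  by (intro add_mem scale_mem)

lemma ip_norm_sq: "f \<in> H \<Longrightarrow> (ip_norm ip f)\<^sup>2 = Re (ip f f)"
  using ip_nonneg[of f] by (simp add: ip_norm_def)

lemma ip_norm_sq_add:
  assumes "f \<in> H" "g \<in> H"
  shows "(ip_norm ip (\<lambda>\<phi>. f \<phi> + c * g \<phi>))\<^sup>2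
    = (ip_norm ip f)\<^sup>2 + 2 * Re (c * ip g f) + (cmod c)\<^sup>2 * (ip_norm ip g)\<^sup>2"
proof -
  note cg = scale_mem[OF assms(2), of c]
  have "ip (\<lambda>\<phi>. f \<phi> + c * g \<phi>) (\<lambda>\<phi>. f \<phi> + c * g \<phi>)
      = ip f f + c * ip g f + cnj (c * ip g f) + (c * cnj c) * ip g g"
    using assms cg ip_commute[OF assms(2,1)]
    by (simp add: ip_add_left ip_add_right ip_scale_left ip_scale_right add_mem algebra_simps)
  moreover have "c * cnj c = of_real ((cmod c)\<^sup>2)" by (rule complex_norm_square[symmetric])
  ultimately show ?thesis
    using assms by (simp add: ip_norm_sq lin_mem)
qed

lemma ip_norm_diff_sym:
  assumes "f \<in> H" "g \<in> H"
  shows "ip_norm ip (\<lambda>\<phi>. f \<phi> - g \<phi>) = ip_norm ip (\<lambda>\<phi>. g \<phi> - f \<phi>)"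
proof -
  have "ip_dist H ip f g = ip_dist H ip g f" by (rule commute)
  then show ?thesis using assms by (simp add: ip_dist_def)
qed

lemma ip_diff_left:
  assumes "f \<in> H" "g \<in> H" "h \<in> H"
  shows "ip (\<lambda>\<phi>. f \<phi> - g \<phi>) h = ip f h - ip g h"
  using ip_add_left[OF assms(1) scale_mem[OF assms(2), of "-1"] assms(3)] ip_scale_left[OF assms(2,3), of "-1"] by simp

lemma tendsto_ip:
  assumes s: "\<And>n. s n \<in> H" and h: "h \<in> H" and t: "t \<in> H"
    and lim: "(\<lambda>n. ip_norm ip (\<lambda>\<phi>. s n \<phi> - h \<phi>)) \<longlonglongrightarrow> 0"
  shows "(\<lambda>n. ip (s n) t) \<longlonglongrightarrow> ip h t"
proof -
  have "(\<lambda>n. ip_norm ip (\<lambda>\<phi>. s n \<phi> - h \<phi>) * ip_norm ip t) \<longlonglongrightarrow> 0 * ip_norm ip t"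
    by (intro tendsto_mult lim tendsto_const)
  then have z: "(\<lambda>n. ip_norm ip (\<lambda>\<phi>. s n \<phi> - h \<phi>) * ip_norm ip t) \<longlonglongrightarrow> 0" by simp
  have "(\<lambda>n. ip (s n) t - ip h t) \<longlonglongrightarrow> 0"
    by (rule Lim_null_comparison[OF always_eventually z])
       (use cauchy_schwarz[OF diff_mem[OF s h] t] ip_diff_left[OF s h t] in simp)
  then show ?thesis by (rule LIM_zero_cancel)
qed

text \<open>Polarisation: precomposition with V is automatically linear on functionals, so the norms
  of g + c f are preserved; c = 1 yields the real part of the inner product and c = -i the imaginary
  part.\<close>

lemma isometry_preserves_ip:
  assumes f: "f \<in> H" and g: "g \<in> H"
    and U: "\<And>f. f \<in> H \<Longrightarrow> (\<lambda>\<phi>. f (V \<phi>)) \<in> H \<and> ip_norm ip (\<lambda>\<phi>. f (V \<phi>)) = ip_norm ip f"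
  shows "ip (\<lambda>\<phi>. f (V \<phi>)) (\<lambda>\<phi>. g (V \<phi>)) = ip f g"
proof -
  have "Re (c * ip (\<lambda>\<phi>. f (V \<phi>)) (\<lambda>\<phi>. g (V \<phi>))) = Re (c * ip f g)" for c
    using ip_norm_sq_add[OF g f, of c] ip_norm_sq_add[of "\<lambda>\<phi>. g (V \<phi>)" "\<lambda>\<phi>. f (V \<phi>)" c]
      U[OF lin_mem[OF g f, of c]] U[OF f] U[OF g] by simp
  from this[of 1] this[of "- \<i>"] show ?thesis by (simp add: complex_eq_iff)
qed

text \<open>Evaluation at \<phi> is continuous for pointwise convergence, so it stays below 1 in
  modulus on a ball of radius r around 0. Scaling f to norm r / 2 gives the constant 2 / r.\<close>

lemma bounded_evaluation:
  assumes "continuously_embedded H ip"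
  obtains M where "\<And>f. f \<in> H \<Longrightarrow> cmod (f \<phi>) \<le> M * ip_norm ip f"
proof -
  let ?U = "distributions \<inter> {u. cmod (u \<phi>) < 1}"
  have "open {u :: 'a functional. cmod (u \<phi>) < 1}"
    by (intro open_Collect_less continuous_intros continuous_on_product_coordinates)
  then have "openin (top_of_set distributions) ?U" by (rule openin_open_Int)
  moreover have "continuous_map mtopology (top_of_set distributions) (\<lambda>f. f)"
    using assms by (simp add: continuously_embedded_def)
  ultimately have "openin mtopology {f \<in> topspace mtopology. f \<in> ?U}"
    by (intro openin_continuous_map_preimage)
  moreover have "(\<lambda>_. 0) \<in> {f \<in> topspace mtopology. f \<in> ?U}"
    using zero_mem subset_distributions by auto
  ultimately obtain r where r: "r > 0" "mball (\<lambda>_. 0) r \<subseteq> {f \<in> topspace mtopology. f \<in> ?U}"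
    unfolding openin_mtopology by blast
  have small: "cmod (f \<phi>) < 1" if f: "f \<in> H" "ip_norm ip f < r" for f
  proof -
    have "ip_dist H ip (\<lambda>_. 0) f = ip_dist H ip f (\<lambda>_. 0)" by (rule commute)
    then have "f \<in> mball (\<lambda>_. 0) r" using f zero_mem by (simp add: in_mball ip_dist_def)
    then show ?thesis using r(2) by auto
  qed
  have "cmod (f \<phi>) \<le> 2 / r * ip_norm ip f" if f: "f \<in> H" for f
  proof (cases "ip_norm ip f = 0")
    case True
    then show ?thesis using ip_norm_eq_0[OF f True] by simp
  next
    case False
    then have pos: "ip_norm ip f > 0" using ip_norm_nonneg[OF f] by simp
    define c where "c = r / (2 * ip_norm ip f)"
    have c: "c > 0" using pos r by (simp add: c_def)
    have "(ip_norm ip (\<lambda>\<phi>. complex_of_real c * f \<phi>))\<^sup>2 = (c * ip_norm ip f)\<^sup>2"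
      using ip_norm_sq_add[OF zero_mem f, of c] ip_norm_sq[OF zero_mem] ip_scale_left[OF zero_mem zero_mem, of 0]
        ip_scale_right[OF zero_mem f, of 0]
      by (simp add: power_mult_distrib)
    then have "ip_norm ip (\<lambda>\<phi>. complex_of_real c * f \<phi>) = c * ip_norm ip f"
      using c pos by (subst (asm) power2_eq_iff_nonneg) (auto simp: ip_norm_nonneg scale_mem f)
    also have "\<dots> = r / 2" using pos by (simp add: c_def)
    finally have "cmod (complex_of_real c * f \<phi>) < 1"
      using r by (intro small[OF scale_mem[OF f]]) simp
    then have "c * cmod (f \<phi>) < 1" using c by (simp add: norm_mult)
    then show ?thesis using pos r by (simp add: c_def field_simps)
  qed
  then show ?thesis by (rule that)
qed

end

section \<open>Riesz representation of bounded functionals on subspaces\<close>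

lemma nonneg_if_nonneg_plus_vanishing:
  assumes "\<And>n. a n \<ge> - (1 / real (Suc n))" "a \<longlonglongrightarrow> l"
  shows "l \<ge> 0"
proof (rule LIMSEQ_le[of "\<lambda>n. - (1 / real (Suc n))"])
  show "(\<lambda>n. - (1 / real (Suc n))) \<longlonglongrightarrow> 0"
    using tendsto_minus[OF LIMSEQ_inverse_real_of_nat] by (simp add: inverse_eq_divide)
qed (use assms in auto)

text \<open>
  The sequence \<open>s\<close> minimises \<open>\<parallel>s\<parallel>\<^sup>2 - 2 Re (l s)\<close> over \<open>S\<close>; it is Cauchy by the parallelogram identity.
\<close>

lemma (in hilbert_distribution_space) riesz_on_subspace:
  assumes S: "S \<subseteq> H" "(\<lambda>_. 0) \<in> S" "\<And>s t c. s \<in> S \<Longrightarrow> t \<in> S \<Longrightarrow> (\<lambda>\<phi>. s \<phi> + c * t \<phi>) \<in> S"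
    and l: "\<And>s t c. s \<in> S \<Longrightarrow> t \<in> S \<Longrightarrow> l (\<lambda>\<phi>. s \<phi> + c * t \<phi>) = l s + c * l t"
    and bound: "\<And>s. s \<in> S \<Longrightarrow> cmod (l s) \<le> M * ip_norm ip s"
  obtains s h where "\<And>n::nat. s n \<in> S" "h \<in> H" "(\<lambda>n. ip_norm ip (\<lambda>\<phi>. s n \<phi> - h \<phi>)) \<longlonglongrightarrow> 0"
    "\<And>t. t \<in> S \<Longrightarrow> ip t h = l t"
proof -
  define \<Phi> where "\<Phi> s = (ip_norm ip s)\<^sup>2 - 2 * Re (l s)" for s
  have SH: "s \<in> H" if "s \<in> S" for s using S(1) that by blast
  \<comment> \<open>The linear term measures the failure of the Euler-Lagrange equation
    \<open>ip t s = l t\<close>.\<close>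
  have \<Phi>_add: "\<Phi> (\<lambda>\<phi>. s \<phi> + c * t \<phi>) = \<Phi> s + (cmod c)\<^sup>2 * (ip_norm ip t)\<^sup>2 + 2 * Re (c * (ip t s - l t))"
    if "s \<in> S" "t \<in> S" for s t c
    unfolding \<Phi>_def ip_norm_sq_add[OF SH[OF that(1)] SH[OF that(2)]] l[OF that] by (simp add: algebra_simps)
  have bdd: "bdd_below (\<Phi> ` S)"
  proof (rule bdd_belowI2)
    fix s assume s: "s \<in> S"
    have "Re (l s) \<le> M * ip_norm ip s" using bound[OF s] complex_Re_le_cmod[of "l s"] by linarith
    moreover have "0 \<le> (ip_norm ip s - M)\<^sup>2" by simp
    ultimately show "- M\<^sup>2 \<le> \<Phi> s" by (simp add: \<Phi>_def power2_diff algebra_simps)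
  qed
  define I where "I = Inf (\<Phi> ` S)"
  have I: "I \<le> \<Phi> s" if "s \<in> S" for s unfolding I_def by (rule cINF_lower[OF bdd that])
  have "\<exists>s. s \<in> S \<and> \<Phi> s < I + 1 / Suc n" for n
  proof -
    have "Inf (\<Phi> ` S) < I + 1 / Suc n" by (simp add: I_def)
    then have "\<exists>y\<in>\<Phi> ` S. y < I + 1 / Suc n" by (subst (asm) cInf_less_iff) (use S(2) bdd in auto)
    then show ?thesis by blast
  qed
  then obtain s where s: "\<And>n. s n \<in> S" "\<And>n. \<Phi> (s n) < I + 1 / Suc n" by metis
  have dist: "(ip_norm ip (\<lambda>\<phi>. s m \<phi> - s n \<phi>))\<^sup>2 \<le> 2 / Suc m + 2 / Suc n" for m n
  proof -
    define d where "d = (\<lambda>\<phi>. s n \<phi> + (-1) * s m \<phi>)"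
    have d: "d \<in> S" unfolding d_def by (rule S(3)[OF s(1) s(1)])
    have "\<Phi> (\<lambda>\<phi>. s m \<phi> + 1 * d \<phi>) = \<Phi> (s n)" by (simp add: d_def)
    then have 1: "\<Phi> (s n) = \<Phi> (s m) + (ip_norm ip d)\<^sup>2 + 2 * Re (ip d (s m) - l d)"
      using \<Phi>_add[OF s(1)[of m] d, of 1] by simp
    \<comment> \<open>The midpoint of s m and s n competes for the minimum. Eliminating the linear
      term between 1 and 2 bounds the square of the norm of d by
      \<open>2 * (\<Phi> (s m) + \<Phi> (s n)) - 4 * I\<close>.\<close>
    have "I \<le> \<Phi> (\<lambda>\<phi>. s m \<phi> + (1/2) * d \<phi>)" by (intro I S(3) s(1) d)
    then have 2: "I \<le> \<Phi> (s m) + (ip_norm ip d)\<^sup>2 / 4 + Re (ip d (s m) - l d)"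
      using \<Phi>_add[OF s(1)[of m] d, of "1/2"] by (simp add: power2_eq_square diff_divide_distrib)
    have "(ip_norm ip d)\<^sup>2 \<le> 2 / Suc m + 2 / Suc n" using 1 2 s(2)[of m] s(2)[of n] by simp
    moreover have "d = (\<lambda>\<phi>. s n \<phi> - s m \<phi>)" by (simp add: d_def)
    ultimately show ?thesis using ip_norm_diff_sym[OF SH[OF s(1)] SH[OF s(1)], of m n] by simp
  qed
  have "MCauchy s"
    unfolding MCauchy_def
  proof (intro conjI allI impI)
    show "range s \<subseteq> H" using s(1) SH by blast
    fix e :: real assume e: "e > 0"
    have "(\<lambda>n. 1 / real (Suc n)) \<longlonglongrightarrow> 0" using LIMSEQ_inverse_real_of_nat by (simp add: inverse_eq_divide)
    then have "\<forall>\<^sub>F n in sequentially. 1 / real (Suc n) < e\<^sup>2 / 4" using e by (intro order_tendstoD) auto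
    then obtain N where N: "\<And>n. n \<ge> N \<Longrightarrow> 1 / real (Suc n) < e\<^sup>2 / 4"
      unfolding eventually_sequentially by blast
    have "ip_dist H ip (s m) (s n) < e" if "m \<ge> N" "n \<ge> N" for m n
    proof -
      have "(ip_norm ip (\<lambda>\<phi>. s m \<phi> - s n \<phi>))\<^sup>2 < e\<^sup>2"
        using dist[of m n] N[OF that(1)] N[OF that(2)] by simp
      then have "ip_norm ip (\<lambda>\<phi>. s m \<phi> - s n \<phi>) < e" using e by (intro power2_less_imp_less[of _ e]) auto
      then show ?thesis using SH[OF s(1)] by (simp add: ip_dist_def)
    qed
    then show "\<exists>N. \<forall>n n'. N \<le> n \<longrightarrow> N \<le> n' \<longrightarrow> ip_dist H ip (s n) (s n') < e" by blast
  qed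
  then obtain h where "limitin mtopology s h sequentially"
    using complete unfolding mcomplete_def by blast
  then have h: "h \<in> H" and hlim: "\<And>e. e > 0 \<Longrightarrow> \<exists>N. \<forall>n\<ge>N. ip_dist H ip (s n) h < e"
    unfolding limit_metric_sequentially by (auto, meson)
  have lim: "(\<lambda>n. ip_norm ip (\<lambda>\<phi>. s n \<phi> - h \<phi>)) \<longlonglongrightarrow> 0"
    unfolding LIMSEQ_iff
  proof (intro allI impI)
    fix e :: real assume "e > 0"
    from hlim[OF this] show "\<exists>N. \<forall>n\<ge>N. norm (ip_norm ip (\<lambda>\<phi>. s n \<phi> - h \<phi>) - 0) < e"
      using SH[OF s(1)] h by (simp add: ip_dist_def ip_norm_nonneg diff_mem)
  qed
  have "ip t h = l t" if t: "t \<in> S" for t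
  proof (rule ccontr)
    assume ne: "ip t h \<noteq> l t"
    define z where "z = ip t h - l t"
    \<comment> \<open>\<open>\<Phi>\<close> cannot drop by more than 1 / Suc n from s n in any
      direction t; the limit in n gives the variational inequality at h.\<close>
    have nonneg: "(cmod c)\<^sup>2 * (ip_norm ip t)\<^sup>2 + 2 * Re (c * z) \<ge> 0" for c
    proof (rule nonneg_if_nonneg_plus_vanishing)
      show "(cmod c)\<^sup>2 * (ip_norm ip t)\<^sup>2 + 2 * Re (c * (ip t (s n) - l t)) \<ge> - (1 / real (Suc n))" for n
        using I[OF S(3)[OF s(1)[of n] t, of c]] \<Phi>_add[OF s(1)[of n] t, of c] s(2)[of n] by simp
      have "(\<lambda>n. ip t (s n)) \<longlonglongrightarrow> ip t h"
        using tendsto_cnj[OF tendsto_ip[OF SH[OF s(1)] h SH[OF t] lim]]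
        by (simp add: ip_commute[OF _ SH[OF t]] SH s(1) t h)
      then show "(\<lambda>n. (cmod c)\<^sup>2 * (ip_norm ip t)\<^sup>2 + 2 * Re (c * (ip t (s n) - l t)))
          \<longlonglongrightarrow> (cmod c)\<^sup>2 * (ip_norm ip t)\<^sup>2 + 2 * Re (c * z)"
        unfolding z_def by (intro tendsto_intros)
    qed
    \<comment> \<open>With c = -a times the conjugate of z, the variational inequality forces a
      times the squared norm of t to be at least 2 when z is nonzero. This a keeps that product
      below 1.\<close>
    define a where "a = 1 / ((ip_norm ip t)\<^sup>2 + 1)"
    have a: "a > 0" "a * (ip_norm ip t)\<^sup>2 < 1" by (auto simp: a_def add_nonneg_pos divide_less_eq)
    have "cnj z * z = of_real ((cmod z)\<^sup>2)" by (metis complex_norm_square mult.commute)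
    then have re: "Re (- of_real a * cnj z * z) = - a * (cmod z)\<^sup>2" by (simp add: mult.assoc)
    have "(cmod (- of_real a * cnj z))\<^sup>2 = a\<^sup>2 * (cmod z)\<^sup>2" by (simp add: norm_mult power_mult_distrib)
    then have "a\<^sup>2 * (cmod z)\<^sup>2 * (ip_norm ip t)\<^sup>2 + 2 * (- a * (cmod z)\<^sup>2) \<ge> 0"
      using nonneg[of "- of_real a * cnj z"] by (simp only: re)
    moreover have "(cmod z)\<^sup>2 * a * (a * (ip_norm ip t)\<^sup>2) = a\<^sup>2 * (cmod z)\<^sup>2 * (ip_norm ip t)\<^sup>2"
      by (simp only: power2_eq_square mult_ac)
    moreover have "(cmod z)\<^sup>2 * a * 2 = 2 * (a * (cmod z)\<^sup>2)" by (simp only: mult_ac)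
    ultimately have "(cmod z)\<^sup>2 * a * (a * (ip_norm ip t)\<^sup>2) \<ge> (cmod z)\<^sup>2 * a * 2" by linarith
    moreover have "(cmod z)\<^sup>2 * a > 0" using ne a(1) by (simp add: z_def)
    ultimately have "a * (ip_norm ip t)\<^sup>2 \<ge> 2" by (simp only: mult_le_cancel_left_pos)
    then show False using a(2) by simp
  qed
  with s(1) h lim show ?thesis by (rule that)
qed

section \<open>The reproducing kernel of an invariant Hilbert space\<close>

locale tm_invariant_hilbert_space = hilbert_distribution_space H ip
  for H :: "'a::euclidean_space functional set" and ip +
  assumes embedded: "continuously_embedded H ip" and invariant: "tm_invariant H ip"
begin

lemma riesz_representation: "\<exists>!k. k \<in> H \<and> (\<forall>f\<in>H. ip f k = f \<phi>)"
proof (rule ex_ex1I)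
  obtain M where M: "\<And>f. f \<in> H \<Longrightarrow> cmod (f \<phi>) \<le> M * ip_norm ip f"
    using bounded_evaluation[OF embedded] by blast
  obtain s :: "nat \<Rightarrow> 'a functional" and h where "h \<in> H" "\<And>t. t \<in> H \<Longrightarrow> ip t h = t \<phi>"
    by (rule riesz_on_subspace[of H "\<lambda>f. f \<phi>" M]) (use zero_mem lin_mem M in auto)
  then show "\<exists>k. k \<in> H \<and> (\<forall>f\<in>H. ip f k = f \<phi>)" by blast
  fix k k' assume k: "k \<in> H \<and> (\<forall>f\<in>H. ip f k = f \<phi>)" "k' \<in> H \<and> (\<forall>f\<in>H. ip f k' = f \<phi>)"
  then have "(\<lambda>\<psi>. k \<psi> - k' \<psi>) \<in> H" by (intro diff_mem) auto
  moreover from this have "ip (\<lambda>\<psi>. k \<psi> - k' \<psi>) (\<lambda>\<psi>. k \<psi> - k' \<psi>) = 0"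
    using k ip_diff_left[of k k' "\<lambda>\<psi>. k \<psi> - k' \<psi>"]
      ip_commute[of "\<lambda>\<psi>. k \<psi> - k' \<psi>" k] ip_commute[of "\<lambda>\<psi>. k \<psi> - k' \<psi>" k'] by simp
  ultimately have "(\<lambda>\<psi>. k \<psi> - k' \<psi>) = (\<lambda>_. 0)" by (rule ip_definite)
  then show "k = k'" by (simp add: fun_eq_iff)
qed

text \<open>The representing vector sits in the conjugate linear slot of \<open>ip\<close>, so
  \<open>kern\<close> is conjugate linear in \<phi>.\<close>

definition kern :: "('a \<Rightarrow> complex) \<Rightarrow> 'a functional" where
  "kern \<phi> = (THE k. k \<in> H \<and> (\<forall>f\<in>H. ip f k = f \<phi>))"

lemma kern_mem: "kern \<phi> \<in> H" and ip_kern: "f \<in> H \<Longrightarrow> ip f (kern \<phi>) = f \<phi>"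
  using theI'[OF riesz_representation[of \<phi>]] unfolding kern_def by auto

lemma kern_eqI: "k \<in> H \<Longrightarrow> (\<And>f. f \<in> H \<Longrightarrow> ip f k = f \<phi>) \<Longrightarrow> kern \<phi> = k"
  unfolding kern_def by (rule the1_equality[OF riesz_representation]) simp

lemma mem_distribution: "f \<in> H \<Longrightarrow> f \<in> distributions"
  using subset_distributions by blast

lemma kern_lin:
  assumes "\<phi> \<in> test_functions" "\<psi> \<in> test_functions"
  shows "kern (\<lambda>x. \<phi> x + c * \<psi> x) = (\<lambda>\<eta>. kern \<phi> \<eta> + cnj c * kern \<psi> \<eta>)"
proof (rule kern_eqI)
  show "(\<lambda>\<eta>. kern \<phi> \<eta> + cnj c * kern \<psi> \<eta>) \<in> H" by (intro lin_mem kern_mem)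
  fix f assume f: "f \<in> H"
  note u = mem_distribution[OF f]
  have "ip f (\<lambda>\<eta>. kern \<phi> \<eta> + cnj c * kern \<psi> \<eta>) = f \<phi> + c * f \<psi>"
    using f by (simp add: ip_add_right ip_scale_right kern_mem scale_mem ip_kern)
  also have "\<dots> = f (\<lambda>x. \<phi> x + c * \<psi> x)"
    using distribution_add[OF u assms(1) test_cmult[OF assms(2)]] distribution_cmult[OF u assms(2)] by simp
  finally show "ip f (\<lambda>\<eta>. kern \<phi> \<eta> + cnj c * kern \<psi> \<eta>) = f (\<lambda>x. \<phi> x + c * \<psi> x)" .
qed

lemma kern_commute: "kern \<psi> \<eta> = cnj (kern \<eta> \<psi>)"
  using ip_commute[OF kern_mem kern_mem] ip_kern[OF kern_mem] by metis

text \<open>Let U be precomposition with V on H, a unitary operator. From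
  \<open>f (V \<eta>) = ip (U f) (kern \<eta>)\<close> the vector representing evaluation at
  \<open>V \<eta>\<close> is the inverse of U applied to \<open>kern \<eta>\<close>; evaluating it
  at \<open>V \<psi>\<close> undoes V.\<close>

lemma kern_isometry:
  assumes V: "\<And>f. f \<in> H \<Longrightarrow> (\<lambda>\<phi>. f (V \<phi>)) \<in> H \<and> ip_norm ip (\<lambda>\<phi>. f (V \<phi>)) = ip_norm ip f"
    and V': "\<And>f. f \<in> H \<Longrightarrow> (\<lambda>\<phi>. f (V' \<phi>)) \<in> H \<and> ip_norm ip (\<lambda>\<phi>. f (V' \<phi>)) = ip_norm ip f"
    and inv: "\<And>\<phi>. V (V' \<phi>) = \<phi>" "\<And>\<phi>. V' (V \<phi>) = \<phi>"
  shows "kern (V \<eta>) (V \<psi>) = kern \<eta> \<psi>"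
proof -
  have "kern (V \<eta>) = (\<lambda>\<phi>. kern \<eta> (V' \<phi>))"
  proof (rule kern_eqI)
    show "(\<lambda>\<phi>. kern \<eta> (V' \<phi>)) \<in> H" using V' kern_mem by blast
    fix f assume f: "f \<in> H"
    then have Vf: "(\<lambda>\<phi>. f (V \<phi>)) \<in> H" using V by blast
    have "ip f (\<lambda>\<phi>. kern \<eta> (V' \<phi>)) = ip (\<lambda>\<phi>. (\<lambda>\<phi>. f (V \<phi>)) (V' \<phi>)) (\<lambda>\<phi>. kern \<eta> (V' \<phi>))"
      by (simp add: inv)
    also have "\<dots> = ip (\<lambda>\<phi>. f (V \<phi>)) (kern \<eta>)" by (rule isometry_preserves_ip[OF Vf kern_mem V'])
    also have "\<dots> = f (V \<eta>)" by (rule ip_kern[OF Vf])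
    finally show "ip f (\<lambda>\<phi>. kern \<eta> (V' \<phi>)) = f (V \<eta>)" .
  qed
  then show ?thesis by (simp add: inv)
qed

lemma tm_shift_isometry:
  "f \<in> H \<Longrightarrow> tm_shift x \<xi> f \<in> H \<and> ip_norm ip (tm_shift x \<xi> f) = ip_norm ip f"
  using invariant by (simp add: tm_invariant_def)

text \<open>The arguments are swapped to put the linear one first. With one of its two parameters
  equal to 0, \<open>tm_shift\<close> is precomposition with a pure modulation or a pure
  translation, and the opposite parameter gives the inverse.\<close>

sublocale kernel: invariant_form "\<lambda>\<psi> \<eta>. kern \<eta> \<psi>"
proof
  show "(\<lambda>\<psi>. kern \<eta> \<psi>) \<in> distributions" for \<eta> using mem_distribution[OF kern_mem] by simp
  show "kern \<psi> \<eta> = cnj (kern \<eta> \<psi>)" for \<psi> \<eta> by (rule kern_commute)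
  show "kern (\<lambda>x. cis (x \<bullet> \<xi>) * \<eta> x) (\<lambda>x. cis (x \<bullet> \<xi>) * \<psi> x) = kern \<eta> \<psi>" for \<psi> \<eta> :: "'a \<Rightarrow> complex" and \<xi>
  proof (rule kern_isometry[where V="\<lambda>\<phi> x. cis (x \<bullet> \<xi>) * \<phi> x" and V'="\<lambda>\<phi> x. cis (x \<bullet> (- \<xi>)) * \<phi> x"])
    show "(\<lambda>\<phi>. f (\<lambda>x. cis (x \<bullet> \<xi>) * \<phi> x)) \<in> H \<and> ip_norm ip (\<lambda>\<phi>. f (\<lambda>x. cis (x \<bullet> \<xi>) * \<phi> x)) = ip_norm ip f"
      if "f \<in> H" for f using tm_shift_isometry[OF that, of 0 \<xi>] by (simp add: tm_shift_def)
    show "(\<lambda>\<phi>. f (\<lambda>x. cis (x \<bullet> (- \<xi>)) * \<phi> x)) \<in> H \<and> ip_norm ip (\<lambda>\<phi>. f (\<lambda>x. cis (x \<bullet> (- \<xi>)) * \<phi> x)) = ip_norm ip f"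
      if "f \<in> H" for f using tm_shift_isometry[OF that, of 0 "- \<xi>"] by (simp add: tm_shift_def)
  qed (simp_all add: mult.assoc[symmetric] cis_mult inner_minus_right)
  show "kern (\<lambda>x. \<eta> (x + t)) (\<lambda>x. \<psi> (x + t)) = kern \<eta> \<psi>" for \<psi> \<eta> :: "'a \<Rightarrow> complex" and t
  proof (rule kern_isometry[where V="\<lambda>\<phi> x. \<phi> (x + t)" and V'="\<lambda>\<phi> x. \<phi> (x + - t)"])
    show "(\<lambda>\<phi>. f (\<lambda>x. \<phi> (x + t))) \<in> H \<and> ip_norm ip (\<lambda>\<phi>. f (\<lambda>x. \<phi> (x + t))) = ip_norm ip f"
      if "f \<in> H" for f using tm_shift_isometry[OF that, of t 0] by (simp add: tm_shift_def)
    show "(\<lambda>\<phi>. f (\<lambda>x. \<phi> (x + - t))) \<in> H \<and> ip_norm ip (\<lambda>\<phi>. f (\<lambda>x. \<phi> (x + - t))) = ip_norm ip f"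
      if "f \<in> H" for f using tm_shift_isometry[OF that, of "- t" 0] by (simp add: tm_shift_def)
  qed simp_all
qed

lemma mem_eqI:
  assumes "f \<in> H" "g \<in> H" "\<And>\<phi>. \<phi> \<in> test_functions \<Longrightarrow> f \<phi> = g \<phi>"
  shows "f = g"
proof
  show "f \<phi> = g \<phi>" for \<phi>
    using assms(3)[of \<phi>] distribution_not_test[OF mem_distribution[OF assms(1)]]
      distribution_not_test[OF mem_distribution[OF assms(2)]] by (cases "\<phi> \<in> test_functions") auto
qed

text \<open>Exchanging against the fixed pair \<rho>, \<rho> determines the constant as the squared
  norm of \<open>kern \<rho>\<close> in H divided by the squared L2 norm of \<rho>.\<close>

lemma kern_eq_L2_product:
  assumes ne: "\<exists>f\<in>H. f \<noteq> (\<lambda>_. 0)"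
  obtains c where "c > 0" "\<And>\<psi> \<eta>. \<psi> \<in> test_functions \<Longrightarrow> \<eta> \<in> test_functions \<Longrightarrow>
    kern \<eta> \<psi> = of_real c * (LINT x|lborel. \<psi> x * cnj (\<eta> x))"
proof -
  obtain \<rho> :: "'a \<Rightarrow> complex" where \<rho>: "\<rho> \<in> test_functions" "0 < (LINT x|lborel. (cmod (\<rho> x))\<^sup>2)"
    using ex_nonzero_test by blast
  define I where "I = (LINT x|lborel. (cmod (\<rho> x))\<^sup>2)"
  define c where "c = (ip_norm ip (kern \<rho>))\<^sup>2 / I"
  have I: "(LINT x|lborel. \<rho> x * cnj (\<rho> x)) = of_real I"
    unfolding I_def complex_norm_square[symmetric] by (rule integral_complex_of_real)
  have \<rho>\<rho>: "kern \<rho> \<rho> = of_real ((ip_norm ip (kern \<rho>))\<^sup>2)"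
    using ip_self[OF kern_mem] ip_kern[OF kern_mem] by metis
  have eq: "kern \<eta> \<psi> = of_real c * (LINT x|lborel. \<psi> x * cnj (\<eta> x))"
    if "\<psi> \<in> test_functions" "\<eta> \<in> test_functions" for \<psi> \<eta>
    using kernel.form_exchange[OF that \<rho>(1) \<rho>(1)] \<rho>(2) unfolding I \<rho>\<rho> c_def by (simp add: field_simps flip: I_def)
  \<comment> \<open>For c = 0 every \<open>kern \<psi>\<close> has norm 0, so every f in H vanishes
    at every test function by the reproducing property.\<close>
  have "c \<noteq> 0"
  proof
    assume "c = 0"
    then have "ip (kern \<psi>) (kern \<psi>) = 0" if "\<psi> \<in> test_functions" for \<psi>
      using eq[OF that that] ip_kern[OF kern_mem] by simp
    then have "kern \<psi> = (\<lambda>_. 0)" if "\<psi> \<in> test_functions" for \<psi> using ip_definite[OF kern_mem] that by blast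
    then have "f \<psi> = 0" if "\<psi> \<in> test_functions" "f \<in> H" for f \<psi>
      using ip_kern[OF that(2), of \<psi>] ip_scale_right[OF zero_mem that(2), of 0] that by simp
    then have "f = (\<lambda>_. 0)" if "f \<in> H" for f using mem_eqI[OF that zero_mem] that by blast
    then show False using ne by blast
  qed
  moreover have "c \<ge> 0" using \<rho>(2) by (simp add: c_def I_def)
  ultimately show ?thesis using eq by (intro that[of c]) auto
qed

section \<open>Identification of H with the square integrable functions\<close>

context
  fixes c :: real
  assumes c: "c > 0"
    and kern_L2: "\<And>\<psi> \<eta>. \<psi> \<in> test_functions \<Longrightarrow> \<eta> \<in> test_functions \<Longrightarrow>
      kern \<eta> \<psi> = of_real c * (LINT x|lborel. \<psi> x * cnj (\<eta> x))"
begin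

lemma kern_norm:
  assumes "\<psi> \<in> test_functions"
  shows "(ip_norm ip (kern \<psi>))\<^sup>2 = c * (LINT x|lborel. (cmod (\<psi> x))\<^sup>2)"
proof -
  have "(LINT x|lborel. \<psi> x * cnj (\<psi> x)) = of_real (LINT x|lborel. (cmod (\<psi> x))\<^sup>2)"
    unfolding complex_norm_square[symmetric] by (rule integral_complex_of_real)
  then have "ip (kern \<psi>) (kern \<psi>) = of_real (c * (LINT x|lborel. (cmod (\<psi> x))\<^sup>2))"
    using kern_L2[OF assms assms] ip_kern[OF kern_mem] by simp
  then show ?thesis by (simp add: ip_norm_sq[OF kern_mem])
qed

lemma kern_norm_L2: "\<psi> \<in> test_functions \<Longrightarrow> ip_norm ip (kern \<psi>) = sqrt c * L2_norm \<psi>"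
  using kern_norm[of \<psi>] ip_norm_nonneg[OF kern_mem, of \<psi>] unfolding L2_norm_def real_sqrt_mult[symmetric]
  by (metis real_sqrt_unique)

lemma kern_diff:
  assumes "\<phi> \<in> test_functions" "\<psi> \<in> test_functions"
  shows "kern (\<lambda>x. \<phi> x - \<psi> x) = (\<lambda>\<eta>. kern \<phi> \<eta> - kern \<psi> \<eta>)"
  using kern_lin[OF assms, of "-1"] by simp

lemma kern_image_subspace:
  assumes "s \<in> kern ` test_functions" "t \<in> kern ` test_functions"
  shows "(\<lambda>\<phi>. s \<phi> + b * t \<phi>) \<in> kern ` test_functions"
proof -
  obtain \<phi> \<psi> where st: "\<phi> \<in> test_functions" "\<psi> \<in> test_functions" "s = kern \<phi>" "t = kern \<psi>" using assms by blast
  then have "(\<lambda>\<phi>. s \<phi> + b * t \<phi>) = kern (\<lambda>x. \<phi> x + cnj b * \<psi> x)"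
    using kern_lin[OF st(1,2), of "cnj b"] by simp
  then show ?thesis using test_add[OF st(1) test_cmult[OF st(2)]] by blast
qed

lemma zero_in_kern_image: "(\<lambda>_. 0) \<in> kern ` test_functions"
proof -
  have "kern (\<lambda>_. 0) = (\<lambda>_. 0)"
  proof (rule kern_eqI[OF zero_mem])
    fix f assume f: "f \<in> H"
    show "ip f (\<lambda>_. 0) = f (\<lambda>_. 0)"
      using ip_scale_right[OF zero_mem f, of 0] distribution_zero[OF mem_distribution[OF f]] by simp
  qed
  then show ?thesis using test_zero image_eqI by metis
qed

text \<open>h is a limit of kernels of test functions \<open>\<psi> n\<close>. Up to the factor sqrt
  c the map \<open>kern\<close> preserves norms, so the \<open>\<psi> n\<close> converge in L2 to
  some g, and h is represented by c times the conjugate of g.\<close>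

lemma member_is_square_integrable:
  assumes h: "h \<in> H"
  obtains g where "g \<in> square_integrable" "h = distribution_of g" "ip_norm ip h = L2_norm g / sqrt c"
proof -
  obtain s :: "nat \<Rightarrow> 'a functional" and h' where s: "\<And>n. s n \<in> kern ` test_functions" and h': "h' \<in> H"
    and lim: "(\<lambda>n. ip_norm ip (\<lambda>\<phi>. s n \<phi> - h' \<phi>)) \<longlonglongrightarrow> 0"
    and iph': "\<And>t. t \<in> kern ` test_functions \<Longrightarrow> ip t h' = ip t h"
  \<comment> \<open>Density of the kernels: representing the functional t \<mapsto>
    \<open>ip t h\<close> on their span gives a limit h' of kernels that has the same products with
    all kernels as h, that is, the same values at test functions.\<close>
  proof (rule riesz_on_subspace[of "kern ` test_functions" "\<lambda>t. ip t h" "ip_norm ip h"])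
    show "kern ` test_functions \<subseteq> H" using kern_mem by blast
    show "ip (\<lambda>\<phi>. s \<phi> + b * t \<phi>) h = ip s h + b * ip t h"
      if "s \<in> kern ` test_functions" "t \<in> kern ` test_functions" for s t b
    proof -
      have "s \<in> H" "t \<in> H" using that kern_mem by blast+
      then show ?thesis using h by (simp add: ip_add_left ip_scale_left scale_mem)
    qed
    show "cmod (ip s h) \<le> ip_norm ip h * ip_norm ip s" if "s \<in> kern ` test_functions" for s
      using cauchy_schwarz[OF _ h, of s] that kern_mem by (auto simp: mult.commute)
  qed (use kern_image_subspace zero_in_kern_image in auto)
  have "h' = h"
  proof (rule mem_eqI[OF h' h])
    fix \<phi> :: "'a \<Rightarrow> complex" assume "\<phi> \<in> test_functions"
    then have "ip (kern \<phi>) h' = ip (kern \<phi>) h" by (intro iph') simp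
    then show "h' \<phi> = h \<phi>"
      using ip_commute[OF kern_mem h'] ip_commute[OF kern_mem h] ip_kern[OF h'] ip_kern[OF h] by metis
  qed
  note lim = lim[unfolded this]
  obtain \<psi> where \<psi>: "\<And>n. \<psi> n \<in> test_functions" "\<And>n. s n = kern (\<psi> n)" 
  proof -
    have "\<exists>\<psi>. \<psi> \<in> test_functions \<and> s n = kern \<psi>" for n using s[of n] by blast
    then have "\<forall>n. \<exists>\<psi>. \<psi> \<in> test_functions \<and> s n = kern \<psi>" by blast
    from choice[OF this] show ?thesis using that by blast
  qed
  note \<psi>2 = test_square_integrable[OF \<psi>(1)]
  obtain g where g: "g \<in> square_integrable" and glim: "(\<lambda>n. LINT x|lborel. (cmod (\<psi> n x - g x))\<^sup>2) \<longlonglongrightarrow> 0"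
  proof (rule L2_complete[of \<psi>, OF \<psi>2])
    fix e :: real assume e: "e > 0"
    \<comment> \<open>Two such distances add up to less than sqrt (c e), whose square is the bound e
      for the L2 distance after division by c.\<close>
    have "sqrt (c * e) / 2 > 0" using e c by simp
    from LIMSEQ_D[OF lim this] obtain N where
      N0: "\<forall>n\<ge>N. norm (ip_norm ip (\<lambda>\<phi>. s n \<phi> - h \<phi>) - 0) < sqrt (c * e) / 2" ..
    have N: "ip_norm ip (\<lambda>\<phi>. s n \<phi> - h \<phi>) < sqrt (c * e) / 2" if "n \<ge> N" for n
      using N0[rule_format, OF that] by simp
    have "(LINT x|lborel. (cmod (\<psi> m x - \<psi> n x))\<^sup>2) < e" if "m \<ge> N" "n \<ge> N" for m n
    proof -
      have sH: "s n \<in> H" for n using \<psi>(2) kern_mem by simp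
      have "ip_norm ip (\<lambda>\<phi>. s m \<phi> - s n \<phi>) \<le> ip_norm ip (\<lambda>\<phi>. s m \<phi> - h \<phi>) + ip_norm ip (\<lambda>\<phi>. h \<phi> - s n \<phi>)"
        using ip_norm_triangle[OF diff_mem[OF sH h] diff_mem[OF h sH], of m n] by simp
      also have "\<dots> < sqrt (c * e)"
        using N[OF that(1)] N[OF that(2)] ip_norm_diff_sym[OF h sH] by simp
      finally have "ip_norm ip (kern (\<lambda>x. \<psi> m x - \<psi> n x)) < sqrt (c * e)"
        by (simp add: kern_diff \<psi>)
      then have "(ip_norm ip (kern (\<lambda>x. \<psi> m x - \<psi> n x)))\<^sup>2 < (sqrt (c * e))\<^sup>2"
        by (intro power_strict_mono) (simp_all add: ip_norm_nonneg kern_mem)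
      then show ?thesis using c e by (simp add: kern_norm test_diff \<psi>(1))
    qed
    then show "\<exists>N. \<forall>m\<ge>N. \<forall>n\<ge>N. (LINT x|lborel. (cmod (\<psi> m x - \<psi> n x))\<^sup>2) < e" by blast
  qed
  have sH: "s n \<in> H" for n using \<psi>(2) kern_mem by simp
  have conv: "(\<lambda>n. of_real c * (LINT x|lborel. cnj (\<psi> n x) * q x)) \<longlonglongrightarrow> of_real c * (LINT x|lborel. cnj (g x) * q x)"
    if q: "q \<in> square_integrable" for q
  proof (intro tendsto_mult tendsto_const L2_limit_integral square_integrable_cnj \<psi>2 g q)
    show "(\<lambda>n. LINT x|lborel. (cmod (cnj (\<psi> n x) - cnj (g x)))\<^sup>2) \<longlonglongrightarrow> 0"
      using glim by (simp flip: complex_cnj_diff)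
  qed
  have h_eq: "h \<phi> = (LINT x|lborel. (of_real c * cnj (g x)) * \<phi> x)" if \<phi>: "\<phi> \<in> test_functions" for \<phi>
  proof -
    have "(\<lambda>n. ip (s n) (kern \<phi>)) \<longlonglongrightarrow> ip h (kern \<phi>)"
      by (rule tendsto_ip[OF sH h kern_mem lim])
    moreover have "ip (s n) (kern \<phi>) = of_real c * (LINT x|lborel. cnj (\<psi> n x) * \<phi> x)" for n
      using ip_kern[OF sH] kern_L2[OF \<phi> \<psi>(1)] by (simp add: \<psi>(2) mult.commute)
    ultimately have "h \<phi> = of_real c * (LINT x|lborel. cnj (g x) * \<phi> x)"
      using conv[OF test_square_integrable[OF \<phi>]] ip_kern[OF h] LIMSEQ_unique by simp
    then show ?thesis by (simp add: mult.assoc)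
  qed
  define G where "G = (\<lambda>x. of_real c * cnj (g x))"
  have G: "G \<in> square_integrable" unfolding G_def by (intro square_integrable_cmult square_integrable_cnj g)
  have "h = distribution_of G"
  proof
    show "h \<phi> = distribution_of G \<phi>" for \<phi>
      using h_eq[of \<phi>] distribution_not_test[OF mem_distribution[OF h]]
      by (simp add: distribution_of_def G_def)
  qed
  moreover have "ip_norm ip h = L2_norm G / sqrt c"
  proof -
    \<comment> \<open>The squared norm of h is c times that of g, while \<open>G\<close> has c times
      the norm of g; their comparison leaves the factor 1 / sqrt c.\<close>
    have "(\<lambda>n. ip (s n) h) \<longlonglongrightarrow> ip h h" by (rule tendsto_ip[OF sH h h lim])
    moreover have "ip (s n) h = of_real c * cnj (LINT x|lborel. cnj (g x) * \<psi> n x)" for n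
    proof -
      have "ip (s n) h = cnj (h (\<psi> n))" using ip_commute[OF h sH] ip_kern[OF h] by (simp add: \<psi>(2))
      then show ?thesis by (simp add: h_eq[OF \<psi>(1)] mult.assoc)
    qed
    moreover have "cnj (LINT x|lborel. cnj (g x) * \<psi> n x) = (LINT x|lborel. cnj (\<psi> n x) * g x)" for n
      using Bochner_Integration.integral_cnj[of lborel "\<lambda>x. cnj (g x) * \<psi> n x"] by (simp add: mult.commute)
    ultimately have "ip h h = of_real c * (LINT x|lborel. cnj (g x) * g x)"
      using conv[OF g] LIMSEQ_unique by simp
    also have "(LINT x|lborel. cnj (g x) * g x) = of_real (LINT x|lborel. (cmod (g x))\<^sup>2)"
      unfolding integral_complex_of_real[symmetric] complex_norm_square by (simp add: mult.commute)
    finally have "(ip_norm ip h)\<^sup>2 = c * (LINT x|lborel. (cmod (g x))\<^sup>2)" by (simp add: ip_norm_sq[OF h])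
    then have "ip_norm ip h = sqrt (c * (LINT x|lborel. (cmod (g x))\<^sup>2))"
      using ip_norm_nonneg[OF h] by (metis real_sqrt_unique)
    moreover have "L2_norm G = c * sqrt (LINT x|lborel. (cmod (g x))\<^sup>2)"
      using c by (simp add: L2_norm_def G_def norm_mult power_mult_distrib real_sqrt_mult)
    moreover have "c * y / sqrt c = sqrt c * y" for y
      using c by (simp add: field_simps)
    ultimately show ?thesis by (simp add: real_sqrt_mult)
  qed
  ultimately show ?thesis using G that by blast
qed

text \<open>By Cauchy-Schwarz in L2 and the norm formula for \<open>kern\<close>, integration
  against f defines a bounded functional on the kernels. The Riesz vector in H takes the same values
  at test functions as \<open>distribution_of f\<close>.\<close>

lemma square_integrable_is_member:
  assumes f: "f \<in> square_integrable"
  shows "distribution_of f \<in> H"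
proof -
  \<comment> \<open>The functional acts on elements of H, so a preimage under \<open>kern\<close> is
    chosen. The choice does not matter, since test functions with equal kernels have L2 distance 0.
    Conjugation compensates the conjugate linearity of \<open>kern\<close> and makes l
    linear.\<close>
  define l where "l t = cnj (LINT x|lborel. f x * (SOME \<psi>. \<psi> \<in> test_functions \<and> kern \<psi> = t) x)" for t
  note int = square_integrable_mult[OF f test_square_integrable]
  have l: "l (kern \<psi>) = cnj (LINT x|lborel. f x * \<psi> x)" if \<psi>: "\<psi> \<in> test_functions" for \<psi>
  proof -
    define \<eta> where "\<eta> = (SOME \<eta>. \<eta> \<in> test_functions \<and> kern \<eta> = kern \<psi>)"
    have \<eta>: "\<eta> \<in> test_functions" "kern \<eta> = kern \<psi>"
      unfolding \<eta>_def using someI[of "\<lambda>\<eta>. \<eta> \<in> test_functions \<and> kern \<eta> = kern \<psi>" \<psi>] \<psi> by auto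
    have "kern (\<lambda>x. \<eta> x - \<psi> x) = (\<lambda>_. 0)" using kern_diff[OF \<eta>(1) \<psi>] \<eta>(2) by simp
    then have "c * (LINT x|lborel. (cmod (\<eta> x - \<psi> x))\<^sup>2) = 0"
      using kern_norm[OF test_diff[OF \<eta>(1) \<psi>]] ip_norm_sq[OF zero_mem] ip_scale_left[OF zero_mem zero_mem, of 0] by simp
    then have "L2_norm (\<lambda>x. \<eta> x - \<psi> x) = 0" using c by (simp add: L2_norm_def)
    then have "(LINT x|lborel. f x * (\<eta> x - \<psi> x)) = 0"
      using L2_Cauchy_Schwarz[OF f test_square_integrable[OF test_diff[OF \<eta>(1) \<psi>]]] by simp
    then have "(LINT x|lborel. f x * \<eta> x) = (LINT x|lborel. f x * \<psi> x)"
      using int[OF \<eta>(1)] int[OF \<psi>] by (simp add: right_diff_distrib)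
    then show ?thesis by (simp add: l_def \<eta>_def)
  qed
  obtain s :: "nat \<Rightarrow> 'a functional" and h where h: "h \<in> H" and lh: "\<And>t. t \<in> kern ` test_functions \<Longrightarrow> ip t h = l t"
  proof (rule riesz_on_subspace[of "kern ` test_functions" l "L2_norm f / sqrt c"])
    show "kern ` test_functions \<subseteq> H" using kern_mem by blast
    show "l (\<lambda>\<phi>. s \<phi> + b * t \<phi>) = l s + b * l t"
      if st: "s \<in> kern ` test_functions" "t \<in> kern ` test_functions" for s t b
    proof -
      obtain \<phi> \<psi> where T: "\<phi> \<in> test_functions" "\<psi> \<in> test_functions" "s = kern \<phi>" "t = kern \<psi>" using st by blast
      have "l (\<lambda>\<phi>. s \<phi> + b * t \<phi>) = l (kern (\<lambda>x. \<phi> x + cnj b * \<psi> x))"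
        using kern_lin[OF T(1,2), of "cnj b"] by (simp add: T)
      also have "\<dots> = cnj (LINT x|lborel. f x * (\<phi> x + cnj b * \<psi> x))"
        by (rule l[OF test_add[OF T(1) test_cmult[OF T(2)]]])
      also have "(LINT x|lborel. f x * (\<phi> x + cnj b * \<psi> x)) = (LINT x|lborel. f x * \<phi> x + cnj b * (f x * \<psi> x))"
        by (simp add: algebra_simps)
      also have "\<dots> = (LINT x|lborel. f x * \<phi> x) + cnj b * (LINT x|lborel. f x * \<psi> x)"
        using int[OF T(1)] int[OF T(2)] by simp
      finally show ?thesis using l[OF T(1)] l[OF T(2)] by (simp add: T)
    qed
    show "cmod (l s) \<le> L2_norm f / sqrt c * ip_norm ip s" if sk: "s \<in> kern ` test_functions" for s
    proof -
      obtain \<psi> where T: "\<psi> \<in> test_functions" "s = kern \<psi>" using sk by blast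
      then show ?thesis
        using L2_Cauchy_Schwarz[OF f test_square_integrable[OF T(1)]] c by (simp add: l kern_norm_L2)
    qed
  qed (use kern_image_subspace zero_in_kern_image in auto)
  have "h = distribution_of f"
  proof
    show "h \<phi> = distribution_of f \<phi>" for \<phi>
    proof (cases "\<phi> \<in> test_functions")
      case True
      then have "ip (kern \<phi>) h = cnj (LINT x|lborel. f x * \<phi> x)" using lh l by simp
      then have "h \<phi> = (LINT x|lborel. f x * \<phi> x)"
        using ip_commute[OF kern_mem h] ip_kern[OF h] by (metis complex_cnj_cnj)
      then show ?thesis using True by (simp add: distribution_of_def)
    qed (use distribution_not_test[OF mem_distribution[OF h]] in \<open>simp add: distribution_of_def\<close>)
  qed
  then show ?thesis using h by simp
qed

text \<open>The norm formula is known for some function g that represents the same distribution as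
  f; the two agree almost everywhere, so their L2 norms coincide.\<close>

lemma norm_distribution_of:
  assumes f: "f \<in> square_integrable"
  shows "ip_norm ip (distribution_of f) = L2_norm f / sqrt c"
proof -
  obtain g where g: "g \<in> square_integrable" "distribution_of f = distribution_of g"
    "ip_norm ip (distribution_of f) = L2_norm g / sqrt c"
    using member_is_square_integrable[OF square_integrable_is_member[OF f]] .
  have "AE x in lborel. f x - g x = 0"
  proof (rule du_Bois_Reymond[OF square_integrable_diff[OF f g(1)]])
    fix \<phi> :: "'a \<Rightarrow> complex" assume \<phi>: "\<phi> \<in> test_functions"
    have "(LINT x|lborel. f x * \<phi> x) = (LINT x|lborel. g x * \<phi> x)"
      using fun_cong[OF g(2), of \<phi>] \<phi> by (simp add: distribution_of_def)
    then show "(LINT x|lborel. (f x - g x) * \<phi> x) = 0"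
      using square_integrable_mult[OF f test_square_integrable[OF \<phi>]]
        square_integrable_mult[OF g(1) test_square_integrable[OF \<phi>]]
      by (simp add: left_diff_distrib)
  qed
  then have "(LINT x|lborel. (cmod (f x))\<^sup>2) = (LINT x|lborel. (cmod (g x))\<^sup>2)"
    using square_integrable_borel[OF f] square_integrable_borel[OF g(1)]
    by (intro integral_cong_AE) (auto elim!: eventually_mono)
  then show ?thesis using g(3) by (simp add: L2_norm_def)
qed

end

lemma eq_L2:
  assumes "\<exists>f\<in>H. f \<noteq> (\<lambda>_. 0)"
  shows "H = distribution_of ` square_integrable \<and>
         (\<exists>c>0. \<forall>f\<in>square_integrable. ip_norm ip (distribution_of f) = c * L2_norm f)"
proof -
  obtain c where c: "c > 0" and k: "\<And>\<psi> \<eta>. \<psi> \<in> test_functions \<Longrightarrow> \<eta> \<in> test_functions \<Longrightarrow>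
      kern \<eta> \<psi> = of_real c * (LINT x|lborel. \<psi> x * cnj (\<eta> x))"
    using kern_eq_L2_product[OF assms] by blast
  have "H \<subseteq> distribution_of ` square_integrable"
  proof
    fix h assume "h \<in> H"
    from member_is_square_integrable[OF c k this] show "h \<in> distribution_of ` square_integrable" by blast
  qed
  moreover have "distribution_of ` square_integrable \<subseteq> H"
    using square_integrable_is_member[OF c k] by blast
  moreover have "\<forall>f\<in>square_integrable. ip_norm ip (distribution_of f) = 1 / sqrt c * L2_norm f"
    using norm_distribution_of[OF c k] by simp
  moreover have "1 / sqrt c > 0" using c by simp
  ultimately show ?thesis by blast
qed

end

theorem theorem2p2:
  fixes H :: "(real ^ 'n) functional set"
    and ip :: "(real ^ 'n) functional \<Rightarrow> (real ^ 'n) functional \<Rightarrow> complex"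
    and \<phi> :: "real ^ 'n \<Rightarrow> complex"
  assumes "hilbert_distribution_space H ip"
    and "tm_invariant H ip"
    and "\<phi> \<in> schwartz_functions" and "\<phi> \<noteq> (\<lambda>_. 0)"
    and "\<exists>f\<in>H. f \<in> feichtinger_algebra \<phi> \<and> f \<noteq> (\<lambda>_. 0)"
    and "continuously_embedded H ip"
  shows "H = distribution_of ` square_integrable \<and>
         (\<exists>c>0. \<forall>f\<in>square_integrable. ip_norm ip (distribution_of f) = c * L2_norm f)"
proof -
  interpret hilbert_distribution_space H ip by (rule assms(1))
  interpret tm_invariant_hilbert_space H ip
    by unfold_locales (rule assms(6), rule assms(2))
  show ?thesis using assms(5) by (intro eq_L2) blast
qed

end
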